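(* Let $F\in H^2(T_{\Gamma_1})$ and let $\mathcal D$ be the dictionary of all normalized functions $\psi_{\alpha,z}=\phi_{\alpha,z}/\|\phi_{\alpha,z}\|$, with $\alpha$ an $n$-tuple of non-negative integers and $z\in T_{\Gamma_1}$. Define remainders by $R^0F=F$ and, for $l\ge1$, $$R^lF=R^{l-1}F-\langle R^{l-1}F,\psi_{\alpha^{(l)},z^{(l)}}\rangle\,\psi_{\alpha^{(l)},z^{(l)}},$$ where $\psi_{\alpha^{(l)},z^{(l)}}\in\mathcal D$ is chosen so that $$|\langle R^{l-1}F,\psi_{\alpha^{(l)},z^{(l)}}\rangle|=\sup_{\psi_{\alpha,z}\in\mathcal D}|\langle R^{l-1}F,\psi_{\alpha,z}\rangle| .$$ Then such an optimal $\psi_{\alpha^{(l)},z^{(l)}}$ exists at every step $l\ge1$, and $$\lim_{m\to\infty}\|R^mF\|=0 .$$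
   Context: $\Gamma_1=\{y\in\mathbb R^n: y_1>0,\dots,y_n>0\}$, $T_{\Gamma_1}=\{x+iy: x\in\mathbb R^n,\ y\in\Gamma_1\}\subset\mathbb C^n$. $H^2(T_{\Gamma_1})$ is the space of holomorphic $F$ on $T_{\Gamma_1}$ with $\|F\|^2=\sup_{y\in\Gamma_1}\int_{\mathbb R^n}|F(x+iy)|^2dx<\infty$; it is a Hilbert space with inner product $\langle F,G\rangle=\int_{\mathbb R^n}F(\xi)\overline{G(\xi)}\,d\xi$, where $F(\xi)=\lim_{\eta\in\Gamma_1,\eta\to0}F(\xi+i\eta)$ is the $L^2$ boundary limit. Its reproducing kernel is $K_{\Gamma_1}(w,\overline z)=\prod_{k=1}^n\frac{-1}{2\pi i(w_k-\overline z_k)}$. For $z\in T_{\Gamma_1}$, $$\phi_{\alpha,z}(w)=\frac{\partial^{|\alpha|}K_{\Gamma_1}(w,\overline z)}{\partial\overline z_1^{\alpha_1}\cdots\partial\overline z_n^{\alpha_n}}=\Big(\frac{-1}{2\pi i}\Big)^n\prod_{j=1}^n\frac{\alpha_j!}{(w_j-\overline z_j)^{\alpha_j+1}} .$$ *)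

theory Defs
  imports "HOL-Complex_Analysis.Complex_Analysis"
begin

definition octant :: "(real^'n) set" where
  "octant = {y. \<forall>k. 0 < y $ k}"

definition cvec :: "real^'n \<Rightarrow> real^'n \<Rightarrow> complex^'n" where
  "cvec x y = (\<chi> k. Complex (x $ k) (y $ k))"

definition tube :: "(complex^'n) set" where
  "tube = {cvec x y | x y. y \<in> octant}"

text \<open>Holomorphy in several variables, on an open set: the real Frechet derivative exists
  and is complex-linear.\<close>

definition holomorphic_Cn_on :: "(complex^'n \<Rightarrow> complex) \<Rightarrow> (complex^'n) set \<Rightarrow> bool" where
  "holomorphic_Cn_on F S \<longleftrightarrow>
     (\<forall>z\<in>S. \<exists>c :: complex^'n. (F has_derivative (\<lambda>h. \<Sum>k\<in>UNIV. c $ k * h $ k)) (at z))"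

text \<open>The space consists of total functions of which only the values on the tube matter. The
  real-valued \<open>H2_norm\<close> is meaningful on \<open>H2\<close> only: it is 0 when the energy is infinite.\<close>

definition H2_energy :: "(complex^'n \<Rightarrow> complex) \<Rightarrow> ennreal" where
  "H2_energy F = (SUP y\<in>octant. \<integral>\<^sup>+ x. ennreal ((cmod (F (cvec x y)))\<^sup>2) \<partial>lborel)"

definition H2 :: "(complex^'n \<Rightarrow> complex) set" where
  "H2 = {F. holomorphic_Cn_on F tube \<and> H2_energy F < \<infinity>}"

definition H2_norm :: "(complex^'n \<Rightarrow> complex) \<Rightarrow> real" where
  "H2_norm F = sqrt (enn2real (H2_energy F))"

text \<open>The boundary limit is the limit in mean square as the imaginary part tends to the
  origin within the octant. It is determined up to a null set only, which the inner product
  does not see.\<close>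

definition is_boundary_limit :: "(complex^'n \<Rightarrow> complex) \<Rightarrow> (real^'n \<Rightarrow> complex) \<Rightarrow> bool" where
  "is_boundary_limit F g \<longleftrightarrow>
     g \<in> borel_measurable lborel \<and>
     (\<integral>\<^sup>+ \<xi>. ennreal ((cmod (g \<xi>))\<^sup>2) \<partial>lborel) < \<infinity> \<and>
     ((\<lambda>\<eta>. \<integral>\<^sup>+ \<xi>. ennreal ((cmod (F (cvec \<xi> \<eta>) - g \<xi>))\<^sup>2) \<partial>lborel) \<longlongrightarrow> 0) (at 0 within octant)"

definition boundary_limit :: "(complex^'n \<Rightarrow> complex) \<Rightarrow> real^'n \<Rightarrow> complex" where
  "boundary_limit F = (SOME g. is_boundary_limit F g)"

definition H2_inner :: "(complex^'n \<Rightarrow> complex) \<Rightarrow> (complex^'n \<Rightarrow> complex) \<Rightarrow> complex" where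
  "H2_inner F G = (\<integral>\<xi>. boundary_limit F \<xi> * cnj (boundary_limit G \<xi>) \<partial>lborel)"

text \<open>\<open>kernel w z\<close> is $K(w,\overline z)$: the conjugation is part of the definition.\<close>

definition kernel :: "complex^'n \<Rightarrow> complex^'n \<Rightarrow> complex" where
  "kernel w z = (\<Prod>k\<in>UNIV. - 1 / (2 * complex_of_real pi * \<i> * (w $ k - cnj (z $ k))))"

text \<open>The Wirtinger operator $\partial/\partial\overline z_j
  = \frac12(\partial/\partial x_j + i\,\partial/\partial y_j)$.\<close>

definition dbar :: "'n \<Rightarrow> (complex^'n \<Rightarrow> complex) \<Rightarrow> complex^'n \<Rightarrow> complex" where
  "dbar j f z =
     (vector_derivative (\<lambda>t. f (z + axis j (of_real t))) (at 0)
      + \<i> * vector_derivative (\<lambda>t. f (z + axis j (\<i> * of_real t))) (at 0)) / 2"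

text \<open>Iterated derivatives are taken along an arbitrary enumeration of the coordinates; for the
  kernel the order is immaterial, see \<open>phi_eq\<close> below.\<close>

definition dbar_multi :: "nat^'n \<Rightarrow> (complex^'n \<Rightarrow> complex) \<Rightarrow> complex^'n \<Rightarrow> complex" where
  "dbar_multi \<alpha> f = foldr (\<lambda>j. dbar j ^^ (\<alpha> $ j)) (SOME js. distinct js \<and> set js = UNIV) f"

definition phi :: "nat^'n \<Rightarrow> complex^'n \<Rightarrow> complex^'n \<Rightarrow> complex" where
  "phi \<alpha> z w = dbar_multi \<alpha> (kernel w) z"

definition psi :: "nat^'n \<Rightarrow> complex^'n \<Rightarrow> complex^'n \<Rightarrow> complex" where
  "psi \<alpha> z w = phi \<alpha> z w / of_real (H2_norm (phi \<alpha> z))"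

definition dictionary :: "(complex^'n \<Rightarrow> complex) set" where
  "dictionary = {psi \<alpha> z | \<alpha> z. z \<in> tube}"

definition optimal_choice :: "(complex^'n \<Rightarrow> complex) \<Rightarrow> nat^'n \<Rightarrow> complex^'n \<Rightarrow> bool" where
  "optimal_choice G \<alpha> z \<longleftrightarrow>
     z \<in> tube \<and>
     ennreal (cmod (H2_inner G (psi \<alpha> z))) = (SUP \<psi>\<in>dictionary. ennreal (cmod (H2_inner G \<psi>)))"

text \<open>The sequences of parameters are indexed from 1; their values at 0 are not used.\<close>

primrec remainder ::
  "(complex^'n \<Rightarrow> complex) \<Rightarrow> (nat \<Rightarrow> nat^'n) \<Rightarrow> (nat \<Rightarrow> complex^'n) \<Rightarrow> nat \<Rightarrow> complex^'n \<Rightarrow> complex"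
where
  "remainder F \<alpha> z 0 = F"
| "remainder F \<alpha> z (Suc l) = (\<lambda>w. remainder F \<alpha> z l w
     - H2_inner (remainder F \<alpha> z l) (psi (\<alpha> (Suc l)) (z (Suc l))) * psi (\<alpha> (Suc l)) (z (Suc l)) w)"

lemma tube_iff: "z \<in> tube \<longleftrightarrow> (\<forall>k. 0 < Im (z $ k))"
proof
  assume "\<forall>k. 0 < Im (z $ k)"
  then have "z = cvec (\<chi> k. Re (z $ k)) (\<chi> k. Im (z $ k)) \<and> (\<chi> k. Im (z $ k)) \<in> octant"
    by (simp add: cvec_def octant_def vec_eq_iff)
  then show "z \<in> tube" unfolding tube_def by blast
qed (auto simp: tube_def cvec_def octant_def)

definition phi_form :: "complex^'n \<Rightarrow> ('n \<Rightarrow> nat) \<Rightarrow> complex^'n \<Rightarrow> complex" where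
  "phi_form w \<beta> z = (- 1 / (2 * complex_of_real pi * \<i>)) ^ CARD('n)
     * (\<Prod>k\<in>UNIV. fact (\<beta> k) / (w $ k - cnj (z $ k)) ^ (\<beta> k + 1))"

lemma deriv_aux:
  fixes a b :: complex
  assumes "a - cnj b \<noteq> 0"
  shows "((\<lambda>u. fact m / (a - u) ^ (m + 1)) has_field_derivative
          fact (Suc m) / (a - cnj b) ^ (Suc m + 1)) (at (cnj b))"
proof -
  define x where "x = a - cnj b"
  have x: "x \<noteq> 0" using assms by (simp add: x_def)
  have "((\<lambda>u. a - u) has_field_derivative (- 1)) (at (cnj b))"
    by (auto intro!: derivative_eq_intros)
  from DERIV_power[OF this, of "Suc m"]
  have "((\<lambda>u. (a - u) ^ Suc m) has_field_derivative (of_nat (Suc m) * (- 1 * x ^ m))) (at (cnj b))"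
    by (simp only: x_def diff_Suc_Suc diff_zero)
  from DERIV_divide[OF DERIV_const this, of "fact m"] x
  have "((\<lambda>u. fact m / (a - u) ^ Suc m) has_field_derivative
      (0 * x ^ Suc m - fact m * (of_nat (Suc m) * (- 1 * x ^ m))) / (x ^ Suc m * x ^ Suc m)) (at (cnj b))"
    using assms by (simp add: x_def)
  moreover have "(0 * x ^ Suc m - fact m * (of_nat (Suc m) * (- 1 * x ^ m))) / (x ^ Suc m * x ^ Suc m)
      = fact (Suc m) / x ^ (Suc m + 1)"
    using x by (simp add: field_simps)
  ultimately show ?thesis by (simp add: x_def)
qed

lemma dbar_phi_form:
  fixes w z :: "complex^'n"
  assumes f: "\<And>z. z \<in> tube \<Longrightarrow> f z = phi_form w \<beta> z" and w: "w \<in> tube" and z: "z \<in> tube"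
  shows "dbar j f z = phi_form w (\<beta>(j := Suc (\<beta> j))) z"
proof -
  define C where "C = (- 1 / (2 * complex_of_real pi * \<i>)) ^ CARD('n)
     * (\<Prod>k\<in>UNIV - {j}. fact (\<beta> k) / (w $ k - cnj (z $ k)) ^ (\<beta> k + 1))"
  define h where "h = (\<lambda>u. fact (\<beta> j) / (w $ j - u) ^ (\<beta> j + 1))"
  define D where "D = (fact (Suc (\<beta> j)) / (w $ j - cnj (z $ j)) ^ (Suc (\<beta> j) + 1))"
  have ne: "w $ j - cnj (z $ j) \<noteq> 0"
  proof
    assume "w $ j - cnj (z $ j) = 0"
    then have "Im (w $ j - cnj (z $ j)) = 0" by simp
    then have "Im (w $ j) + Im (z $ j) = 0" by simp
    then show False using w z unfolding tube_iff by (smt (verit))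
  qed
  have h': "(h has_field_derivative D) (at (cnj (z $ j)))"
    unfolding h_def D_def by (rule deriv_aux[OF ne])
  have prod_split: "(\<Prod>k\<in>UNIV. g k) = g j * (\<Prod>k\<in>UNIV - {j}. g k)" for g :: "'n \<Rightarrow> complex"
    by (simp add: prod.remove)
  have form: "phi_form w \<beta> (z + axis j s) = C * h (cnj (z $ j + s))" for s
    unfolding phi_form_def C_def h_def
    by (subst prod_split) (auto simp: axis_def intro!: prod.cong)
  have target: "phi_form w (\<beta>(j := Suc (\<beta> j))) z = C * D"
    unfolding phi_form_def C_def D_def
    by (subst prod_split) (auto intro!: prod.cong)
  have der: "vector_derivative (\<lambda>t. f (z + axis j (s * of_real t))) (at 0) = C * (D * cnj s)" for s
  proof (rule vector_derivative_at)
    have d1: "((\<lambda>t. cnj (z $ j + s * of_real t)) has_vector_derivative cnj s) (at 0)"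
      by (auto intro!: derivative_eq_intros)
    have "((h \<circ> (\<lambda>t. cnj (z $ j + s * of_real t))) has_vector_derivative (cnj s * D)) (at 0)"
      by (rule field_vector_diff_chain_at[OF d1]) (use h' in simp)
    then have d2: "((\<lambda>t. C * h (cnj (z $ j + s * of_real t))) has_vector_derivative C * (D * cnj s)) (at 0)"
      using has_vector_derivative_mult_right[of "\<lambda>t. h (cnj (z $ j + s * of_real t))" "cnj s * D"]
      by (simp add: o_def mult.commute)
    have "((\<lambda>t. Im (z $ j + s * complex_of_real t)) \<longlongrightarrow> Im (z $ j + s * of_real 0)) (at 0)"
      by (intro tendsto_intros)
    then have "\<forall>\<^sub>F t in at 0. 0 < Im (z $ j + s * complex_of_real t)"
      using z by (intro order_tendstoD) (auto simp: tube_iff)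
    then have ev: "\<forall>\<^sub>F t in nhds 0. 0 < Im (z $ j + s * complex_of_real t)"
      using z by (auto simp: eventually_at_filter tube_iff elim!: eventually_mono)
    have "\<forall>\<^sub>F t in nhds 0. f (z + axis j (s * of_real t)) = C * h (cnj (z $ j + s * of_real t))"
      using ev
    proof eventually_elim
      case (elim t)
      have "z + axis j (s * of_real t) \<in> tube"
        using z elim by (auto simp: tube_iff axis_def)
      then show ?case by (simp add: f form)
    qed
    then have ev1: "\<forall>\<^sub>F t in nhds 0. C * h (cnj (z $ j + s * of_real t)) = f (z + axis j (s * of_real t))"
      by eventually_elim simp
    have ev2: "\<forall>\<^sub>F t in at 0. C * h (cnj (z $ j + s * of_real t)) = f (z + axis j (s * of_real t))"
      using ev1 unfolding eventually_at_filter by eventually_elim simp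
    show "((\<lambda>t. f (z + axis j (s * of_real t))) has_vector_derivative C * (D * cnj s)) (at 0)"
      using has_derivative_transform_eventually[OF d2[unfolded has_vector_derivative_def] ev2]
        eventually_nhds_x_imp_x[OF ev1] unfolding has_vector_derivative_def by simp
  qed
  show ?thesis
    using der[of 1] der[of \<i>] unfolding dbar_def target by (simp add: algebra_simps)
qed

lemma dbar_pow_phi_form:
  fixes w z :: "complex^'n"
  assumes f: "\<And>z. z \<in> tube \<Longrightarrow> f z = phi_form w \<beta> z" and w: "w \<in> tube" and z: "z \<in> tube"
  shows "(dbar j ^^ m) f z = phi_form w (\<beta>(j := \<beta> j + m)) z"
  using z
proof (induction m arbitrary: z)
  case (Suc m)
  have "dbar j ((dbar j ^^ m) f) z
      = phi_form w ((\<beta>(j := \<beta> j + m))(j := Suc ((\<beta>(j := \<beta> j + m)) j))) z"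
    by (rule dbar_phi_form) (rule Suc.IH w Suc.prems, assumption?)+
  also have "(\<beta>(j := \<beta> j + m))(j := Suc ((\<beta>(j := \<beta> j + m)) j)) = \<beta>(j := \<beta> j + Suc m)"
    by auto
  finally show ?case by simp
qed (simp add: f)

lemma phi_eq:
  fixes w z :: "complex^'n"
  assumes w: "w \<in> tube" and z: "z \<in> tube"
  shows "phi \<alpha> z w = (- 1 / (2 * complex_of_real pi * \<i>)) ^ CARD('n)
     * (\<Prod>j\<in>UNIV. fact (\<alpha> $ j) / (w $ j - cnj (z $ j)) ^ (\<alpha> $ j + 1))"
proof -
  have ker: "kernel w z = phi_form w (\<lambda>_. 0) z" for z
  proof -
    have "kernel w z = (\<Prod>k\<in>UNIV. (- 1 / (2 * complex_of_real pi * \<i>)) * (1 / (w $ k - cnj (z $ k))))"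
      unfolding kernel_def by (intro prod.cong) auto
    also have "\<dots> = phi_form w (\<lambda>_. 0) z"
      unfolding phi_form_def by (subst prod.distrib) simp
    finally show ?thesis .
  qed
  have fold: "foldr (\<lambda>j. dbar j ^^ (\<alpha> $ j)) js (kernel w) z
      = phi_form w (\<lambda>j. if j \<in> set js then \<alpha> $ j else 0) z"
    if "distinct js" "z \<in> tube" for js z
    using that
  proof (induction js arbitrary: z)
    case (Cons j js)
    let ?b = "\<lambda>j. if j \<in> set js then \<alpha> $ j else 0"
    have "(dbar j ^^ (\<alpha> $ j)) (foldr (\<lambda>j. dbar j ^^ (\<alpha> $ j)) js (kernel w)) z
        = phi_form w (?b(j := ?b j + \<alpha> $ j)) z"
      by (rule dbar_pow_phi_form) (use Cons w in auto)
    also have "?b(j := ?b j + \<alpha> $ j) = (\<lambda>i. if i \<in> set (j # js) then \<alpha> $ i else 0)"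
      using Cons.prems by auto
    finally show ?case by simp
  qed (simp add: ker)
  define js where "js = (SOME js :: 'n list. distinct js \<and> set js = UNIV)"
  have "\<exists>js :: 'n list. distinct js \<and> set js = UNIV"
    using finite_distinct_list[of "UNIV :: 'n set"] by auto
  then have "distinct js \<and> set js = UNIV"
    unfolding js_def by (rule someI_ex)
  then show ?thesis
    using fold[of js z] z unfolding phi_def dbar_multi_def js_def[symmetric] phi_form_def by simp
qed

end

(* The mean square N(y) of F over the slice of height y satisfies <F(.+iy), F(.+iy')> = N((y+y')/2),
   by shifting the height of integration.  Hence N is midpoint convex and bounded, so it decreases,
   and the slices are Cauchy in L2 as y tends to 0: this gives the boundary limit, with
   ||F||^2 = <F, F>.  Cauchy's formula, applied one coordinate at a time, shows that F is reproduced
   by phi_0, and an explicit integral gives the inner products of dictionary elements.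

   Existence of an optimum: psi_{alpha,z} becomes almost orthogonal to every fixed dictionary element
   as (alpha, z) leaves all compact sets of parameters.  Infinitely many almost orthogonal unit
   vectors cannot keep a correlation bounded below with one vector G, so |<G, psi_{alpha,z}>| tends
   to 0 at infinity and a positive supremum is attained on a compact set.

   Convergence: by Jones' argument the remainders are Cauchy and their correlations with the
   dictionary tend to 0.  By the reproducing formula they then tend to 0 pointwise, and Fatou's lemma
   turns this into convergence in norm. *)

theory Submission
  imports Defs
begin

text \<open>Three obstacles shape the proof. The parameters range over a noncompact set in z and in
  \<alpha> together, so decay in \<alpha> must be uniform in z. For every index some z balances the
  geometric factor of a correlation at its maximum, so the decay has to come from the factorials;
  Wallis' estimate leaves, in each coordinate, a factor of order 1/sqrt(\<alpha>_k). Finite energy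
  gives no decay of F along a single coordinate, while Cauchy's formula on a line needs it. F is
  therefore moved up into the tube, where the mean value property bounds it, and its kernel is
  multiplied by a decaying factor that is removed by dominated convergence. The shift of height
  rests on F(x + i y + \<zeta> s) times the conjugate of F(x + i y' + cnj \<zeta> s) being
  holomorphic in \<zeta>: moving \<zeta> from 0 to i raises one slice and lowers the other by s.
  Totality of the dictionary enters only through point evaluation: the functions with \<alpha> = 0
  already detect every value of F on the tube.\<close>

unbundle no Formal_Power_Series.fps_syntax

subsection \<open>Greedy approximation in semi-inner product spaces\<close>

text \<open>Vectors are functions, not classes of functions, so the form may vanish on nonzero ones:
  \<open>L2_inner\<close> ignores null sets and \<open>H2_inner\<close> ignores values off the tube.
  The single operation F + c * G covers sums, differences and multiples, with zero as F - F.\<close>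

locale semi_inner_space =
  fixes V :: "('x \<Rightarrow> complex) set" and ip :: "('x \<Rightarrow> complex) \<Rightarrow> ('x \<Rightarrow> complex) \<Rightarrow> complex"
  assumes lin_closed: "\<And>F G c. F \<in> V \<Longrightarrow> G \<in> V \<Longrightarrow> (\<lambda>w. F w + c * G w) \<in> V"
    and ip_lin: "\<And>F G K c. F \<in> V \<Longrightarrow> G \<in> V \<Longrightarrow> K \<in> V \<Longrightarrow> ip (\<lambda>w. F w + c * G w) K = ip F K + c * ip G K"
    and ip_cnj: "\<And>F G. F \<in> V \<Longrightarrow> G \<in> V \<Longrightarrow> ip G F = cnj (ip F G)"
    and ip_nonneg: "\<And>F. F \<in> V \<Longrightarrow> 0 \<le> Re (ip F F)"
begin

definition nsq :: "('x \<Rightarrow> complex) \<Rightarrow> real" where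
  "nsq F = Re (ip F F)"

lemma ip_lin_right:
  assumes "F \<in> V" "G \<in> V" "K \<in> V"
  shows "ip K (\<lambda>w. F w + c * G w) = ip K F + cnj c * ip K G"
  using ip_lin[OF assms, of c] ip_cnj[OF lin_closed[OF assms(1,2), of c] assms(3)]
    ip_cnj[OF assms(1,3)] ip_cnj[OF assms(2,3)]
  by simp

lemma ip_self: "F \<in> V \<Longrightarrow> ip F F = of_real (nsq F)"
  using ip_cnj[of F F] by (simp add: nsq_def complex_eq_iff)

lemma nsq_nonneg: "F \<in> V \<Longrightarrow> 0 \<le> nsq F"
  by (simp add: nsq_def ip_nonneg)

lemma nsq_lin:
  assumes "F \<in> V" "G \<in> V"
  shows "nsq (\<lambda>w. F w + c * G w) = nsq F + 2 * Re (cnj c * ip F G) + (cmod c)\<^sup>2 * nsq G"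
proof -
  have "ip (\<lambda>w. F w + c * G w) (\<lambda>w. F w + c * G w)
      = ip F F + c * ip G F + cnj c * (ip F G + c * ip G G)"
    by (simp add: ip_lin_right ip_lin lin_closed assms)
  also have "\<dots> = ip F F + (c * cnj (ip F G) + cnj c * ip F G) + (c * cnj c) * ip G G"
    by (simp add: ip_cnj[OF assms] algebra_simps)
  also have "\<dots> = of_real (nsq F + 2 * Re (cnj c * ip F G) + (cmod c)\<^sup>2 * nsq G)"
    by (simp add: ip_self assms complex_eq_iff cmod_power2) (simp add: power2_eq_square algebra_simps)
  finally show ?thesis by (simp add: nsq_def)
qed

text \<open>The multiplier t * \<open>ip F G\<close> with t real makes the cross term real and
  leaves a quadratic in t that is never negative. If \<open>nsq G\<close> is 0 it is affine, so its
  slope must vanish; otherwise t = -1 / \<open>nsq G\<close> minimises it.\<close>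

lemma Cauchy_Schwarz_ip:
  assumes "F \<in> V" "G \<in> V"
  shows "(cmod (ip F G))\<^sup>2 \<le> nsq F * nsq G"
proof -
  let ?b = "(cmod (ip F G))\<^sup>2"
  have quad: "0 \<le> nsq F + 2 * t * ?b + t\<^sup>2 * ?b * nsq G" for t :: real
  proof -
    have e: "cnj (of_real t * ip F G) * ip F G = of_real (t * ?b)"
      by (simp add: complex_norm_square mult_ac del: of_real_power)
    show ?thesis
      using nsq_nonneg[OF lin_closed[OF assms, of "of_real t * ip F G"]]
      unfolding nsq_lin[OF assms] e by (simp add: norm_mult power_mult_distrib)
  qed
  show ?thesis
  proof (cases "nsq G = 0")
    case True
    show ?thesis
    proof (rule ccontr)
      assume "\<not> ?thesis"
      then have b: "?b > 0" using True by (simp del: zero_less_power2 zero_less_norm_iff)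
      have "0 \<le> nsq F + 2 * (- (nsq F + 1) / (2 * ?b)) * ?b"
        using quad[of "- (nsq F + 1) / (2 * ?b)"] True by simp
      then show False using b by (simp add: field_simps)
    qed
  next
    case False
    then have G: "nsq G > 0" using nsq_nonneg[OF assms(2)] by simp
    have "0 \<le> nsq F - ?b / nsq G"
      using quad[of "- 1 / nsq G"] G by (simp add: field_simps power2_eq_square)
    then show ?thesis using G by (simp add: field_simps)
  qed
qed

text \<open>The parallelogram identity with the nonnegative term \<open>nsq\<close> of F - c * G
  dropped.\<close>

lemma nsq_add_le:
  assumes "F \<in> V" "G \<in> V" "cmod c = 1"
  shows "nsq (\<lambda>w. F w + c * G w) \<le> 2 * nsq F + 2 * nsq G"
  using nsq_nonneg[OF lin_closed[OF assms(1,2), of "- c"]] assms(3)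
  unfolding nsq_lin[OF assms(1,2)] by simp

lemma zero_mem: "F \<in> V \<Longrightarrow> (\<lambda>w. 0) \<in> V"
  using lin_closed[of F F "-1"] by simp

lemma ip_zero: "F \<in> V \<Longrightarrow> ip (\<lambda>w. 0) F = 0"
  using ip_lin[of F F F "-1"] by simp

lemma ip_sum:
  assumes "finite S" "\<And>i. i \<in> S \<Longrightarrow> e i \<in> V" "K \<in> V"
  shows "(\<lambda>w. \<Sum>i\<in>S. c i * e i w) \<in> V \<and> ip (\<lambda>w. \<Sum>i\<in>S. c i * e i w) K = (\<Sum>i\<in>S. c i * ip (e i) K)"
  using assms(1,2)
proof (induction S)
  case empty
  then show ?case using assms(3) by (simp add: zero_mem ip_zero)
next
  case (insert x S)
  then show ?case
    using lin_closed[of "\<lambda>w. \<Sum>i\<in>S. c i * e i w" "e x" "c x"]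
      ip_lin[of "\<lambda>w. \<Sum>i\<in>S. c i * e i w" "e x" K "c x"] assms(3)
    by (simp add: add.commute)
qed

text \<open>Almost orthogonal unit vectors cannot all correlate with one vector: with \<open>N\<close> of them,
  pairwise almost orthogonal, \<open>G\<close> minus a small multiple of its projection would have negative
  square norm.\<close>

lemma almost_orthogonal_imp_weakly_null:
  fixes e :: "nat \<Rightarrow> 'x \<Rightarrow> complex"
  assumes eV: "\<And>k. e k \<in> V" and unit: "\<And>k. nsq (e k) = 1" and G: "G \<in> V"
    and orth: "\<And>i. (\<lambda>k. ip (e i) (e k)) \<longlonglongrightarrow> 0"
  shows "(\<lambda>k. ip G (e k)) \<longlonglongrightarrow> 0"
proof (rule ccontr)
  assume "\<not> ?thesis"
  then obtain \<delta> where \<delta>: "\<delta> > 0" and fr0: "\<not> (\<forall>\<^sub>F k in sequentially. cmod (ip G (e k)) < \<delta>)"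
    unfolding tendsto_iff dist_norm by auto
  then have fr: "\<exists>\<^sub>F k in sequentially. \<delta> \<le> cmod (ip G (e k))"
    by (simp add: frequently_def not_le)
  define g where "g = nsq G"
  have cs: "(cmod (ip G (e k)))\<^sup>2 \<le> g" for k
    using Cauchy_Schwarz_ip[OF G eV[of k]] by (simp add: unit g_def)
  have g: "g > 0"
  proof -
    obtain k where "\<delta> \<le> cmod (ip G (e k))" using fr frequently_ex by blast
    then have "0 < (cmod (ip G (e k)))\<^sup>2" using \<delta> by (intro zero_less_power) linarith
    then show ?thesis using cs[of k] by linarith
  qed
  \<comment> \<open>All late vectors are almost orthogonal to the finitely many already chosen, and
    infinitely many of them correlate with \<open>G\<close>; so the choice can always be extended by
    one.\<close>
  have pick: "\<exists>S. finite S \<and> card S = m \<and> (\<forall>i\<in>S. \<delta> \<le> cmod (ip G (e i)))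
      \<and> (\<forall>i\<in>S. \<forall>j\<in>S. i \<noteq> j \<longrightarrow> cmod (ip (e i) (e j)) \<le> \<epsilon>)" if "\<epsilon> > 0" for m and \<epsilon> :: real
  proof (induction m)
    case 0
    show ?case by (intro exI[of _ "{}"]) simp
  next
    case (Suc m)
    then obtain S where S: "finite S" "card S = m" "\<forall>i\<in>S. \<delta> \<le> cmod (ip G (e i))"
      "\<forall>i\<in>S. \<forall>j\<in>S. i \<noteq> j \<longrightarrow> cmod (ip (e i) (e j)) \<le> \<epsilon>" by blast
    have "\<forall>\<^sub>F k in sequentially. \<forall>i\<in>S. cmod (ip (e i) (e k)) < \<epsilon> \<and> i < k"
    proof (intro eventually_ball_finite S(1) ballI eventually_conj eventually_gt_at_top)
      fix i show "\<forall>\<^sub>F k in sequentially. cmod (ip (e i) (e k)) < \<epsilon>"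
        using orth[of i] that unfolding tendsto_iff dist_norm by simp
    qed
    then have "\<exists>\<^sub>F k in sequentially. (\<forall>i\<in>S. cmod (ip (e i) (e k)) < \<epsilon> \<and> i < k) \<and> \<delta> \<le> cmod (ip G (e k))"
      by (rule frequently_eventually_conj[OF fr])
    then obtain k where k: "\<delta> \<le> cmod (ip G (e k))" "\<forall>i\<in>S. cmod (ip (e i) (e k)) < \<epsilon> \<and> i < k"
      by (auto dest!: frequently_ex)
    have sym: "cmod (ip (e k) (e i)) = cmod (ip (e i) (e k))" for i
      by (subst ip_cnj[OF eV eV]) simp
    have "k \<notin> S" using k(2) by blast
    then have "card (insert k S) = Suc m" using S(1,2) by simp
    moreover have "cmod (ip (e i) (e j)) \<le> \<epsilon>" if ij: "i \<in> insert k S" "j \<in> insert k S" "i \<noteq> j" for i j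
    proof -
      consider "i \<in> S" "j \<in> S" | "i = k" "j \<in> S" | "i \<in> S" "j = k" using ij by blast
      then show ?thesis
        using S(4) k(2) ij(3) sym[of j] by cases (simp, metis less_imp_le, metis less_imp_le)
    qed
    ultimately show ?case
      using S(1,3) k(1) by (intro exI[of _ "insert k S"] conjI) blast+
  qed
  \<comment> \<open>The upper bound g - 2 \<tau> N \<delta>^2 + 2 \<tau>^2 N g for the squared norm
    of G - \<tau> P is smallest at this \<tau>, with value g - N \<delta>^4 / (2 g); the choice of
    \<open>N\<close> makes that negative.\<close>
  define \<tau> where "\<tau> = \<delta>\<^sup>2 / (2 * g)"
  obtain N :: nat where N: "2 * g\<^sup>2 / \<delta> ^ 4 < real N"
    using reals_Archimedean2[of "2 * g\<^sup>2 / \<delta> ^ 4"] by auto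
  have Npos: "N > 0"
  proof (rule ccontr)
    have "0 \<le> 2 * g\<^sup>2 / \<delta> ^ 4" using \<delta> by simp
    moreover assume "\<not> N > 0"
    then have "real N = 0" by simp
    ultimately show False using N by linarith
  qed
  \<comment> \<open>With tolerance 1/N the off-diagonal terms of \<open>nsq P\<close> add up to at
    most N g, just like the diagonal ones.\<close>
  have "1 / real N > 0" using Npos by simp
  from pick[OF this, of N] obtain S where S: "finite S" "card S = N" and
      S3: "\<forall>i\<in>S. \<delta> \<le> cmod (ip G (e i))" and
      S4: "\<forall>i\<in>S. \<forall>j\<in>S. i \<noteq> j \<longrightarrow> cmod (ip (e i) (e j)) \<le> 1 / N"
    by (elim exE conjE) (rule that)
  define c where "c i = ip G (e i)" for i
  define P where "P = (\<lambda>w. \<Sum>i\<in>S. c i * e i w)"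
  have PV: "P \<in> V" and ipP: "\<And>K. K \<in> V \<Longrightarrow> ip P K = (\<Sum>i\<in>S. c i * ip (e i) K)"
    using ip_sum[of S e _ c] S(1) eV G unfolding P_def by blast+
  have GP: "ip G P = of_real (\<Sum>i\<in>S. (cmod (c i))\<^sup>2)"
  proof -
    have "ip P G = (\<Sum>i\<in>S. c i * cnj (c i))"
      unfolding ipP[OF G] c_def by (intro sum.cong refl arg_cong2[of _ _ _ _ "(*)"] ip_cnj[OF G eV])
    also have "\<dots> = of_real (\<Sum>i\<in>S. (cmod (c i))\<^sup>2)" by (simp only: complex_norm_square of_real_sum)
    finally show ?thesis using ip_cnj[OF PV G] by simp
  qed
  have c2: "(cmod (c i))\<^sup>2 \<le> g" for i unfolding c_def by (rule cs)
  have cc: "cmod (c i) * cmod (c j) \<le> g" for i j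
  proof -
    have "2 * (cmod (c i) * cmod (c j)) \<le> (cmod (c i))\<^sup>2 + (cmod (c j))\<^sup>2"
      using sum_squares_bound[of "cmod (c i)" "cmod (c j)"] by simp
    then show ?thesis using c2[of i] c2[of j] by linarith
  qed
  have "nsq P \<le> (\<Sum>i\<in>S. \<Sum>j\<in>S. if i = j then g else g / N)"
  proof -
    have "nsq P \<le> cmod (ip P P)" unfolding nsq_def by (rule complex_Re_le_cmod)
    also have "ip P P = (\<Sum>i\<in>S. c i * cnj (\<Sum>j\<in>S. c j * ip (e j) (e i)))"
      by (subst ipP[OF PV], intro sum.cong refl arg_cong2[of _ _ _ _ "(*)"])
        (simp add: ip_cnj[OF PV eV] ipP[OF eV])
    also have "\<dots> = (\<Sum>i\<in>S. \<Sum>j\<in>S. c i * cnj (c j) * cnj (ip (e j) (e i)))"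
      by (simp add: sum_distrib_left mult_ac)
    also have "cmod \<dots> \<le> (\<Sum>i\<in>S. \<Sum>j\<in>S. if i = j then g else g / N)"
    proof (intro sum_norm_le)
      fix i j assume ij: "i \<in> S" "j \<in> S"
      show "cmod (c i * cnj (c j) * cnj (ip (e j) (e i))) \<le> (if i = j then g else g / N)"
      proof (cases "i = j")
        case True
        then show ?thesis using ip_self[OF eV[of i]] unit[of i] c2[of i]
          by (simp add: norm_mult power2_eq_square)
      next
        case False
        have "cmod (c i) * cmod (c j) * cmod (ip (e j) (e i)) \<le> g * (1 / N)"
          using S4 ij False g by (intro mult_mono cc) auto
        then show ?thesis using False by (simp add: norm_mult)
      qed
    qed
    finally show ?thesis .
  qed
  also have "\<dots> \<le> (\<Sum>i\<in>S. g + g)"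
  proof (intro sum_mono)
    fix i assume i: "i \<in> S"
    have "(\<Sum>j\<in>S. if i = j then g else g / N) \<le> (\<Sum>j\<in>S. (if i = j then g else 0) + g / N)"
      using g by (intro sum_mono) auto
    also have "\<dots> = g + g" using i S(1,2) Npos by (simp add: sum.distrib)
    finally show "(\<Sum>j\<in>S. if i = j then g else g / N) \<le> g + g" .
  qed
  finally have nP: "nsq P \<le> 2 * N * g" using S(2) by simp
  have "real N * \<delta>\<^sup>2 = (\<Sum>i\<in>S. \<delta>\<^sup>2)" using S(2) by simp
  also have "\<dots> \<le> (\<Sum>i\<in>S. (cmod (c i))\<^sup>2)"
    using S3 \<delta> unfolding c_def by (intro sum_mono power_mono) auto
  finally have low: "real N * \<delta>\<^sup>2 \<le> Re (ip G P)" by (simp add: GP)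
  have "0 \<le> nsq (\<lambda>w. G w + of_real (- \<tau>) * P w)"
    by (rule nsq_nonneg[OF lin_closed[OF G PV]])
  also have "\<dots> = g - 2 * \<tau> * Re (ip G P) + \<tau>\<^sup>2 * nsq P"
    unfolding nsq_lin[OF G PV] by (simp add: g_def)
  also have "\<dots> \<le> g - 2 * \<tau> * (real N * \<delta>\<^sup>2) + \<tau>\<^sup>2 * (2 * N * g)"
    using low nP g by (intro add_mono diff_mono mult_left_mono) (auto simp: \<tau>_def)
  also have "\<dots> = g - real N * \<delta> ^ 4 / (2 * g)"
    using g by (simp add: \<tau>_def field_simps power2_eq_square power4_eq_xxxx)
  also have "\<dots> < 0"
    using N g \<delta> by (simp add: field_simps power2_eq_square)
  finally show False by simp
qed

end

text \<open>By Cauchy-Schwarz the m-th partial sum is at most sqrt (m A). If the product stayed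
  above \<epsilon>, the squares of \<open>a m\<close> would dominate a multiple of the harmonic
  series, although they are summable. Using A + 1 and m + 1 keeps the denominators positive.\<close>

lemma frequently_small_product_partial_sums:
  fixes a :: "nat \<Rightarrow> real"
  assumes nonneg: "\<And>l. 0 \<le> a l" and bd: "\<And>n. (\<Sum>l<n. (a l)\<^sup>2) \<le> A" and \<epsilon>: "\<epsilon> > 0"
  shows "\<exists>m\<ge>N. a m * (\<Sum>l<m. a l) < \<epsilon>"
proof (rule ccontr)
  assume "\<not> ?thesis"
  then have big: "\<epsilon> \<le> a m * (\<Sum>l<m. a l)" if "m \<ge> N" for m using that by (meson not_less)
  have A: "A \<ge> 0" using bd[of 0] by simp
  have le: "\<epsilon>\<^sup>2 / (A + 1) * inverse (real (Suc m)) \<le> (a m)\<^sup>2" if "m \<ge> N" for m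
  proof -
    have "(\<Sum>l<m. a l)\<^sup>2 \<le> real m * (\<Sum>l<m. (a l)\<^sup>2)"
      using Cauchy_Schwarz_ineq_sum[of "\<lambda>_. 1" a "{..<m}"] by simp
    also have "\<dots> \<le> real (Suc m) * (A + 1)"
      using bd[of m] by (intro mult_mono) (auto simp: sum_nonneg)
    finally have s: "(\<Sum>l<m. a l)\<^sup>2 \<le> real (Suc m) * (A + 1)" .
    have "\<epsilon>\<^sup>2 \<le> (a m * (\<Sum>l<m. a l))\<^sup>2" using big[OF that] \<epsilon> by (intro power_mono) auto
    also have "\<dots> \<le> (a m)\<^sup>2 * (real (Suc m) * (A + 1))"
      unfolding power_mult_distrib by (intro mult_left_mono s) auto
    finally have "\<epsilon>\<^sup>2 \<le> (a m)\<^sup>2 * (real (Suc m) * (A + 1))" .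
    then have "\<epsilon>\<^sup>2 / (real (Suc m) * (A + 1)) \<le> (a m)\<^sup>2"
      using A by (subst pos_divide_le_eq) auto
    then show ?thesis by (simp add: divide_inverse mult_ac)
  qed
  have "summable (\<lambda>l. (a l)\<^sup>2)"
    by (rule bounded_imp_summable[of _ A]) (use bd in \<open>auto simp: lessThan_Suc_atMost[symmetric] simp del: sum.lessThan_Suc\<close>)
  then have "summable (\<lambda>m. \<epsilon>\<^sup>2 / (A + 1) * inverse (real (Suc m)))"
    by (rule summable_comparison_test'[where N = N]) (use le A in auto)
  then have "summable (\<lambda>m. inverse (real (Suc m)))"
    using \<epsilon> A by (subst (asm) summable_cmult_iff) auto
  then have "summable (\<lambda>m. inverse (real m))"
    by (rule summable_Suc_iff[THEN iffD1])
  then show False using not_summable_harmonic[where ?'a = real] by blast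
qed

text \<open>Jones' theorem on the convergence of pure greedy algorithms, in a form that needs neither
  completeness of the space nor totality of the dictionary.\<close>

locale greedy = semi_inner_space V ip
  for V :: "('x \<Rightarrow> complex) set" and ip +
  fixes D :: "('x \<Rightarrow> complex) set" and R e :: "nat \<Rightarrow> 'x \<Rightarrow> complex"
  assumes DV: "D \<subseteq> V" and unit: "\<And>\<psi>. \<psi> \<in> D \<Longrightarrow> nsq \<psi> = 1"
    and R0: "R 0 \<in> V"
    and RSuc: "\<And>l. R (Suc l) = (\<lambda>w. R l w - ip (R l) (e l) * e l w)"
    and eD: "\<And>l. e l \<in> D"
    and opt: "\<And>l \<psi>. \<psi> \<in> D \<Longrightarrow> cmod (ip (R l) \<psi>) \<le> cmod (ip (R l) (e l))"
begin

definition gain :: "nat \<Rightarrow> real" where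
  "gain l = cmod (ip (R l) (e l))"

lemma eV: "e l \<in> V"
  using eD DV by blast

lemma RSuc': "R (Suc l) = (\<lambda>w. R l w + (- ip (R l) (e l)) * e l w)"
  by (simp add: RSuc)

lemma RV: "R l \<in> V"
  by (induction l) (simp_all only: R0 RSuc' lin_closed eV)

lemma nsq_R_Suc: "nsq (R (Suc l)) = nsq (R l) - (gain l)\<^sup>2"
  unfolding RSuc' nsq_lin[OF RV eV] unit[OF eD] gain_def
  by (simp add: cmod_power2) (simp add: power2_eq_square algebra_simps)

lemma sum_gain_squares: "(\<Sum>l<n. (gain l)\<^sup>2) = nsq (R 0) - nsq (R n)"
  by (induction n) (auto simp: nsq_R_Suc)

lemma residual_inner_tendsto_0:
  assumes "\<psi> \<in> D"
  shows "(\<lambda>l. ip (R l) \<psi>) \<longlonglongrightarrow> 0"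
proof -
  have "summable (\<lambda>l. (gain l)\<^sup>2)"
    by (rule bounded_imp_summable[of _ "nsq (R 0)"])
      (auto simp: lessThan_Suc_atMost[symmetric] sum_gain_squares nsq_nonneg RV simp del: sum.lessThan_Suc)
  from summable_LIMSEQ_zero[OF this] have "(\<lambda>l. sqrt ((gain l)\<^sup>2)) \<longlonglongrightarrow> sqrt 0"
    by (intro tendsto_intros)
  then have "gain \<longlonglongrightarrow> 0" by (simp add: gain_def[abs_def])
  then show ?thesis
    by (rule Lim_null_comparison[rotated]) (auto simp: gain_def opt[OF assms])
qed

text \<open>The difference telescopes into the terms removed in between, whose coefficients have
  modulus \<open>gain l\<close>. Summing from 0 instead of \<open>n\<close> produces the partial
  sums controlled by \<open>frequently_small_product_partial_sums\<close>.\<close>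

lemma inner_diff_residual:
  assumes "\<psi> \<in> V" "\<And>l. cmod (ip (e l) \<psi>) \<le> b"
  shows "cmod (ip (\<lambda>w. R n w + (-1) * R (n + k) w) \<psi>) \<le> b * (\<Sum>l<n + k. gain l)"
proof (induction k)
  case 0
  have "0 \<le> b" using assms(2)[of 0] norm_ge_zero order_trans by blast
  then show ?case
    by (auto simp: ip_zero assms(1) gain_def intro!: mult_nonneg_nonneg sum_nonneg)
next
  case (Suc k)
  let ?c = "ip (R (n + k)) (e (n + k))"
  have "(\<lambda>w. R n w + (-1) * R (n + Suc k) w) = (\<lambda>w. (R n w + (-1) * R (n + k) w) + ?c * e (n + k) w)"
    by (simp add: RSuc algebra_simps)
  then have "ip (\<lambda>w. R n w + (-1) * R (n + Suc k) w) \<psi>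
      = ip (\<lambda>w. R n w + (-1) * R (n + k) w) \<psi> + ?c * ip (e (n + k)) \<psi>"
    by (simp only: ip_lin[OF lin_closed[OF RV RV] eV assms(1)])
  then have "cmod (ip (\<lambda>w. R n w + (-1) * R (n + Suc k) w) \<psi>)
      \<le> cmod (ip (\<lambda>w. R n w + (-1) * R (n + k) w) \<psi>) + cmod ?c * cmod (ip (e (n + k)) \<psi>)"
    by (metis norm_triangle_ineq norm_mult)
  also have "\<dots> \<le> b * (\<Sum>l<n + k. gain l) + gain (n + k) * b"
    unfolding gain_def[symmetric, of "n + k"]
    by (intro add_mono Suc.IH mult_left_mono assms) (simp add: gain_def)
  finally show ?case by (simp add: algebra_simps)
qed

text \<open>With d = R n - R m, expanding R n = d + R m gives nsq d = nsq (R n) - nsq (R m) - 2 Re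
  (ip d (R m)). Every removed element belongs to the dictionary, so optimality at stage
  \<open>m\<close> bounds its correlation with \<open>R m\<close> by \<open>gain m\<close>.\<close>

lemma nsq_diff_residual_le:
  assumes "n \<le> m"
  shows "nsq (\<lambda>w. R n w + (-1) * R m w) \<le> nsq (R n) - nsq (R m) + 2 * (gain m * (\<Sum>l<m. gain l))"
proof -
  let ?d = "\<lambda>w. R n w + (-1) * R m w"
  have dV: "?d \<in> V" by (rule lin_closed[OF RV RV])
  have "cmod (ip (e l) (R m)) \<le> gain m" for l
    using opt[OF eD[of l], of m] ip_cnj[OF RV[of m] eV[of l]] by (simp add: gain_def)
  from inner_diff_residual[OF RV this, of n "m - n"] assms
  have "cmod (ip ?d (R m)) \<le> gain m * (\<Sum>l<m. gain l)" by simp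
  then have "- Re (ip ?d (R m)) \<le> gain m * (\<Sum>l<m. gain l)"
    using abs_Re_le_cmod[of "ip ?d (R m)"] by linarith
  moreover have "nsq (R n) = nsq (\<lambda>w. ?d w + 1 * R m w)" by simp
  then have "nsq (R n) = nsq ?d + 2 * Re (ip ?d (R m)) + nsq (R m)"
    unfolding nsq_lin[OF dV RV] by simp
  ultimately show ?thesis by linarith
qed

text \<open>The estimate for R n - R m is good only for those \<open>m\<close> at which the product
  of gain and partial sum is small. Such \<open>m\<close> exist arbitrarily late, so two late
  residuals are compared through a common later one.\<close>

theorem residual_Cauchy:
  assumes "\<epsilon> > 0"
  shows "\<exists>N. \<forall>n\<ge>N. \<forall>p\<ge>N. nsq (\<lambda>w. R n w + (-1) * R p w) \<le> \<epsilon>"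
proof -
  \<comment> \<open>Each comparison with \<open>R m\<close> costs \<delta> + 2 \<delta>, and
    \<open>nsq_add_le\<close> doubles both of the two comparisons.\<close>
  define \<delta> where "\<delta> = \<epsilon> / 12"
  have \<delta>: "\<delta> > 0" using assms by (simp add: \<delta>_def)
  have dec: "decseq (\<lambda>n. nsq (R n))"
    by (rule decseq_SucI) (simp add: nsq_R_Suc)
  obtain L where L: "(\<lambda>n. nsq (R n)) \<longlonglongrightarrow> L" "\<And>n. L \<le> nsq (R n)"
    using decseq_convergent[OF dec, of 0] nsq_nonneg[OF RV] by metis
  obtain N where N: "nsq (R n) < L + \<delta>" if "n \<ge> N" for n
    using order_tendstoD(2)[OF L(1), of "L + \<delta>"] \<delta> unfolding eventually_sequentially by auto
  have "nsq (\<lambda>w. R n w + (-1) * R p w) \<le> \<epsilon>" if n: "n \<ge> N" and p: "p \<ge> N" for n p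
  proof -
    have "(\<Sum>l<k. (gain l)\<^sup>2) \<le> nsq (R 0)" for k
      using nsq_nonneg[OF RV[of k]] by (simp add: sum_gain_squares)
    then obtain m where m: "m \<ge> max n p" "gain m * (\<Sum>l<m. gain l) < \<delta>"
      using frequently_small_product_partial_sums[of gain "nsq (R 0)" \<delta> "max n p"] \<delta>
      by (auto simp: gain_def)
    have 1: "nsq (\<lambda>w. R q w + (-1) * R m w) \<le> 3 * \<delta>" if "q \<ge> N" "q \<le> m" for q
      using nsq_diff_residual_le[OF that(2)] N[OF that(1)] L(2)[of m] m(2) by linarith
    have "nsq (\<lambda>w. R n w + (-1) * R p w)
        = nsq (\<lambda>w. (R n w + (-1) * R m w) + (-1) * (R p w + (-1) * R m w))"
      by (rule arg_cong[of _ _ nsq]) (simp add: fun_eq_iff)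
    also have "\<dots> \<le> 2 * nsq (\<lambda>w. R n w + (-1) * R m w) + 2 * nsq (\<lambda>w. R p w + (-1) * R m w)"
      by (intro nsq_add_le lin_closed RV) simp
    also have "\<dots> \<le> \<epsilon>" using 1[OF n] 1[OF p] m(1) by (simp add: \<delta>_def)
    finally show ?thesis .
  qed
  then show ?thesis by blast
qed

end

subsection \<open>Translations and iterated integrals\<close>

lemma nn_integral_lborel_translate:
  fixes f :: "'a::euclidean_space \<Rightarrow> ennreal"
  assumes [measurable]: "f \<in> borel_measurable borel"
  shows "(\<integral>\<^sup>+x. f (x + c) \<partial>lborel) = (\<integral>\<^sup>+x. f x \<partial>lborel)"
  by (subst (2) lborel_distr_plus[of c, symmetric]) (simp add: nn_integral_distr add.commute)

lemma integral_lborel_translate: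
  fixes f :: "'a::euclidean_space \<Rightarrow> 'b::{banach, second_countable_topology}"
  assumes [measurable]: "f \<in> borel_measurable borel"
  shows "(\<integral>x. f (x + c) \<partial>lborel) = (\<integral>x. f x \<partial>lborel)"
  by (subst (2) lborel_distr_plus[of c, symmetric]) (simp add: integral_distr add.commute)

lemma integrable_lborel_translate:
  fixes f :: "'a::euclidean_space \<Rightarrow> 'b::{banach, second_countable_topology}"
  assumes "integrable lborel f"
  shows "integrable lborel (\<lambda>x. f (x + c))"
proof -
  have [measurable]: "f \<in> borel_measurable borel" using assms by auto
  show ?thesis
    using assms nn_integral_lborel_translate[of "\<lambda>x. norm (f x)" c]
    by (simp add: integrable_iff_bounded)
qed

lemma nn_integral_lborel_pair:
  fixes f :: "'a::euclidean_space \<times> 'b::euclidean_space \<Rightarrow> ennreal"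
  assumes [measurable]: "f \<in> borel_measurable borel"
  shows "(\<integral>\<^sup>+p. f p \<partial>lborel) = (\<integral>\<^sup>+x. (\<integral>\<^sup>+y. f (x, y) \<partial>lborel) \<partial>lborel)"
    and "(\<integral>\<^sup>+p. f p \<partial>lborel) = (\<integral>\<^sup>+y. (\<integral>\<^sup>+x. f (x, y) \<partial>lborel) \<partial>lborel)"
proof -
  have f: "f \<in> borel_measurable (lborel \<Otimes>\<^sub>M lborel)" by (simp add: lborel_prod)
  show "(\<integral>\<^sup>+p. f p \<partial>lborel) = (\<integral>\<^sup>+x. (\<integral>\<^sup>+y. f (x, y) \<partial>lborel) \<partial>lborel)"
    using lborel.nn_integral_fst[OF f] by (simp add: lborel_prod)
  show "(\<integral>\<^sup>+p. f p \<partial>lborel) = (\<integral>\<^sup>+y. (\<integral>\<^sup>+x. f (x, y) \<partial>lborel) \<partial>lborel)"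
    using lborel_pair.nn_integral_snd[OF f] f by (simp add: lborel_prod)
qed

lemma integral_lborel_pair:
  fixes f :: "'a::euclidean_space \<times> 'b::euclidean_space \<Rightarrow> 'c::{banach, second_countable_topology}"
  assumes "integrable lborel f"
  shows "(\<integral>p. f p \<partial>lborel) = (\<integral>x. (\<integral>y. f (x, y) \<partial>lborel) \<partial>lborel)"
    and "(\<integral>p. f p \<partial>lborel) = (\<integral>y. (\<integral>x. f (x, y) \<partial>lborel) \<partial>lborel)"
    and "integrable lborel (\<lambda>x. \<integral>y. f (x, y) \<partial>lborel)"
proof -
  have f: "integrable (lborel \<Otimes>\<^sub>M lborel) f" using assms by (simp add: lborel_prod)
  show "(\<integral>p. f p \<partial>lborel) = (\<integral>x. (\<integral>y. f (x, y) \<partial>lborel) \<partial>lborel)"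
    using lborel_pair.integral_fst'[OF f] by (simp add: lborel_prod)
  then show "(\<integral>p. f p \<partial>lborel) = (\<integral>y. (\<integral>x. f (x, y) \<partial>lborel) \<partial>lborel)"
    using lborel_pair.Fubini_integral[of "\<lambda>x y. f (x, y)"] f by simp
  show "integrable lborel (\<lambda>x. \<integral>y. f (x, y) \<partial>lborel)"
    by (rule lborel_pair.integrable_fst'[OF f])
qed

subsection \<open>Shifting the height of integration\<close>

text \<open>Fubini and translation invariance. This turns a horizontal side of the rectangle
  contour, once integrated over the base point, back into the integral at that height.\<close>

lemma integral_over_segment_average:
  fixes g :: "'a::euclidean_space \<Rightarrow> complex"
  assumes g: "integrable lborel g"
  shows "integrable lborel (\<lambda>x. \<integral>t. indicator {0..1} t *\<^sub>R g (x + t *\<^sub>R v) \<partial>lborel)"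
    and "(\<integral>x. (\<integral>t. indicator {0..1::real} t *\<^sub>R g (x + t *\<^sub>R v) \<partial>lborel) \<partial>lborel) = (\<integral>x. g x \<partial>lborel)"
proof -
  have [measurable]: "g \<in> borel_measurable borel" using g by auto
  define k where "k = (\<lambda>p::'a \<times> real. indicator {0..1} (snd p) *\<^sub>R g (fst p + snd p *\<^sub>R v))"
  have [measurable]: "k \<in> borel_measurable borel" unfolding k_def borel_prod[symmetric] by measurable
  have "(\<integral>\<^sup>+p. norm (k p) \<partial>lborel) = (\<integral>\<^sup>+t. (\<integral>\<^sup>+x. indicator {0..1} t * norm (g (x + t *\<^sub>R v)) \<partial>lborel) \<partial>lborel)"
    by (subst nn_integral_lborel_pair(2)) (measurable, auto simp: k_def intro!: nn_integral_cong simp: indicator_def)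
  also have "\<dots> = (\<integral>\<^sup>+t. indicator {0..1::real} t * (\<integral>\<^sup>+x. norm (g x) \<partial>lborel) \<partial>lborel)"
    by (intro nn_integral_cong)
      (auto simp: indicator_def nn_integral_lborel_translate[of "\<lambda>x. ennreal (norm (g x))"])
  also have "\<dots> = (\<integral>\<^sup>+x. norm (g x) \<partial>lborel)"
    by (simp add: nn_integral_multc)
  also have "\<dots> < \<infinity>" using g by (simp add: integrable_iff_bounded)
  finally have k: "integrable lborel k" by (auto intro: integrableI_bounded)
  show "integrable lborel (\<lambda>x. \<integral>t. indicator {0..1} t *\<^sub>R g (x + t *\<^sub>R v) \<partial>lborel)"
    using integral_lborel_pair(3)[OF k] by (simp add: k_def)
  have "(\<integral>x. (\<integral>t. indicator {0..1::real} t *\<^sub>R g (x + t *\<^sub>R v) \<partial>lborel) \<partial>lborel)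
      = (\<integral>t. (\<integral>x. indicator {0..1} t *\<^sub>R g (x + t *\<^sub>R v) \<partial>lborel) \<partial>lborel)"
    using integral_lborel_pair(1,2)[OF k] by (simp add: k_def)
  also have "\<dots> = (\<integral>t. indicator {0..1::real} t *\<^sub>R (\<integral>x. g x \<partial>lborel) \<partial>lborel)"
    by (intro Bochner_Integration.integral_cong refl) (simp add: integral_lborel_translate[of g])
  also have "\<dots> = (\<integral>x. g x \<partial>lborel)" by simp
  finally show "(\<integral>x. (\<integral>t. indicator {0..1::real} t *\<^sub>R g (x + t *\<^sub>R v) \<partial>lborel) \<partial>lborel) = (\<integral>x. g x \<partial>lborel)" .
qed

text \<open>The difference of the horizontal sides of the rectangle \<open>[0,1] \<times> [a,b]\<close> equals that of its
  vertical sides, and integrated over \<open>x\<close> the two vertical sides are translates of each other.\<close>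

lemma integral_strip_shift:
  fixes h :: "'a::euclidean_space \<Rightarrow> complex \<Rightarrow> complex" and v :: 'a
  assumes ab: "c < a" "a \<le> b" "b < d"
    and holo: "\<And>x. h x holomorphic_on {\<zeta>. c < Im \<zeta> \<and> Im \<zeta> < d}"
    and cov: "\<And>x t \<zeta>. h (x + t *\<^sub>R v) \<zeta> = h x (\<zeta> + of_real t)"
    and meas[measurable]: "(\<lambda>p. indicator {a..b} (snd p) *\<^sub>R h (fst p) (Complex 0 (snd p)))
      \<in> borel_measurable (borel :: ('a \<times> real) measure)"
    and bd: "\<And>s. s \<in> {a..b} \<Longrightarrow> (\<integral>\<^sup>+x. norm (h x (Complex 0 s)) \<partial>lborel) \<le> C" "C < \<infinity>"
  shows "(\<integral>x. h x (Complex 0 a) \<partial>lborel) = (\<integral>x. h x (Complex 0 b) \<partial>lborel)"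
proof -
  define k where "k = (\<lambda>p::'a \<times> real. indicator {a..b} (snd p) *\<^sub>R h (fst p) (Complex 0 (snd p)))"
  have [measurable]: "k \<in> borel_measurable borel" unfolding k_def by (rule meas)
  have hm: "(\<lambda>x. h x (Complex 0 s)) \<in> borel_measurable borel" if "s \<in> {a..b}" for s
  proof -
    have "(\<lambda>x. k (x, s)) \<in> borel_measurable borel" by measurable
    then show ?thesis using that by (simp add: k_def)
  qed
  have hint: "integrable lborel (\<lambda>x. h x (Complex 0 s))" if "s \<in> {a..b}" for s
    using hm[OF that] bd(1)[OF that] bd(2) by (auto intro!: integrableI_bounded)
  have "(\<integral>\<^sup>+p. norm (k p) \<partial>lborel) = (\<integral>\<^sup>+s. (\<integral>\<^sup>+x. norm (k (x, s)) \<partial>lborel) \<partial>lborel)"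
    by (subst nn_integral_lborel_pair(2)) auto
  also have "\<dots> \<le> (\<integral>\<^sup>+s. C * indicator {a..b} s \<partial>lborel)"
    using bd(1) by (intro nn_integral_mono) (auto simp: k_def indicator_def)
  also have "\<dots> = C * ennreal (b - a)" using ab by (simp add: nn_integral_cmult)
  also have "\<dots> < \<infinity>" using bd(2) by (simp add: ennreal_mult_less_top)
  finally have k: "integrable lborel k" by (auto intro: integrableI_bounded)
  define W where "W x = (\<integral>s. k (x, s) \<partial>lborel)" for x
  have W: "integrable lborel W" unfolding W_def by (rule integral_lborel_pair(3)[OF k])
  define T where "T s x = (\<integral>t. indicator {0..1} t *\<^sub>R h (x + t *\<^sub>R v) (Complex 0 s) \<partial>lborel)" for s x
  have T: "integrable lborel (T s)" "(\<integral>x. T s x \<partial>lborel) = (\<integral>x. h x (Complex 0 s) \<partial>lborel)" if "s \<in> {a..b}" for s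
    unfolding T_def by (rule integral_over_segment_average[OF hint[OF that]])+
  \<comment> \<open>Cauchy's theorem on the rectangle, through a primitive on the convex strip.
    \<open>W x\<close> comes from the left side; by \<open>cov\<close> the right side of the
    rectangle at \<open>x\<close> is the left side of the one at \<open>x + v\<close>. The factor i
    comes from d\<zeta> = i ds.\<close>
  have rect: "T a x - T b x = \<i> * (W x - W (x + v))" for x
  proof -
    let ?S = "{\<zeta>. c < Im \<zeta> \<and> Im \<zeta> < d}"
    have S: "open ?S" "convex ?S"
      by (auto intro!: open_Collect_conj open_halfspace_Im_gt open_halfspace_Im_lt
          convex_Int convex_halfspace_Im_gt convex_halfspace_Im_lt simp: Collect_conj_eq)
    obtain P where P: "\<And>z. z \<in> ?S \<Longrightarrow> (P has_field_derivative h x z) (at z within ?S)"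
      using holomorphic_convex_primitive'[OF S(2,1) holo[of x]] by blast
    have P': "(P has_field_derivative h x z) (at z)" if "z \<in> ?S" for z
      using P[OF that] at_within_open[OF that S(1)] by simp
    have cont: "continuous_on ?S (h x)" by (rule holomorphic_on_imp_continuous_on[OF holo])
    have Tv: "T s x = P (Complex 1 s) - P (Complex 0 s)" if s: "s \<in> {a..b}" for s
    proof -
      have "T s x = (\<integral>t. indicator {0..1} t *\<^sub>R h x (Complex t s) \<partial>lborel)"
        unfolding T_def by (simp add: cov complex_eq_iff Complex_eq algebra_simps)
      also have "\<dots> = P (Complex 1 s) - P (Complex 0 s)"
      proof (rule integral_FTC_atLeastAtMost)
        fix t :: real
        have "((\<lambda>t. Complex t s) has_vector_derivative 1) (at t within {0..1})"
          unfolding Complex_eq by (auto intro!: derivative_eq_intros)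
        then have "((P \<circ> (\<lambda>t. Complex t s)) has_vector_derivative (1 * h x (Complex t s))) (at t within {0..1})"
          by (rule field_vector_diff_chain_within)
            (use s ab in \<open>auto intro!: DERIV_subset[OF P']\<close>)
        then show "((\<lambda>t. P (Complex t s)) has_vector_derivative h x (Complex t s)) (at t within {0..1})"
          by (simp add: o_def)
      next
        show "continuous_on {0..1} (\<lambda>t. h x (Complex t s))"
          by (rule continuous_on_compose2[OF cont])
            (use s ab in \<open>auto simp: Complex_eq intro!: continuous_intros\<close>)
      qed simp
      finally show ?thesis .
    qed
    have Wv: "\<i> * W (x + t *\<^sub>R v) = P (Complex t b) - P (Complex t a)" for t
    proof -
      have "\<i> * W (x + t *\<^sub>R v) = (\<integral>s. indicator {a..b} s *\<^sub>R (\<i> * h x (Complex t s)) \<partial>lborel)"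
        unfolding W_def k_def
        by (subst integral_mult_right_zero[symmetric]) (simp add: cov Complex_eq algebra_simps)
      also have "\<dots> = P (Complex t b) - P (Complex t a)"
      proof (rule integral_FTC_atLeastAtMost)
        fix s :: real assume s: "a \<le> s" "s \<le> b"
        have "((\<lambda>s. Complex t s) has_vector_derivative \<i>) (at s within {a..b})"
          unfolding Complex_eq by (auto intro!: derivative_eq_intros)
        then have "((P \<circ> (\<lambda>s. Complex t s)) has_vector_derivative (\<i> * h x (Complex t s))) (at s within {a..b})"
          by (rule field_vector_diff_chain_within)
            (use s ab in \<open>auto intro!: DERIV_subset[OF P']\<close>)
        then show "((\<lambda>s. P (Complex t s)) has_vector_derivative \<i> * h x (Complex t s)) (at s within {a..b})"
          by (simp add: o_def)
      next
        show "continuous_on {a..b} (\<lambda>s. \<i> * h x (Complex t s))"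
          by (intro continuous_intros continuous_on_compose2[OF cont])
            (use ab in \<open>auto simp: Complex_eq intro!: continuous_intros\<close>)
      qed (rule ab(2))
      finally show ?thesis .
    qed
    have "\<i> * (W x - W (x + v)) = \<i> * W (x + 0 *\<^sub>R v) - \<i> * W (x + 1 *\<^sub>R v)"
      by (simp add: algebra_simps)
    then show ?thesis unfolding Wv using Tv[of a] Tv[of b] ab(2) by simp
  qed
  have "(\<integral>x. h x (Complex 0 a) \<partial>lborel) - (\<integral>x. h x (Complex 0 b) \<partial>lborel) = (\<integral>x. T a x - T b x \<partial>lborel)"
    using T[of a] T[of b] ab(2) by (simp add: Bochner_Integration.integral_diff)
  also have "\<dots> = \<i> * ((\<integral>x. W x \<partial>lborel) - (\<integral>x. W (x + v) \<partial>lborel))"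
    unfolding rect using W integrable_lborel_translate[OF W, of v]
    by (simp add: Bochner_Integration.integral_diff)
  also have "\<dots> = 0"
    using integral_lborel_translate[of W v] W by auto
  finally show ?thesis by simp
qed

subsection \<open>Cauchy integrals on the real line\<close>

lemma Cauchy_density:
  fixes u v :: real
  assumes v: "v > 0"
  shows "integrable lborel (\<lambda>t. 1 / ((t - u)\<^sup>2 + v\<^sup>2))" (is "integrable _ ?f")
    and "(\<integral>t. 1 / ((t - u)\<^sup>2 + v\<^sup>2) \<partial>lborel) = pi / v"
proof -
  let ?F = "\<lambda>t. arctan ((t - u) / v) / v"
  have D: "DERIV ?F t :> ?f t" for t
  proof -
    have "DERIV ?F t :> inverse (1 + ((t - u) / v)\<^sup>2) * (1 / v) / v"
      using v by (auto intro!: derivative_eq_intros)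
    also have "inverse (1 + ((t - u) / v)\<^sup>2) * (1 / v) / v = 1 / ((1 + ((t - u) / v)\<^sup>2) * v\<^sup>2)"
      by (simp add: divide_inverse power2_eq_square)
    also have "(1 + ((t - u) / v)\<^sup>2) * v\<^sup>2 = (t - u)\<^sup>2 + v\<^sup>2"
      using v by (simp add: power_divide field_simps)
    finally show ?thesis .
  qed
  have pos: "(t - u)\<^sup>2 + v\<^sup>2 > 0" for t using v by (simp add: add_nonneg_pos)
  have C: "isCont ?f t" for t
    using pos[of t] v by (intro isCont_divide isCont_add isCont_power isCont_diff continuous_const continuous_ident) simp
  have lin: "filterlim (\<lambda>t. (t - u) / v) at_top at_top" "filterlim (\<lambda>t. (t - u) / v) at_bot at_bot"
    using v by real_asymp+
  have "(?F \<longlongrightarrow> pi / 2 / v) at_top"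
    using v by (intro tendsto_divide tendsto_const filterlim_compose[OF tendsto_arctan_at_top lin(1)]) simp
  then have A: "((?F \<circ> real_of_ereal) \<longlongrightarrow> pi / 2 / v) (at_left \<infinity>)"
    by (simp only: ereal_tendsto_simps1)
  have "(?F \<longlongrightarrow> - (pi / 2) / v) at_bot"
    using v by (intro tendsto_divide tendsto_const filterlim_compose[OF tendsto_arctan_at_bot lin(2)]) simp
  then have B: "((?F \<circ> real_of_ereal) \<longlongrightarrow> - (pi / 2) / v) (at_right (- \<infinity>))"
    by (simp only: ereal_tendsto_simps1)
  note I = interval_integral_FTC_nonneg[of "- \<infinity>" \<infinity> ?F ?f, OF _ D C _ B A]
  have nn: "AE x in lborel. - \<infinity> < ereal x \<longrightarrow> ereal x < \<infinity> \<longrightarrow> 0 \<le> ?f x"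
    by (intro AE_I2 impI divide_nonneg_nonneg less_imp_le[OF pos]) simp
  have lt: "- \<infinity> < (\<infinity>::ereal)" by simp
  have U: "einterval (- \<infinity>) \<infinity> = UNIV" by (auto simp: einterval_def)
  show "integrable lborel ?f"
    using I(1)[OF lt nn] unfolding set_integrable_def U by (simp only: indicator_UNIV scaleR_one)
  have "(\<integral>t. ?f t \<partial>lborel) = pi / 2 / v - - (pi / 2) / v"
    using I(2)[OF lt nn] lt
    unfolding interval_lebesgue_integral_def set_lebesgue_integral_def U
    by (simp only: indicator_UNIV scaleR_one less_imp_le if_True)
  also have "\<dots> = pi / v" using v by (simp add: field_simps)
  finally show "(\<integral>t. 1 / ((t - u)\<^sup>2 + v\<^sup>2) \<partial>lborel) = pi / v" .
qed

lemma borel_measurable_on_slab: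
  fixes f :: "'a::euclidean_space \<times> real \<Rightarrow> complex"
  assumes "continuous_on (UNIV \<times> {a..b}) f"
  shows "(\<lambda>p. indicator {a..b} (snd p) *\<^sub>R f p) \<in> borel_measurable borel"
proof -
  have "(\<lambda>p. indicator (UNIV \<times> {a..b}) p *\<^sub>R f p) \<in> borel_measurable borel"
    by (intro borel_measurable_continuous_on_indicator assms borel_closed closed_Times) auto
  then show ?thesis by (simp add: indicator_def mem_Times_iff of_bool_def)
qed

lemma open_above: "open {\<zeta>. e < Im \<zeta>}"
  by (rule open_halfspace_Im_gt)

text \<open>The line of integration can be raised to height n without changing the integral. There
  the integrand is at most C / (1 + n^2) pointwise and is dominated by C / (1 + t^2), so the
  integrals tend to 0.\<close>

lemma integral_real_line_eq_0:
  fixes g :: "complex \<Rightarrow> complex"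
  assumes \<epsilon>: "\<epsilon> > 0" and holo: "g holomorphic_on {\<zeta>. - \<epsilon> < Im \<zeta>}"
    and bd: "\<And>\<zeta>. 0 \<le> Im \<zeta> \<Longrightarrow> cmod (g \<zeta>) \<le> C / (1 + (cmod \<zeta>)\<^sup>2)"
  shows "integrable lborel (\<lambda>t. g (of_real t))" and "(\<integral>t. g (of_real t) \<partial>lborel) = 0"
proof -
  have C: "0 \<le> C" using bd[of 0] norm_ge_zero[of "g 0"] by (simp del: norm_ge_zero)
  have cont: "continuous_on {\<zeta>. - \<epsilon> < Im \<zeta>} g" by (rule holomorphic_on_imp_continuous_on[OF holo])
  have meas: "(\<lambda>t. g (Complex t s)) \<in> borel_measurable borel" if "s \<ge> 0" for s
    by (intro borel_measurable_continuous_onI continuous_on_compose2[OF cont])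
      (use that \<epsilon> in \<open>auto simp: Complex_eq intro!: continuous_intros\<close>)
  have w: "integrable lborel (\<lambda>t. C * (1 / ((t - 0)\<^sup>2 + 1\<^sup>2)))"
    by (intro integrable_mult_right Cauchy_density) simp
  have bd': "cmod (g (Complex t s)) \<le> C * (1 / ((t - 0)\<^sup>2 + 1\<^sup>2))" if "s \<ge> 0" for t s
  proof -
    have "C / (1 + (cmod (Complex t s))\<^sup>2) \<le> C / (t\<^sup>2 + 1)"
      using C by (intro divide_left_mono mult_pos_pos) (auto simp: cmod_power2 add_nonneg_pos add_pos_nonneg)
    then show ?thesis using bd[of "Complex t s"] that by simp
  qed
  have int: "integrable lborel (\<lambda>t. g (Complex t s))" if "s \<ge> 0" for s
    by (rule Bochner_Integration.integrable_bound[OF w]) (use meas[OF that] in \<open>simp_all only: real_norm_def measurable_lborel2 AE_I2 order_trans[OF bd'[OF that] abs_ge_self]\<close>)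
  show "integrable lborel (\<lambda>t. g (of_real t))"
    using int[of 0] by (simp add: Complex_eq)
  have eq: "(\<integral>t. g (Complex t 0) \<partial>lborel) = (\<integral>t. g (Complex t (real n)) \<partial>lborel)" for n
  proof -
    have "(\<integral>t. g (of_real t + Complex 0 0) \<partial>lborel) = (\<integral>t. g (of_real t + Complex 0 (real n)) \<partial>lborel)"
    proof (rule integral_strip_shift[where h = "\<lambda>x \<zeta>. g (of_real x + \<zeta>)" and c = "- \<epsilon>" and d = "real n + 1" and v = "1::real"])
      fix x :: real
      have "(\<lambda>\<zeta>. of_real x + \<zeta>) ` {\<zeta>. - \<epsilon> < Im \<zeta> \<and> Im \<zeta> < real n + 1} \<subseteq> {\<zeta>. - \<epsilon> < Im \<zeta>}" by auto
      moreover have "(\<lambda>\<zeta>. of_real x + \<zeta>) holomorphic_on {\<zeta>. - \<epsilon> < Im \<zeta> \<and> Im \<zeta> < real n + 1}"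
        by (intro holomorphic_intros)
      ultimately show "(\<lambda>\<zeta>. g (of_real x + \<zeta>)) holomorphic_on {\<zeta>. - \<epsilon> < Im \<zeta> \<and> Im \<zeta> < real n + 1}"
        using holomorphic_on_compose_gen[OF _ holo] by (simp only: o_def)
    next
      show "(\<lambda>p. indicator {0..real n} (snd p) *\<^sub>R g (of_real (fst p) + Complex 0 (snd p)))
          \<in> borel_measurable (borel :: (real \<times> real) measure)"
        by (intro borel_measurable_on_slab continuous_on_compose2[OF cont])
          (use \<epsilon> in \<open>auto simp: Complex_eq intro!: continuous_intros\<close>)
    next
      fix s assume s: "s \<in> {0..real n}"
      have e: "of_real x + Complex 0 s = Complex x s" for x by (simp add: complex_eq_iff)
      show "(\<integral>\<^sup>+x. ennreal (cmod (g (of_real x + Complex 0 s))) \<partial>lborel) \<le> (\<integral>\<^sup>+t. ennreal (C * (1 / ((t - 0)\<^sup>2 + 1\<^sup>2))) \<partial>lborel)"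
        unfolding e using s by (intro nn_integral_mono ennreal_leI bd') simp
    next
      have "(\<integral>\<^sup>+t. ennreal (norm (C * (1 / ((t - 0)\<^sup>2 + 1\<^sup>2)))) \<partial>lborel) < \<infinity>"
        using w by (simp only: integrable_iff_bounded)
      then show "(\<integral>\<^sup>+t. ennreal (C * (1 / ((t - 0)\<^sup>2 + 1\<^sup>2))) \<partial>lborel) < \<infinity>"
        using C by (simp add: abs_of_nonneg)
    qed (use \<epsilon> in \<open>auto simp: algebra_simps\<close>)
    then show ?thesis by (simp add: Complex_eq)
  qed
  have "(\<lambda>n. \<integral>t. g (Complex t (real n)) \<partial>lborel) \<longlonglongrightarrow> (\<integral>t. 0 \<partial>(lborel :: real measure))"
  proof (rule integral_dominated_convergence[OF _ _ w])
    show "AE t in lborel. (\<lambda>n. g (Complex t (real n))) \<longlonglongrightarrow> 0"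
    proof (intro AE_I2)
      fix t :: real
      have "(\<lambda>n. 1 / (1 + (real n)\<^sup>2)) \<longlonglongrightarrow> 0" by real_asymp
      from tendsto_mult_right_zero[OF this, of C]
      have lim: "(\<lambda>n. C / (1 + (real n)\<^sup>2)) \<longlonglongrightarrow> 0" by simp
      show "(\<lambda>n. g (Complex t (real n))) \<longlonglongrightarrow> 0"
      proof (rule Lim_null_comparison[OF always_eventually lim], intro allI)
        fix n
        have "C / (1 + (cmod (Complex t (real n)))\<^sup>2) \<le> C / (1 + (real n)\<^sup>2)"
          using C by (intro divide_left_mono mult_pos_pos) (auto simp: cmod_power2 add_nonneg_pos add_pos_nonneg)
        then show "cmod (g (Complex t (real n))) \<le> C / (1 + (real n)\<^sup>2)"
          using bd[of "Complex t (real n)"] by simp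
      qed
    qed
  qed (use meas bd' in auto)
  then have "(\<lambda>n::nat. \<integral>t. g (Complex t 0) \<partial>lborel) \<longlonglongrightarrow> 0"
    by (simp only: eq[symmetric] integral_zero)
  then show "(\<integral>t. g (of_real t) \<partial>lborel) = 0"
    by (simp add: LIMSEQ_const_iff Complex_eq)
qed

text \<open>The triangle inequality gives 1 + |\<zeta>| \<le> |\<zeta> - b| + (1 + |b|), and the
  last summand is absorbed using |\<zeta> - b| \<ge> |Im b|.\<close>

lemma inverse_below_bound:
  assumes b: "Im b < 0" and \<zeta>: "0 \<le> Im \<zeta>"
  shows "1 / cmod (\<zeta> - b) \<le> (1 + (1 + cmod b) / \<bar>Im b\<bar>) / (1 + cmod \<zeta>)"
proof -
  have 1: "\<bar>Im b\<bar> \<le> cmod (\<zeta> - b)"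
    using abs_Im_le_cmod[of "\<zeta> - b"] b \<zeta> by simp
  have "1 + cmod \<zeta> \<le> cmod (\<zeta> - b) + (1 + cmod b)"
    using norm_triangle_ineq[of "\<zeta> - b" b] by simp
  also have "1 + cmod b \<le> (1 + cmod b) / \<bar>Im b\<bar> * cmod (\<zeta> - b)"
    using mult_left_mono[OF 1, of "1 + cmod b"] b by (simp add: field_simps)
  finally have "1 + cmod \<zeta> \<le> (1 + (1 + cmod b) / \<bar>Im b\<bar>) * cmod (\<zeta> - b)"
    by (simp add: algebra_simps)
  moreover have "cmod (\<zeta> - b) > 0" using 1 b by linarith
  moreover have "1 + cmod \<zeta> > 0" by (simp add: add_pos_nonneg)
  ultimately show ?thesis by (simp add: pos_divide_le_eq pos_le_divide_eq)
qed

text \<open>Subtracting \<kappa> / (\<zeta> - cnj p), with \<kappa> chosen to cancel the value of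
  \<open>g\<close> at \<open>p\<close>, makes the quotient by \<zeta> - p holomorphic across
  \<open>p\<close> and of quadratic decay, so its integral vanishes. What remains is \<kappa> / |t -
  p|^2, a multiple of the Cauchy density.\<close>

lemma integral_Cauchy_kernel:
  fixes g :: "complex \<Rightarrow> complex"
  assumes \<epsilon>: "\<epsilon> > 0" and holo: "g holomorphic_on {\<zeta>. - \<epsilon> < Im \<zeta>}"
    and bd: "\<And>\<zeta>. 0 \<le> Im \<zeta> \<Longrightarrow> cmod (g \<zeta>) \<le> C / (1 + cmod \<zeta>)"
    and p: "0 < Im p"
  shows "integrable lborel (\<lambda>t. g (of_real t) / (of_real t - p))"
    and "(\<integral>t. g (of_real t) / (of_real t - p) \<partial>lborel) = 2 * pi * \<i> * g p"
proof -
  have C: "0 \<le> C" using bd[of 0] norm_ge_zero[of "g 0"] by (simp del: norm_ge_zero)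
  \<comment> \<open>This keeps the pole \<open>cnj p\<close> of the correction term out of the
    half-plane.\<close>
  define \<delta> where "\<delta> = min \<epsilon> (Im p)"
  have \<delta>: "\<delta> > 0" using \<epsilon> p by (simp add: \<delta>_def)
  define \<kappa> where "\<kappa> = g p * (p - cnj p)"
  define q where "q \<zeta> = g \<zeta> - \<kappa> / (\<zeta> - cnj p)" for \<zeta>
  have pne: "p - cnj p \<noteq> 0" using p by (auto simp: complex_eq_iff)
  have q0: "q p = 0" using pne by (simp add: q_def \<kappa>_def)
  have qh: "q holomorphic_on {\<zeta>. - \<delta> < Im \<zeta>}"
    unfolding q_def using \<delta>
    by (intro holomorphic_intros holomorphic_on_subset[OF holo]) (auto simp: \<delta>_def complex_eq_iff)
  define Q where "Q \<zeta> = (if \<zeta> = p then deriv q p else (q \<zeta> - q p) / (\<zeta> - p))" for \<zeta>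
  have Qh: "Q holomorphic_on {\<zeta>. - \<delta> < Im \<zeta>}"
    unfolding Q_def by (rule pole_lemma[OF qh]) (use p \<delta> in \<open>simp add: interior_open open_above\<close>)
  \<comment> \<open>From this radius on, both \<open>p\<close> and \<open>cnj p\<close> are at
    distance at least (1 + |\<zeta>|) / 4 from \<zeta>; within it \<open>Q\<close> is bounded by
    compactness.\<close>
  define R where "R = 2 * cmod p + 1"
  define K where "K = 4 * (C + 4 * cmod \<kappa>)"
  have K: "K \<ge> 0" using C by (simp add: K_def)
  have far: "cmod (Q \<zeta>) \<le> K / (1 + (cmod \<zeta>)\<^sup>2)" if \<zeta>: "0 \<le> Im \<zeta>" "R \<le> cmod \<zeta>" for \<zeta>
  proof -
    define r where "r = 1 + cmod \<zeta>"
    have r: "r > 0" by (simp add: r_def add_pos_nonneg)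
    have d: "r / 4 \<le> cmod (\<zeta> - b)" if "cmod b = cmod p" for b
    proof -
      have "cmod \<zeta> \<le> cmod (\<zeta> - b) + cmod b" using norm_triangle_ineq[of "\<zeta> - b" b] by simp
      then have "r \<le> 2 * cmod (\<zeta> - b)" using that \<zeta>(2) unfolding R_def r_def by linarith
      then have "r / 4 \<le> 2 * cmod (\<zeta> - b) / 4" by (rule divide_right_mono) simp
      also have "\<dots> \<le> cmod (\<zeta> - b)" by simp
      finally show ?thesis .
    qed
    have d1: "r / 4 \<le> cmod (\<zeta> - p)" and d2: "r / 4 \<le> cmod (\<zeta> - cnj p)"
      by (rule d, rule refl, rule d, rule complex_mod_cnj)
    have ne: "\<zeta> \<noteq> p" using d1 r by auto
    have "cmod (q \<zeta>) \<le> cmod (g \<zeta>) + cmod \<kappa> / cmod (\<zeta> - cnj p)"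
      unfolding q_def by (metis norm_triangle_ineq4 norm_divide)
    also have "\<dots> \<le> C / r + cmod \<kappa> / (r / 4)"
      using d2 r bd[OF \<zeta>(1), folded r_def]
      by (intro add_mono divide_left_mono) (auto intro!: mult_pos_pos)
    also have "\<dots> = (C + 4 * cmod \<kappa>) / r"
      by (simp add: add_divide_distrib)
    finally have qb: "cmod (q \<zeta>) \<le> (C + 4 * cmod \<kappa>) / r" .
    have "cmod (Q \<zeta>) = cmod (q \<zeta>) / cmod (\<zeta> - p)" using ne by (simp add: Q_def q0 norm_divide)
    also have "\<dots> \<le> ((C + 4 * cmod \<kappa>) / r) / (r / 4)"
      using d1 r qb C by (intro frac_le) auto
    also have "\<dots> = K / r\<^sup>2" by (simp add: K_def power2_eq_square)
    also have "\<dots> \<le> K / (1 + (cmod \<zeta>)\<^sup>2)"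
      using K by (intro divide_left_mono mult_pos_pos) (auto simp: r_def power2_eq_square algebra_simps intro!: add_pos_nonneg mult_pos_pos)
    finally show ?thesis .
  qed
  have "compact (Q ` (cball 0 R \<inter> {\<zeta>. 0 \<le> Im \<zeta>}))"
    by (intro compact_continuous_image continuous_on_subset[OF holomorphic_on_imp_continuous_on[OF Qh]]
        compact_Int_closed compact_cball closed_halfspace_Im_ge) (use \<delta> in auto)
  then have "bounded (Q ` (cball 0 R \<inter> {\<zeta>. 0 \<le> Im \<zeta>}))" by (rule compact_imp_bounded)
  then obtain M where "\<And>x. x \<in> Q ` (cball 0 R \<inter> {\<zeta>. 0 \<le> Im \<zeta>}) \<Longrightarrow> cmod x \<le> M"
    unfolding bounded_iff by blast
  then have M: "cmod (Q \<zeta>) \<le> M" if "cmod \<zeta> \<le> R" "0 \<le> Im \<zeta>" for \<zeta> using that by auto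
  have M0: "M \<ge> 0" using order_trans[OF norm_ge_zero M[of 0]] by (simp add: R_def)
  define C' where "C' = max K (M * (1 + R\<^sup>2))"
  have Qb: "cmod (Q \<zeta>) \<le> C' / (1 + (cmod \<zeta>)\<^sup>2)" if \<zeta>: "0 \<le> Im \<zeta>" for \<zeta>
  proof (cases "R \<le> cmod \<zeta>")
    case True
    have "K / (1 + (cmod \<zeta>)\<^sup>2) \<le> C' / (1 + (cmod \<zeta>)\<^sup>2)"
      by (intro divide_right_mono) (auto simp: C'_def)
    then show ?thesis using far[OF \<zeta> True] by linarith
  next
    case False
    have "cmod (Q \<zeta>) * (1 + (cmod \<zeta>)\<^sup>2) \<le> M * (1 + R\<^sup>2)"
      using False M[of \<zeta>] \<zeta> M0 by (intro mult_mono add_mono power_mono) auto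
    also have "\<dots> \<le> C'" by (simp add: C'_def)
    finally show ?thesis by (simp add: pos_le_divide_eq add_pos_nonneg)
  qed
  note Q = integral_real_line_eq_0[OF \<delta> Qh Qb]
  have den: "1 / ((of_real t - p) * (of_real t - cnj p)) = of_real (1 / ((t - Re p)\<^sup>2 + (Im p)\<^sup>2))" for t
  proof -
    have "(of_real t - p) * (of_real t - cnj p) = of_real ((t - Re p)\<^sup>2 + (Im p)\<^sup>2)"
      by (simp add: complex_eq_iff power2_eq_square algebra_simps)
    then show ?thesis by simp
  qed
  have eq: "g (of_real t) / (of_real t - p) = Q (of_real t) + \<kappa> * of_real (1 / ((t - Re p)\<^sup>2 + (Im p)\<^sup>2))" for t
  proof -
    have ne: "of_real t \<noteq> p" using p by auto
    then have "Q (of_real t) = q (of_real t) / (of_real t - p)" by (simp add: Q_def q0)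
    also have "\<dots> = g (of_real t) / (of_real t - p) - \<kappa> * (1 / ((of_real t - p) * (of_real t - cnj p)))"
      by (simp add: q_def diff_divide_distrib mult.commute)
    finally show ?thesis unfolding den by simp
  qed
  note D = Cauchy_density[OF p, of "Re p"]
  show "integrable lborel (\<lambda>t. g (of_real t) / (of_real t - p))"
    unfolding eq using Q(1) D(1) by (intro Bochner_Integration.integrable_add integrable_mult_right integrable_of_real)
  have "(\<integral>t. g (of_real t) / (of_real t - p) \<partial>lborel) = \<kappa> * of_real (pi / Im p)"
    unfolding eq using Q D
    by (subst Bochner_Integration.integral_add) (auto simp: integral_of_real simp del: of_real_divide of_real_add)
  also have "\<dots> = 2 * pi * \<i> * g p"
    using p by (simp add: \<kappa>_def complex_diff_cnj field_simps)
  finally show "(\<integral>t. g (of_real t) / (of_real t - p) \<partial>lborel) = 2 * pi * \<i> * g p" .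
qed

text \<open>Partial fractions reduce the exponents (m+1, k+1) to (m+1, k) and (m, k+1), and the
  binomial coefficients combine by Pascal's rule. Integrals with all poles on one side of the axis
  vanish, so only exponents (1, 1) contribute.\<close>

lemma integral_rational_kernel:
  fixes a b :: complex
  assumes a: "0 < Im a" and b: "Im b < 0"
  shows "integrable lborel (\<lambda>t. 1 / ((of_real t - a) ^ Suc m * (of_real t - b) ^ Suc k))"
    and "(\<integral>t. 1 / ((of_real t - a) ^ Suc m * (of_real t - b) ^ Suc k) \<partial>lborel)
      = 2 * pi * \<i> * (-1) ^ m * of_nat ((m + k) choose m) / (a - b) ^ Suc (m + k)"
proof -
  define e where "e m k t = 1 / ((of_real t - a) ^ m * (of_real t - b) ^ k)" for m k :: nat and t :: real
  have below: "integrable lborel (\<lambda>t. 1 / (of_real t - b) ^ Suc (Suc k)) \<and> (\<integral>t. 1 / (of_real t - b) ^ Suc (Suc k) \<partial>lborel) = 0"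
    if b: "Im b < 0" for b and k :: nat
  proof -
    define K where "K = 1 + (1 + cmod b) / \<bar>Im b\<bar>"
    have K: "K \<ge> 0" by (simp add: K_def)
    have h: "(\<lambda>\<zeta>. 1 / (\<zeta> - b) ^ Suc (Suc k)) holomorphic_on {\<zeta>. - (- Im b) < Im \<zeta>}"
      by (intro holomorphic_intros) auto
    have bd: "cmod (1 / (\<zeta> - b) ^ Suc (Suc k)) \<le> K ^ Suc (Suc k) / (1 + (cmod \<zeta>)\<^sup>2)" if "0 \<le> Im \<zeta>" for \<zeta>
    proof -
      have "cmod (1 / (\<zeta> - b) ^ Suc (Suc k)) = (1 / cmod (\<zeta> - b)) ^ Suc (Suc k)"
        by (simp add: norm_divide norm_power power_divide norm_mult)
      also have "\<dots> \<le> (K / (1 + cmod \<zeta>)) ^ Suc (Suc k)"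
        unfolding K_def by (intro power_mono inverse_below_bound b that) simp
      also have "\<dots> = K ^ Suc (Suc k) / (1 + cmod \<zeta>) ^ Suc (Suc k)" by (rule power_divide)
      also have "\<dots> \<le> K ^ Suc (Suc k) / (1 + (cmod \<zeta>)\<^sup>2)"
      proof (intro divide_left_mono)
        have "1 + (cmod \<zeta>)\<^sup>2 \<le> (1 + cmod \<zeta>) ^ 2" by (simp add: power2_eq_square algebra_simps)
        also have "\<dots> \<le> (1 + cmod \<zeta>) ^ Suc (Suc k)" by (intro power_increasing) auto
        finally show "1 + (cmod \<zeta>)\<^sup>2 \<le> (1 + cmod \<zeta>) ^ Suc (Suc k)" .
      qed (use K in \<open>auto intro!: mult_pos_pos add_pos_nonneg zero_less_power\<close>)
      finally show ?thesis .
    qed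
    show ?thesis
      using integral_real_line_eq_0[OF _ h bd] b by simp
  qed
  have edge0: "integrable lborel (e 0 (Suc (Suc k))) \<and> (\<integral>t. e 0 (Suc (Suc k)) t \<partial>lborel) = 0" for k
    using below[OF b, of k] by (simp add: e_def[abs_def])
  \<comment> \<open>Conjugation moves the pole \<open>a\<close> to the lower half-plane, where
    \<open>below\<close> applies.\<close>
  have edge1: "integrable lborel (e (Suc (Suc m)) 0) \<and> (\<integral>t. e (Suc (Suc m)) 0 t \<partial>lborel) = 0" for m
  proof -
    have c: "e (Suc (Suc m)) 0 = (\<lambda>t. cnj (1 / (of_real t - cnj a) ^ Suc (Suc m)))"
      by (simp add: e_def fun_eq_iff)
    have "Im (cnj a) < 0" using a by simp
    note B = below[OF this, of m]
    show ?thesis unfolding c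
      using integrable_cnj[OF conjunct1[OF B]] B by (simp only: Bochner_Integration.integral_cnj complex_cnj_zero)
  qed
  have ab: "a - b \<noteq> 0" using a b by auto
  \<comment> \<open>Here the recursion would lead to single first-order poles, which are not
    integrable on the line; Cauchy's formula is used instead.\<close>
  have base: "integrable lborel (e 1 1) \<and> (\<integral>t. e 1 1 t \<partial>lborel) = 2 * pi * \<i> / (a - b)"
  proof -
    have h: "(\<lambda>\<zeta>. 1 / (\<zeta> - b)) holomorphic_on {\<zeta>. - (- Im b) < Im \<zeta>}"
      by (intro holomorphic_intros) auto
    have bd: "cmod (1 / (\<zeta> - b)) \<le> (1 + (1 + cmod b) / \<bar>Im b\<bar>) / (1 + cmod \<zeta>)" if "0 \<le> Im \<zeta>" for \<zeta>
      using inverse_below_bound[OF b that] by (simp add: norm_divide)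
    have c: "e 1 1 = (\<lambda>t. 1 / (of_real t - b) / (of_real t - a))" by (simp add: e_def fun_eq_iff mult.commute)
    show ?thesis
      using integral_Cauchy_kernel[OF _ h bd a] b unfolding c by simp
  qed
  have ne: "of_real t - a \<noteq> 0" "of_real t - b \<noteq> 0" for t using a b by auto
  have rec: "e (Suc m) (Suc k) = (\<lambda>t. (e (Suc m) k t - e m (Suc k) t) / (a - b))" for m k
  proof
    fix t
    have "e (Suc m) k t = (of_real t - b) * e (Suc m) (Suc k) t" "e m (Suc k) t = (of_real t - a) * e (Suc m) (Suc k) t"
      using ne[of t] by (simp_all add: e_def)
    then have "e (Suc m) k t - e m (Suc k) t = (a - b) * e (Suc m) (Suc k) t"
      by (simp add: algebra_simps)
    then show "e (Suc m) (Suc k) t = (e (Suc m) k t - e m (Suc k) t) / (a - b)" using ab by simp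
  qed
  have main: "integrable lborel (e (Suc m) (Suc k)) \<and> (\<integral>t. e (Suc m) (Suc k) t \<partial>lborel)
      = 2 * pi * \<i> * (-1) ^ m * of_nat ((m + k) choose m) / (a - b) ^ Suc (m + k)"
    if "m + k = n" for n
    using that
  proof (induction n arbitrary: m k)
    case 0
    then show ?case using base by simp
  next
    case (Suc n)
    have pq: "integrable lborel (e (Suc m) (Suc k)) \<and> (\<integral>t. e (Suc m) (Suc k) t \<partial>lborel) = (A - B) / (a - b)"
      if "integrable lborel (e (Suc m) k) \<and> (\<integral>t. e (Suc m) k t \<partial>lborel) = A"
        "integrable lborel (e m (Suc k)) \<and> (\<integral>t. e m (Suc k) t \<partial>lborel) = B" for A B m k
      unfolding rec[of m k] using that by (simp add: Bochner_Integration.integral_diff)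
    consider m' where "m = Suc m'" "k = 0" | k' where "m = 0" "k = Suc k'" | m' k' where "m = Suc m'" "k = Suc k'"
      using Suc.prems by (cases m; cases k) auto
    then show ?case
    proof cases
      case 1
      then show ?thesis using pq[OF edge1[of m'] Suc.IH[of m' 0]] Suc.prems by simp
    next
      case 2
      then show ?thesis using pq[OF Suc.IH[of 0 k'] edge0[of k']] Suc.prems by simp
    next
      case 3
      have alg: "(c * - s * A / X - c * s * B / X) / x = c * - s * (A + B) / (x * X)" if "x \<noteq> 0" "X \<noteq> 0"
        for c s A B X x :: complex
        using that by (simp add: field_simps)
      have "((2 * pi * \<i> * (-1) ^ Suc m' * of_nat ((Suc m' + k') choose Suc m') / (a - b) ^ Suc (Suc m' + k'))
          - (2 * pi * \<i> * (-1) ^ m' * of_nat ((m' + Suc k') choose m') / (a - b) ^ Suc (m' + Suc k'))) / (a - b)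
          = 2 * pi * \<i> * (-1) ^ Suc m' * of_nat ((Suc m' + Suc k') choose Suc m') / (a - b) ^ Suc (Suc m' + Suc k')"
        using alg[OF ab, of "(a - b) ^ Suc (Suc (m' + k'))" "2 * pi * \<i>" "(-1) ^ m'"
            "of_nat (Suc (m' + k') choose Suc m')" "of_nat (Suc (m' + k') choose m')"] ab
        by (simp add: add.commute[of "of_nat (Suc (m' + k') choose Suc m')"])
      moreover have "Suc m' + k' = n" "m' + Suc k' = n" using 3 Suc.prems by simp_all
      ultimately show ?thesis
        using pq[OF Suc.IH[of "Suc m'" k'] Suc.IH[of m' "Suc k'"]] unfolding 3 by (simp only:)
    qed
  qed
  show "integrable lborel (\<lambda>t. 1 / ((of_real t - a) ^ Suc m * (of_real t - b) ^ Suc k))"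
    and "(\<integral>t. 1 / ((of_real t - a) ^ Suc m * (of_real t - b) ^ Suc k) \<partial>lborel)
      = 2 * pi * \<i> * (-1) ^ m * of_nat ((m + k) choose m) / (a - b) ^ Suc (m + k)"
    using main[OF refl] by (simp_all only: e_def[abs_def])
qed

subsection \<open>Integration one coordinate at a time\<close>

lemma nn_integral_prod_vec:
  fixes w :: "'n::finite \<Rightarrow> real \<Rightarrow> ennreal"
  assumes [measurable]: "\<And>k. w k \<in> borel_measurable borel"
  shows "(\<integral>\<^sup>+x. (\<Prod>k\<in>UNIV. w k (x $ k)) \<partial>(lborel :: (real^'n) measure)) = (\<Prod>k\<in>UNIV. \<integral>\<^sup>+t. w k t \<partial>lborel)"
proof -
  \<comment> \<open>The product formula for \<open>lborel\<close> indexes its factors by basis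
    vectors; this recovers the coordinate from the vector.\<close>
  define f where "f b = w (THE k. b = axis k (1::real))" for b :: "real^'n"
  have f: "f (axis k 1) = w k" for k by (simp add: f_def axis_eq_axis)
  have B: "(Basis :: (real^'n) set) = range (\<lambda>k. axis k 1)" by (auto simp: Basis_vec_def)
  have inj: "inj (\<lambda>k. axis k 1 :: real^'n)" by (auto simp: inj_def axis_eq_axis)
  have "(\<integral>\<^sup>+x. (\<Prod>b\<in>Basis. f b (x \<bullet> b)) \<partial>(lborel :: (real^'n) measure)) = (\<Prod>b\<in>Basis. (\<integral>\<^sup>+x. f b x \<partial>lborel))"
    by (rule nn_integral_lborel_prod) (auto simp: f_def)
  then show ?thesis
    by (simp add: B prod.reindex[OF inj] f inner_axis)
qed

definition upd :: "'a^'n \<Rightarrow> 'n \<Rightarrow> 'a \<Rightarrow> 'a^'n" where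
  "upd x j t = (\<chi> k. if k = j then t else x $ k)"

lemma upd_nth [simp]: "upd x j t $ k = (if k = j then t else x $ k)"
  by (simp add: upd_def)

text \<open>Integrate \<open>f\<close> along lines in direction \<open>j\<close>, the base points being weighted by unit mass in
  coordinate \<open>j\<close>; a translation in that direction turns the double integral into a product.\<close>

lemma integral_slice:
  fixes f :: "real^'n \<Rightarrow> complex"
  assumes f: "integrable lborel f"
  shows "(\<integral>x. f x \<partial>lborel) = (\<integral>x. indicator {0..1} (x $ j) *\<^sub>R (\<integral>t. f (upd x j t) \<partial>lborel) \<partial>lborel)"
proof -
  have [measurable]: "f \<in> borel_measurable borel" using f by auto
  have mj[measurable]: "(\<lambda>x::real^'n. x $ j) \<in> borel_measurable borel"
    by (intro borel_measurable_continuous_onI continuous_intros)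
  \<comment> \<open>\<open>G\<close> weights \<open>f\<close> by a unit window whose position is
    \<open>s\<close>, and integrating over \<open>s\<close> gives back \<open>f\<close>. Its
    translate \<open>H\<close> has a fixed window and runs along the line through x in direction
    \<open>j\<close>.\<close>
  define G where "G = (\<lambda>p::(real^'n) \<times> real. indicator {0..1} (fst p $ j - snd p) *\<^sub>R f (fst p))"
  define H where "H = (\<lambda>p::(real^'n) \<times> real. indicator {0..1} (fst p $ j) *\<^sub>R f (fst p + snd p *\<^sub>R axis j 1))"
  have [measurable]: "G \<in> borel_measurable borel" "H \<in> borel_measurable borel"
    unfolding G_def H_def borel_prod[symmetric] by measurable
  have HG: "H (x, s) = G (x + s *\<^sub>R axis j 1, s)" for x s
    by (simp add: H_def G_def)
  have ind: "(\<integral>\<^sup>+s. indicator {0..1} (c - s) \<partial>lborel) = (1::ennreal)" for c :: real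
  proof -
    have "(\<integral>\<^sup>+s. indicator {0..1} (c - s) \<partial>lborel) = (\<integral>\<^sup>+s. indicator {c - 1..c} s \<partial>(lborel::real measure))"
      by (intro nn_integral_cong) (auto simp: indicator_def)
    then show ?thesis by simp
  qed
  have ind': "(\<integral>s. indicator {0..1} (c - s) *\<^sub>R z \<partial>lborel) = z" for c :: real and z :: complex
  proof -
    have "(\<integral>s. indicator {0..1} (c - s) *\<^sub>R z \<partial>lborel) = (\<integral>s. indicator {c - 1..c} s *\<^sub>R z \<partial>(lborel :: real measure))"
      by (intro Bochner_Integration.integral_cong) (auto simp: indicator_def)
    then show ?thesis by simp
  qed
  have "(\<integral>\<^sup>+p. norm (G p) \<partial>lborel) = (\<integral>\<^sup>+x. (\<integral>\<^sup>+s. indicator {0..1} (x $ j - s) * ennreal (norm (f x)) \<partial>lborel) \<partial>lborel)"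
    by (subst nn_integral_lborel_pair(1)) (measurable, auto simp: G_def indicator_def intro!: nn_integral_cong)
  also have "\<dots> = (\<integral>\<^sup>+x. norm (f x) \<partial>lborel)"
    by (simp add: nn_integral_multc ind)
  also have "\<dots> < \<infinity>" using f by (simp add: integrable_iff_bounded)
  finally have G: "integrable lborel G" by (auto intro!: integrableI_bounded)
  have "(\<integral>\<^sup>+p. norm (H p) \<partial>lborel) = (\<integral>\<^sup>+s. (\<integral>\<^sup>+x. norm (G (x + s *\<^sub>R axis j 1, s)) \<partial>lborel) \<partial>lborel)"
    by (subst nn_integral_lborel_pair(2)) (simp_all add: HG)
  also have "\<dots> = (\<integral>\<^sup>+s. (\<integral>\<^sup>+x. norm (G (x, s)) \<partial>lborel) \<partial>lborel)"
    by (intro nn_integral_cong nn_integral_lborel_translate) measurable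
  also have "\<dots> = (\<integral>\<^sup>+p. norm (G p) \<partial>lborel)"
    by (subst nn_integral_lborel_pair(2)) auto
  also have "\<dots> < \<infinity>" using G by (simp add: integrable_iff_bounded)
  finally have H: "integrable lborel H" by (auto intro!: integrableI_bounded)
  have "(\<integral>x. f x \<partial>lborel) = (\<integral>x. (\<integral>s. G (x, s) \<partial>lborel) \<partial>lborel)"
    by (simp add: G_def ind')
  also have "\<dots> = (\<integral>s. (\<integral>x. G (x, s) \<partial>lborel) \<partial>lborel)"
    using integral_lborel_pair(1,2)[OF G] by simp
  also have "\<dots> = (\<integral>s. (\<integral>x. H (x, s) \<partial>lborel) \<partial>lborel)"
    unfolding HG by (intro Bochner_Integration.integral_cong refl integral_lborel_translate[symmetric]) measurable
  also have "\<dots> = (\<integral>x. (\<integral>s. H (x, s) \<partial>lborel) \<partial>lborel)"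
    using integral_lborel_pair(1,2)[OF H] by simp
  also have "\<dots> = (\<integral>x. indicator {0..1} (x $ j) *\<^sub>R (\<integral>t. f (upd x j t) \<partial>lborel) \<partial>lborel)"
  proof (intro Bochner_Integration.integral_cong refl)
    fix x :: "real^'n"
    have u: "x + s *\<^sub>R axis j 1 = upd x j (s + x $ j)" for s
      by (simp add: vec_eq_iff axis_def)
    have um: "(\<lambda>t. f (upd x j t)) \<in> borel_measurable borel"
    proof -
      have "(\<lambda>t. f (x + (t - x $ j) *\<^sub>R axis j 1)) \<in> borel_measurable borel" by measurable
      then show ?thesis by (simp add: u)
    qed
    show "(\<integral>s. H (x, s) \<partial>lborel) = indicator {0..1} (x $ j) *\<^sub>R (\<integral>t. f (upd x j t) \<partial>lborel)"
      using integral_lborel_translate[OF um, of "x $ j"] by (simp add: H_def u)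
  qed
  finally show ?thesis .
qed

text \<open>The intermediate points when Cauchy's formula is applied one coordinate at a time: the
  coordinates in \<open>S\<close> have already been evaluated at \<open>p\<close>, the others are
  still real variables of integration.\<close>

definition mixed :: "'n set \<Rightarrow> complex^'n \<Rightarrow> real^'n \<Rightarrow> complex^'n" where
  "mixed S p x = (\<chi> k. if k \<in> S then p $ k else of_real (x $ k))"

lemma prod_kernel_integrable:
  fixes F :: "real^'n \<Rightarrow> complex" and q :: "'n \<Rightarrow> real \<Rightarrow> complex"
  assumes F: "F \<in> borel_measurable borel" "\<And>x. cmod (F x) \<le> B"
    and q: "\<And>k. integrable lborel (q k)"
  shows "integrable lborel (\<lambda>x. F x * (\<Prod>k\<in>UNIV. q k (x $ k)))"
proof (rule integrableI_bounded)
  have [measurable]: "q k \<in> borel_measurable borel" for k using q[of k] by auto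
  have [measurable]: "(\<lambda>x::real^'n. x $ j) \<in> borel_measurable borel" for j
    by (intro borel_measurable_continuous_onI continuous_intros)
  show "(\<lambda>x. F x * (\<Prod>k\<in>UNIV. q k (x $ k))) \<in> borel_measurable lborel"
    using F(1) by simp
  have B: "B \<ge> 0" using F(2) norm_ge_zero order_trans by blast
  have "(\<integral>\<^sup>+x. norm (F x * (\<Prod>k\<in>UNIV. q k (x $ k))) \<partial>lborel)
      \<le> (\<integral>\<^sup>+x. B * (\<Prod>k\<in>UNIV. ennreal (norm (q k (x $ k)))) \<partial>lborel)"
  proof (intro nn_integral_mono)
    fix x :: "real^'n"
    have "norm (F x * (\<Prod>k\<in>UNIV. q k (x $ k))) \<le> B * (\<Prod>k\<in>UNIV. norm (q k (x $ k)))"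
      by (simp add: norm_mult prod_norm mult_right_mono F(2) prod_nonneg)
    then show "ennreal (norm (F x * (\<Prod>k\<in>UNIV. q k (x $ k)))) \<le> B * (\<Prod>k\<in>UNIV. ennreal (norm (q k (x $ k))))"
      using B by (simp add: prod_ennreal ennreal_mult[symmetric] prod_nonneg ennreal_leI)
  qed
  also have "\<dots> = B * (\<Prod>k\<in>UNIV. \<integral>\<^sup>+t. norm (q k t) \<partial>lborel)"
    by (subst nn_integral_cmult) (simp_all add: nn_integral_prod_vec[of "\<lambda>k t. ennreal (norm (q k t))"])
  also have "\<dots> < \<infinity>"
  proof -
    have "(\<Prod>k\<in>A. \<integral>\<^sup>+t. norm (q k t) \<partial>lborel) < \<infinity>" if "finite A" for A
      using that q by (induction A) (auto simp: ennreal_mult_less_top integrable_iff_bounded)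
    then show ?thesis by (simp add: ennreal_mult_less_top)
  qed
  finally show "(\<integral>\<^sup>+x. norm (F x * (\<Prod>k\<in>UNIV. q k (x $ k))) \<partial>lborel) < \<infinity>" .
qed

text \<open>A coordinate that has been integrated out receives the indicator of [0,1] as its new
  kernel. This has unit mass, so every stage is again an integral over the full space with a product
  kernel, and the last one is the constant \<open>f p\<close> over the unit cube.\<close>

lemma integral_iterated_kernel:
  fixes f :: "complex^'n \<Rightarrow> complex" and q :: "'n \<Rightarrow> real \<Rightarrow> complex"
  assumes meas: "\<And>S. (\<lambda>x. f (mixed S p x)) \<in> borel_measurable borel"
    and bd: "\<And>S x. cmod (f (mixed S p x)) \<le> B"
    and q: "\<And>k. integrable lborel (q k)"
    and step: "\<And>S j x. j \<notin> S \<Longrightarrow> (\<integral>t. f (mixed S p (upd x j t)) * q j t \<partial>lborel) = c j * f (mixed (insert j S) p x)"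
  shows "(\<integral>x. f (mixed {} p x) * (\<Prod>k\<in>UNIV. q k (x $ k)) \<partial>lborel) = (\<Prod>k\<in>UNIV. c k) * f p"
proof -
  define r where "r S k = (if k \<in> S then (\<lambda>t. complex_of_real (indicator {0..1} t)) else q k)" for S and k :: 'n
  have r: "integrable lborel (r S k)" for S k
    using q[of k] by (simp add: r_def)
  define I where "I S = (\<integral>x. f (mixed S p x) * (\<Prod>k\<in>UNIV. r S k (x $ k)) \<partial>lborel)" for S
  have int: "integrable lborel (\<lambda>x. f (mixed S p x) * (\<Prod>k\<in>UNIV. r S k (x $ k)))" for S
    by (rule prod_kernel_integrable[OF meas bd r])
  have stepI: "I S = c j * I (insert j S)" if j: "j \<notin> S" for S j
  proof -
    have inner: "indicator {0..1} (x $ j) *\<^sub>R (\<integral>t. f (mixed S p (upd x j t)) * (\<Prod>k\<in>UNIV. r S k (upd x j t $ k)) \<partial>lborel)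
        = c j * (f (mixed (insert j S) p x) * (\<Prod>k\<in>UNIV. r (insert j S) k (x $ k)))" for x
    proof -
      define P where "P = (\<Prod>k\<in>UNIV - {j}. r S k (x $ k))"
      have 1: "(\<Prod>k\<in>UNIV. r S k (upd x j t $ k)) = q j t * P" for t
        unfolding P_def using j by (subst prod.remove[of _ j]) (auto simp: r_def intro!: prod.cong)
      have 2: "(\<Prod>k\<in>UNIV. r (insert j S) k (x $ k)) = of_real (indicator {0..1} (x $ j)) * P"
        unfolding P_def by (subst prod.remove[of _ j]) (auto simp: r_def intro!: prod.cong)
      have "(\<integral>t. f (mixed S p (upd x j t)) * (\<Prod>k\<in>UNIV. r S k (upd x j t $ k)) \<partial>lborel)
          = (\<integral>t. (f (mixed S p (upd x j t)) * q j t) * P \<partial>lborel)"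
        unfolding 1 by (simp add: mult.assoc)
      also have "\<dots> = c j * f (mixed (insert j S) p x) * P"
        by (simp add: step[OF j])
      finally show ?thesis unfolding 2 by (simp add: scaleR_conv_of_real mult_ac)
    qed
    have "I S = (\<integral>x. indicator {0..1} (x $ j) *\<^sub>R
        (\<integral>t. f (mixed S p (upd x j t)) * (\<Prod>k\<in>UNIV. r S k (upd x j t $ k)) \<partial>lborel) \<partial>lborel)"
      unfolding I_def by (rule integral_slice[OF int])
    also have "\<dots> = c j * I (insert j S)" unfolding inner I_def by simp
    finally show ?thesis .
  qed
  have "I {} = (\<Prod>k\<in>T. c k) * I T" if "finite T" for T
    using that
  proof (induction T)
    case (insert j T)
    then show ?case using stepI[of j T] by simp
  qed simp
  from this[of UNIV] have "I {} = (\<Prod>k\<in>UNIV. c k) * I UNIV" by simp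
  moreover have "I UNIV = f p"
  proof -
    have m: "mixed UNIV p x = p" for x by (simp add: mixed_def vec_eq_iff)
    have "(\<Prod>k\<in>UNIV. r UNIV k (x $ k)) = of_real (indicator (cbox 0 (\<chi> k. 1)) x)" for x :: "real^'n"
      by (auto simp: r_def indicator_def mem_box_cart prod_zero_iff)
    moreover have "(\<integral>x. f p * of_real (indicator (cbox 0 (\<chi> k. 1)) x) \<partial>(lborel :: (real^'n) measure)) = f p"
    proof -
      have "measure lborel (cbox 0 (\<chi> k. 1) :: (real^'n) set) = 1"
        using content_cbox_cart[of 0 "\<chi> k. 1 :: real^'n"] by (simp add: interval_ne_empty_cart)
      then show ?thesis by simp
    qed
    ultimately show ?thesis by (simp add: I_def m)
  qed
  ultimately show ?thesis by (simp add: I_def r_def)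
qed

subsection \<open>Square integrable functions\<close>

definition square_integrable :: "('a::euclidean_space \<Rightarrow> complex) \<Rightarrow> bool" where
  "square_integrable f \<longleftrightarrow> f \<in> borel_measurable borel \<and> integrable lborel (\<lambda>x. (cmod (f x))\<^sup>2)"

definition L2_inner :: "('a::euclidean_space \<Rightarrow> complex) \<Rightarrow> ('a \<Rightarrow> complex) \<Rightarrow> complex" where
  "L2_inner f g = (\<integral>x. f x * cnj (g x) \<partial>lborel)"

lemma square_integrable_iff_nn:
  "square_integrable f \<longleftrightarrow> f \<in> borel_measurable borel \<and> (\<integral>\<^sup>+x. ennreal ((cmod (f x))\<^sup>2) \<partial>lborel) < \<infinity>"
  by (auto simp: square_integrable_def integrable_iff_bounded)

lemma nn_integral_square:
  assumes "square_integrable f"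
  shows "(\<integral>\<^sup>+x. ennreal ((cmod (f x))\<^sup>2) \<partial>lborel) = ennreal (\<integral>x. (cmod (f x))\<^sup>2 \<partial>lborel)"
  using assms by (intro nn_integral_eq_integral) (auto simp: square_integrable_def)

lemma integrable_square_mult:
  assumes f: "square_integrable f" and g: "square_integrable g"
  shows "integrable lborel (\<lambda>x. f x * cnj (g x))"
proof (rule Bochner_Integration.integrable_bound)
  have [measurable]: "f \<in> borel_measurable borel" "g \<in> borel_measurable borel"
    using f g by (auto simp: square_integrable_def)
  show "(\<lambda>x. f x * cnj (g x)) \<in> borel_measurable lborel"
    using borel_measurable_continuous_onI[OF continuous_on_cnj[OF continuous_on_id]] by measurable
  show "integrable lborel (\<lambda>x. (cmod (f x))\<^sup>2 + (cmod (g x))\<^sup>2)"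
    using f g by (auto simp: square_integrable_def)
  show "AE x in lborel. norm (f x * cnj (g x)) \<le> norm ((cmod (f x))\<^sup>2 + (cmod (g x))\<^sup>2)"
  proof (intro AE_I2)
    fix x
    have "2 * (cmod (f x) * cmod (g x)) \<le> (cmod (f x))\<^sup>2 + (cmod (g x))\<^sup>2"
      using sum_squares_bound[of "cmod (f x)" "cmod (g x)"] by simp
    moreover have "0 \<le> cmod (f x) * cmod (g x)" by simp
    ultimately have "cmod (f x) * cmod (g x) \<le> (cmod (f x))\<^sup>2 + (cmod (g x))\<^sup>2"
      by linarith
    then show "norm (f x * cnj (g x)) \<le> norm ((cmod (f x))\<^sup>2 + (cmod (g x))\<^sup>2)"
      by (simp add: norm_mult)
  qed
qed

lemma square_integrable_lin:
  assumes f: "square_integrable f" and g: "square_integrable g"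
  shows "square_integrable (\<lambda>x. f x + c * g x)"
  unfolding square_integrable_def
proof
  have [measurable]: "f \<in> borel_measurable borel" "g \<in> borel_measurable borel"
    using f g by (auto simp: square_integrable_def)
  show "(\<lambda>x. f x + c * g x) \<in> borel_measurable borel" by measurable
  show "integrable lborel (\<lambda>x. (cmod (f x + c * g x))\<^sup>2)"
  proof (rule Bochner_Integration.integrable_bound)
    show "integrable lborel (\<lambda>x. 2 * (cmod (f x))\<^sup>2 + 2 * (cmod c)\<^sup>2 * (cmod (g x))\<^sup>2)"
      using f g by (auto simp: square_integrable_def)
    show "AE x in lborel. norm ((cmod (f x + c * g x))\<^sup>2) \<le> norm (2 * (cmod (f x))\<^sup>2 + 2 * (cmod c)\<^sup>2 * (cmod (g x))\<^sup>2)"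
    proof (intro AE_I2)
      fix x
      have "(cmod (f x + c * g x))\<^sup>2 \<le> (cmod (f x) + cmod c * cmod (g x))\<^sup>2"
        using norm_triangle_ineq[of "f x" "c * g x"] by (intro power_mono) (auto simp: norm_mult)
      also have "\<dots> \<le> 2 * (cmod (f x))\<^sup>2 + 2 * (cmod c * cmod (g x))\<^sup>2"
        using sum_squares_bound[of "cmod (f x)" "cmod c * cmod (g x)"] by (simp add: power2_sum)
      finally show "norm ((cmod (f x + c * g x))\<^sup>2) \<le> norm (2 * (cmod (f x))\<^sup>2 + 2 * (cmod c)\<^sup>2 * (cmod (g x))\<^sup>2)"
        by (simp add: power_mult_distrib)
    qed
  qed measurable
qed

interpretation L2: semi_inner_space "Collect square_integrable" L2_inner
proof
  fix f g h :: "'a \<Rightarrow> complex" and c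
  assume f: "f \<in> Collect square_integrable" and g: "g \<in> Collect square_integrable"
  show "(\<lambda>w. f w + c * g w) \<in> Collect square_integrable"
    using f g by (simp add: square_integrable_lin)
  show "L2_inner g f = cnj (L2_inner f g)"
    unfolding L2_inner_def by (simp add: Bochner_Integration.integral_cnj[symmetric] mult.commute del: Bochner_Integration.integral_cnj)
  have "L2_inner f f = (\<integral>x. of_real ((cmod (f x))\<^sup>2) \<partial>lborel)"
    unfolding L2_inner_def by (simp only: complex_norm_square)
  then show "0 \<le> Re (L2_inner f f)"
    by (simp add: Bochner_Integration.integral_nonneg del: of_real_power)
  assume h: "h \<in> Collect square_integrable"
  show "L2_inner (\<lambda>w. f w + c * g w) h = L2_inner f h + c * L2_inner g h"
    unfolding L2_inner_def using integrable_square_mult[of f h] integrable_square_mult[of g h] f g h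
    by (simp add: distrib_right mult.assoc)
qed

lemma L2_nsq: "L2.nsq f = (\<integral>x. (cmod (f x))\<^sup>2 \<partial>lborel)"
proof -
  have "L2_inner f f = (\<integral>x. of_real ((cmod (f x))\<^sup>2) \<partial>lborel)"
    unfolding L2_inner_def by (simp only: complex_norm_square)
  then show ?thesis by (simp add: L2.nsq_def del: of_real_power)
qed

lemma nn_integral_square_nsq:
  "square_integrable f \<Longrightarrow> (\<integral>\<^sup>+x. ennreal ((cmod (f x))\<^sup>2) \<partial>lborel) = ennreal (L2.nsq f)"
  by (simp add: nn_integral_square L2_nsq)

text \<open>Riesz-Fischer. Along a subsequence whose steps have squared norm at most 8^(-k), the sum
  of 4^k |d_k|^2 has finite integral; so almost everywhere |d_k| is at most a constant times 2^(-k)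
  and the subsequence converges. Fatou's lemma then gives convergence in norm of the whole
  sequence.\<close>

lemma L2_complete:
  fixes f :: "nat \<Rightarrow> 'a::euclidean_space \<Rightarrow> complex"
  assumes f: "\<And>n. square_integrable (f n)"
    and Cauchy: "\<And>e. e > 0 \<Longrightarrow> \<exists>N. \<forall>m\<ge>N. \<forall>n\<ge>N. L2.nsq (\<lambda>x. f m x + (-1) * f n x) \<le> e"
  shows "\<exists>g. square_integrable g \<and> (\<lambda>n. L2.nsq (\<lambda>x. f n x + (-1) * g x)) \<longlonglongrightarrow> 0"
proof -
  have [measurable]: "f n \<in> borel_measurable borel" for n using f[of n] by (simp add: square_integrable_def)
  have diff: "square_integrable (\<lambda>x. f m x + (-1) * f n x)" for m n
    by (rule square_integrable_lin[OF f f])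
  obtain N where N: "\<And>k m n. m \<ge> N k \<Longrightarrow> n \<ge> N k \<Longrightarrow> L2.nsq (\<lambda>x. f m x + (-1) * f n x) \<le> (1/8) ^ k"
    using Cauchy[of "(1/8) ^ k" for k] by (metis zero_less_divide_1_iff zero_less_numeral zero_less_power)
  \<comment> \<open>The maximum ensures that all later members of the subsequence also respect the
    earlier tolerances.\<close>
  define r where "r k = Max (N ` {..k})" for k
  have rN: "N i \<le> r k" if "i \<le> k" for i k using that by (simp add: r_def)
  define d where "d k x = f (r (Suc k)) x + (-1) * f (r k) x" for k x
  have dm[measurable]: "d k \<in> borel_measurable borel" for k unfolding d_def by measurable
  have "(\<integral>\<^sup>+x. (\<Sum>k. ennreal (4 ^ k * (cmod (d k x))\<^sup>2)) \<partial>lborel) = (\<Sum>k. \<integral>\<^sup>+x. ennreal (4 ^ k * (cmod (d k x))\<^sup>2) \<partial>lborel)"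
    by (rule nn_integral_suminf) measurable
  also have "\<dots> \<le> (\<Sum>k. ennreal ((1/2) ^ k))"
  proof (intro suminf_le summableI)
    fix k
    have "(\<integral>\<^sup>+x. ennreal (4 ^ k * (cmod (d k x))\<^sup>2) \<partial>lborel) = ennreal (4 ^ k) * ennreal (L2.nsq (d k))"
      using nn_integral_square_nsq[of "d k"] diff
      by (simp add: ennreal_mult nn_integral_cmult d_def[abs_def])
    also have "\<dots> \<le> ennreal (4 ^ k) * ennreal ((1/8) ^ k)"
      using N[OF rN rN, of k "Suc k" k] by (intro mult_left_mono ennreal_leI) (auto simp: d_def[abs_def])
    also have "\<dots> = ennreal ((1/2) ^ k)"
      by (simp add: ennreal_mult[symmetric] power_mult_distrib[symmetric])
    finally show "(\<integral>\<^sup>+x. ennreal (4 ^ k * (cmod (d k x))\<^sup>2) \<partial>lborel) \<le> ennreal ((1/2) ^ k)" .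
  qed
  also have "\<dots> < \<infinity>"
    by (subst suminf_ennreal2) (auto simp: summable_geometric)
  finally have "AE x in lborel. (\<Sum>k. ennreal (4 ^ k * (cmod (d k x))\<^sup>2)) \<noteq> \<infinity>"
    by (intro nn_integral_PInf_AE) (auto simp: less_top[symmetric])
  then have conv: "AE x in lborel. convergent (\<lambda>k. f (r k) x)"
  proof eventually_elim
    case (elim x)
    define C where "C = enn2real (\<Sum>k. ennreal (4 ^ k * (cmod (d k x))\<^sup>2))"
    have le: "4 ^ k * (cmod (d k x))\<^sup>2 \<le> C" for k
    proof -
      have "ennreal (4 ^ k * (cmod (d k x))\<^sup>2) = (\<Sum>i\<in>{k}. ennreal (4 ^ i * (cmod (d i x))\<^sup>2))" by simp
      also have "\<dots> \<le> (\<Sum>k. ennreal (4 ^ k * (cmod (d k x))\<^sup>2))"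
        by (rule sum_le_suminf) (auto intro: summableI)
      also have "\<dots> = ennreal C" using elim by (simp add: C_def less_top)
      finally show ?thesis by (simp add: C_def)
    qed
    have C: "C \<ge> 0" by (simp add: C_def)
    have "cmod (d k x) \<le> sqrt C * (1/2) ^ k" for k
    proof -
      have "(2 ^ k * cmod (d k x))\<^sup>2 \<le> C"
      proof -
        have "(2::real) ^ k * 2 ^ k = 4 ^ k" by (simp flip: power_mult_distrib)
        then have "((2::real) ^ k)\<^sup>2 = 4 ^ k" by (simp only: power2_eq_square)
        then show ?thesis using le[of k] by (simp only: power_mult_distrib)
      qed
      then have "2 ^ k * cmod (d k x) \<le> sqrt C" by (rule real_le_rsqrt)
      then have "cmod (d k x) \<le> sqrt C / 2 ^ k" by (subst pos_le_divide_eq) (auto simp: mult.commute)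
      then show ?thesis by (simp add: power_divide)
    qed
    then have bound: "\<And>k. k \<ge> 0 \<Longrightarrow> norm (d k x) \<le> sqrt C * (1/2) ^ k" by blast
    have "summable (\<lambda>k. sqrt C * (1/2::real) ^ k)"
      by (rule summable_mult, rule summable_geometric) simp
    from summable_comparison_test'[OF this bound] have "summable (\<lambda>k. d k x)" .
    then have "convergent (\<lambda>n. \<Sum>k<n. d k x)" by (simp add: summable_iff_convergent)
    moreover have "(\<Sum>k<n. d k x) = f (r n) x - f (r 0) x" for n
      by (induction n) (simp_all add: d_def)
    ultimately have "convergent (\<lambda>n. f (r n) x - f (r 0) x)" by simp
    then show ?case by (simp add: convergent_diff_const_right_iff)
  qed
  define g where "g x = lim (\<lambda>k. f (r k) x)" for x
  have gm[measurable]: "g \<in> borel_measurable borel"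
    unfolding g_def by (rule borel_measurable_lim_metric) measurable
  have lim: "AE x in lborel. (\<lambda>k. f (r k) x) \<longlonglongrightarrow> g x"
    using conv by eventually_elim (simp add: g_def convergent_LIMSEQ_iff)
  have close: "(\<integral>\<^sup>+x. ennreal ((cmod (f n x + (-1) * g x))\<^sup>2) \<partial>lborel) \<le> ennreal ((1/8) ^ k)" if n: "n \<ge> N k" for n k
  proof -
    have "(\<integral>\<^sup>+x. ennreal ((cmod (f n x + (-1) * g x))\<^sup>2) \<partial>lborel)
        \<le> (\<integral>\<^sup>+x. liminf (\<lambda>i. ennreal ((cmod (f n x + (-1) * f (r i) x))\<^sup>2)) \<partial>lborel)"
    proof (intro nn_integral_mono_AE)
      show "AE x in lborel. ennreal ((cmod (f n x + (-1) * g x))\<^sup>2) \<le> liminf (\<lambda>i. ennreal ((cmod (f n x + (-1) * f (r i) x))\<^sup>2))"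
        using lim
      proof eventually_elim
        case (elim x)
        have "(\<lambda>i. ennreal ((cmod (f n x + (-1) * f (r i) x))\<^sup>2)) \<longlonglongrightarrow> ennreal ((cmod (f n x + (-1) * g x))\<^sup>2)"
          by (intro tendsto_intros elim)
        from lim_imp_Liminf[OF sequentially_bot this] show ?case by (simp only: order_refl)
      qed
    qed
    also have "\<dots> \<le> liminf (\<lambda>i. \<integral>\<^sup>+x. ennreal ((cmod (f n x + (-1) * f (r i) x))\<^sup>2) \<partial>lborel)"
      by (intro nn_integral_liminf) measurable
    also have "\<dots> \<le> ennreal ((1/8) ^ k)"
    proof (rule Liminf_le)
      show "\<forall>\<^sub>F i in sequentially. (\<integral>\<^sup>+x. ennreal ((cmod (f n x + (-1) * f (r i) x))\<^sup>2) \<partial>lborel) \<le> ennreal ((1/8) ^ k)"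
        using eventually_ge_at_top[of k]
        by eventually_elim (subst nn_integral_square_nsq[OF diff], intro ennreal_leI N n rN)
    qed simp
    finally show ?thesis .
  qed
  have sd: "square_integrable (\<lambda>x. f n x + (-1) * g x)" if "n \<ge> N 0" for n
    unfolding square_integrable_iff_nn using close[OF that] by (auto simp: le_less_trans)
  have g: "square_integrable g"
    using square_integrable_lin[OF f sd, of "N 0" "N 0" "-1"] by simp
  have "(\<lambda>n. L2.nsq (\<lambda>x. f n x + (-1) * g x)) \<longlonglongrightarrow> 0"
  proof (rule LIMSEQ_I)
    fix e :: real assume "e > 0"
    then obtain k where k: "(1/8) ^ k < e" using real_arch_pow_inv[of e "1/8"] by auto
    have "norm (L2.nsq (\<lambda>x. f n x + (-1) * g x) - 0) < e" if "n \<ge> N k" for n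
    proof -
      have s: "square_integrable (\<lambda>x. f n x + (-1) * g x)" by (rule square_integrable_lin[OF f g])
      have "L2.nsq (\<lambda>x. f n x + (-1) * g x) \<le> (1/8) ^ k"
        using close[OF that] unfolding nn_integral_square_nsq[OF s] by (simp add: ennreal_le_iff)
      then show ?thesis using k L2.nsq_nonneg[of "\<lambda>x. f n x + (-1) * g x"] s by simp
    qed
    then show "\<exists>no. \<forall>n\<ge>no. norm (L2.nsq (\<lambda>x. f n x + (-1) * g x) - 0) < e" by blast
  qed
  with g show ?thesis by blast
qed

subsection \<open>Slices of holomorphic functions on the tube\<close>

lemma cvec_nth [simp]: "cvec x y $ k = Complex (x $ k) (y $ k)"
  by (simp add: cvec_def)

lemma cvec_in_tube_iff [simp]: "cvec x y \<in> tube \<longleftrightarrow> y \<in> octant"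
  by (simp add: tube_iff octant_def)

lemma cvec_Re_Im: "z = cvec (\<chi> k. Re (z $ k)) (\<chi> k. Im (z $ k))"
  by (simp add: vec_eq_iff)

lemma octant_eq: "(octant :: (real^'n) set) = (\<Inter>k\<in>UNIV. {y. axis k 1 \<bullet> y > 0})"
  by (auto simp: octant_def inner_axis' )

lemma open_octant: "open (octant :: (real^'n) set)"
  unfolding octant_eq by (intro open_INT ballI open_halfspace_gt) auto

lemma convex_octant: "convex (octant :: (real^'n) set)"
  unfolding octant_eq by (intro convex_INT convex_halfspace_gt)

lemma open_tube: "open (tube :: (complex^'n) set)"
proof -
  have "open (\<Inter>k\<in>UNIV. {z :: complex^'n. 0 < Im (z $ k)})"
    by (intro open_INT ballI open_Collect_less continuous_intros) auto
  moreover have "(tube :: (complex^'n) set) = (\<Inter>k\<in>UNIV. {z. 0 < Im (z $ k)})" by (auto simp: tube_iff)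
  ultimately show ?thesis by simp
qed

lemma octant_add: "y \<in> octant \<Longrightarrow> y' \<in> octant \<Longrightarrow> y + y' \<in> octant"
  by (auto simp: octant_def add_pos_pos)

lemma octant_scaleR: "y \<in> octant \<Longrightarrow> 0 < c \<Longrightarrow> c *\<^sub>R y \<in> octant"
  by (auto simp: octant_def)

lemma continuous_on_cvec [continuous_intros]:
  assumes "continuous_on A f" "continuous_on A g"
  shows "continuous_on A (\<lambda>p. cvec (f p) (g p))"
  unfolding cvec_def Complex_eq by (intro continuous_intros assms)

lemma continuous_on_holomorphic_Cn:
  assumes "holomorphic_Cn_on F S"
  shows "continuous_on S F"
  using assms unfolding holomorphic_Cn_on_def
  by (meson continuous_at_imp_continuous_on has_derivative_continuous)

text \<open>Because the derivative is complex linear, the chain rule along \<zeta> -> u + \<zeta> v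
  gives multiplication by one complex number, that is, a complex derivative.\<close>

lemma holomorphic_on_line:
  fixes F :: "complex^'n \<Rightarrow> complex"
  assumes F: "holomorphic_Cn_on F S"
  shows "(\<lambda>\<zeta>. F (\<chi> k. u $ k + \<zeta> * v $ k)) holomorphic_on {\<zeta>. (\<chi> k. u $ k + \<zeta> * v $ k) \<in> S}"
  unfolding holomorphic_on_def
proof
  fix \<zeta> assume "\<zeta> \<in> {\<zeta>. (\<chi> k. u $ k + \<zeta> * v $ k) \<in> S}"
  then obtain c :: "complex^'n" where c: "(F has_derivative (\<lambda>h. \<Sum>k\<in>UNIV. c $ k * h $ k)) (at (\<chi> k. u $ k + \<zeta> * v $ k))"
    using F unfolding holomorphic_Cn_on_def by auto
  have l: "((\<lambda>\<zeta>. \<chi> k. u $ k + \<zeta> * v $ k) has_derivative (\<lambda>h. \<chi> k. h * v $ k)) (at \<zeta>)"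
  proof -
    have "linear (\<lambda>h. (\<chi> k. h * v $ k) :: complex^'n)"
      by (rule linearI) (simp_all add: vec_eq_iff algebra_simps)
    then have "((\<lambda>\<zeta>. (\<chi> k. u $ k) + (\<chi> k. \<zeta> * v $ k)) has_derivative (\<lambda>h. 0 + (\<chi> k. h * v $ k))) (at \<zeta>)"
      by (intro has_derivative_add has_derivative_const linear_imp_has_derivative)
    moreover have "(\<lambda>\<zeta>. (\<chi> k. u $ k) + (\<chi> k. \<zeta> * v $ k)) = (\<lambda>\<zeta>. \<chi> k. u $ k + \<zeta> * v $ k)"
      by (simp add: fun_eq_iff vec_eq_iff)
    ultimately show ?thesis by simp
  qed
  have "((\<lambda>\<zeta>. F (\<chi> k. u $ k + \<zeta> * v $ k)) has_derivative (\<lambda>h. \<Sum>k\<in>UNIV. c $ k * (\<chi> k. h * v $ k) $ k)) (at \<zeta>)"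
    using has_derivative_compose[OF l c] by simp
  also have "(\<lambda>h. \<Sum>k\<in>UNIV. c $ k * (\<chi> k. h * v $ k) $ k) = (*) (\<Sum>k\<in>UNIV. c $ k * v $ k)"
    by (simp add: fun_eq_iff sum_distrib_left sum_distrib_right mult_ac)
  finally have "((\<lambda>\<zeta>. F (\<chi> k. u $ k + \<zeta> * v $ k)) has_field_derivative (\<Sum>k\<in>UNIV. c $ k * v $ k)) (at \<zeta>)"
    by (simp add: has_field_derivative_def)
  then show "(\<lambda>\<zeta>. F (\<chi> k. u $ k + \<zeta> * v $ k)) field_differentiable at \<zeta> within {\<zeta>. (\<chi> k. u $ k + \<zeta> * v $ k) \<in> S}"
    unfolding field_differentiable_def by (blast intro: has_field_derivative_at_within)
qed

lemma holomorphic_on_real_line: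
  fixes F :: "complex^'n \<Rightarrow> complex"
  assumes F: "holomorphic_Cn_on F tube"
  shows "(\<lambda>\<zeta>. F (cvec (x + Re \<zeta> *\<^sub>R v) (y + Im \<zeta> *\<^sub>R v))) holomorphic_on {\<zeta>. y + Im \<zeta> *\<^sub>R v \<in> octant}"
proof -
  have e: "(\<chi> k. cvec x y $ k + \<zeta> * cvec v 0 $ k) = cvec (x + Re \<zeta> *\<^sub>R v) (y + Im \<zeta> *\<^sub>R v)" for \<zeta>
    by (simp add: vec_eq_iff complex_eq_iff)
  show ?thesis
    using holomorphic_on_line[OF F, of "cvec x y" "cvec v 0"] unfolding e by simp
qed

subsection \<open>Mean squares over horizontal slices\<close>

lemma H2_holomorphic: "F \<in> H2 \<Longrightarrow> holomorphic_Cn_on F tube"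
  by (simp add: H2_def)

lemma continuous_on_H2: "F \<in> H2 \<Longrightarrow> continuous_on tube F"
  by (rule continuous_on_holomorphic_Cn[OF H2_holomorphic])

definition slice :: "(complex^'n \<Rightarrow> complex) \<Rightarrow> real^'n \<Rightarrow> real^'n \<Rightarrow> complex" where
  "slice F y x = F (cvec x y)"

lemma nn_integral_slice_le_energy:
  "y \<in> octant \<Longrightarrow> (\<integral>\<^sup>+x. ennreal ((cmod (slice F y x))\<^sup>2) \<partial>lborel) \<le> H2_energy F"
  unfolding H2_energy_def slice_def by (rule SUP_upper)

lemma slice_measurable:
  assumes "continuous_on tube F" "y \<in> octant"
  shows "slice F y \<in> borel_measurable borel"
  unfolding slice_def
  by (intro borel_measurable_continuous_onI continuous_on_compose2[OF assms(1)] continuous_intros)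
    (use assms in auto)

lemma square_integrable_slice:
  assumes F: "F \<in> H2" and y: "y \<in> octant"
  shows "square_integrable (slice F y)"
  unfolding square_integrable_iff_nn
  using slice_measurable[OF continuous_on_H2[OF F] y] nn_integral_slice_le_energy[OF y, of F] F
  by (auto simp: H2_def intro: le_less_trans)

text \<open>The integrand \<open>h x \<zeta>\<close> multiplies F at x + i y + \<zeta> s by the
  conjugate of F at x + i y' + cnj \<zeta> s; the double conjugation keeps it holomorphic in
  \<zeta>. The values \<zeta> = 0 and \<zeta> = i are the two sides, and
  \<open>integral_strip_shift\<close> connects them, with the energy bounding all heights in
  between.\<close>

lemma inner_slices_shift:
  fixes F :: "complex^'n \<Rightarrow> complex"
  assumes F: "F \<in> H2" and "y \<in> octant" "y' \<in> octant" "y + s \<in> octant" "y' - s \<in> octant"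
  shows "L2_inner (slice F y) (slice F y') = L2_inner (slice F (y + s)) (slice F (y' - s))"
proof -
  let ?T = "{\<tau>. y + \<tau> *\<^sub>R s \<in> octant \<and> y' - \<tau> *\<^sub>R s \<in> octant}"
  have T: "open ?T"
    unfolding Collect_conj_eq
    by (intro open_Int open_vimage[OF open_octant, unfolded vimage_def] continuous_intros)
  have seg: "\<tau> \<in> ?T" if "\<sigma> \<in> ?T" "\<rho> \<in> ?T" "\<sigma> \<le> \<tau>" "\<tau> \<le> \<rho>" for \<sigma> \<rho> \<tau>
  proof -
    have "convex ?T"
      unfolding convex_alt
    proof clarsimp
      fix a b u :: real
      assume ab: "y + a *\<^sub>R s \<in> octant" "y' - a *\<^sub>R s \<in> octant" "y + b *\<^sub>R s \<in> octant" "y' - b *\<^sub>R s \<in> octant"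
        and u: "0 \<le> u" "u \<le> 1"
      have "y + ((1 - u) * a + u * b) *\<^sub>R s = (1 - u) *\<^sub>R (y + a *\<^sub>R s) + u *\<^sub>R (y + b *\<^sub>R s)"
        "y' - ((1 - u) * a + u * b) *\<^sub>R s = (1 - u) *\<^sub>R (y' - a *\<^sub>R s) + u *\<^sub>R (y' - b *\<^sub>R s)"
        by (simp_all add: algebra_simps)
      then show "y + ((1 - u) * a + u * b) *\<^sub>R s \<in> octant \<and> y' - ((1 - u) * a + u * b) *\<^sub>R s \<in> octant"
        using convex_octant ab u unfolding convex_alt by metis
    qed
    then show ?thesis using that by (meson is_interval_1 is_interval_convex_1)
  qed
  have T01: "0 \<in> ?T" "1 \<in> ?T" using assms by simp_all
  \<comment> \<open>The open strip has to reach beyond both heights 0 and 1; openness of the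
    admissible set supplies the margin.\<close>
  obtain e0 where e0: "e0 > 0" "ball 0 e0 \<subseteq> ?T" by (rule openE[OF T T01(1)])
  obtain e1 where e1: "e1 > 0" "ball 1 e1 \<subseteq> ?T" by (rule openE[OF T T01(2)])
  define e where "e = min e0 e1 / 2"
  have e: "e > 0" "- e \<in> ?T" "1 + e \<in> ?T"
    using e0(1) e1(1) subsetD[OF e0(2), of "- e"] subsetD[OF e1(2), of "1 + e"]
    by (auto simp: e_def dist_norm)
  have inT: "\<tau> \<in> ?T" if "- e < \<tau>" "\<tau> < 1 + e" for \<tau>
    using seg[OF e(2,3)] that by auto
  define h where "h x \<zeta> = F (cvec (x + Re \<zeta> *\<^sub>R s) (y + Im \<zeta> *\<^sub>R s)) * cnj (F (cvec (x + Re \<zeta> *\<^sub>R s) (y' - Im \<zeta> *\<^sub>R s)))"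
    for x \<zeta>
  have "(\<integral>x. h x (Complex 0 0) \<partial>lborel) = (\<integral>x. h x (Complex 0 1) \<partial>lborel)"
  proof (rule integral_strip_shift[where c = "- e" and d = "1 + e" and v = s])
    show "- e < 0" "(0::real) \<le> 1" "1 < 1 + e" using e by auto
  next
    fix x
    let ?S = "{\<zeta>. - e < Im \<zeta> \<and> Im \<zeta> < 1 + e}"
    define G where "G \<zeta> = F (cvec (x + Re \<zeta> *\<^sub>R s) (y' + Im \<zeta> *\<^sub>R s))" for \<zeta>
    have "G holomorphic_on {\<zeta>. y' + Im \<zeta> *\<^sub>R s \<in> octant}"
      unfolding G_def by (rule holomorphic_on_real_line[OF H2_holomorphic[OF F]])
    then have "G holomorphic_on cnj ` ?S"
      by (rule holomorphic_on_subset) (use inT in auto)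
    then have "cnj \<circ> G \<circ> cnj holomorphic_on ?S"
      by (rule holomorphic_on_compose_cnj_cnj)
        (auto intro!: open_Int open_halfspace_Im_gt open_halfspace_Im_lt simp: Collect_conj_eq)
    moreover have "(\<lambda>\<zeta>. F (cvec (x + Re \<zeta> *\<^sub>R s) (y + Im \<zeta> *\<^sub>R s))) holomorphic_on ?S"
      by (rule holomorphic_on_subset[OF holomorphic_on_real_line[OF H2_holomorphic[OF F]]]) (use inT in auto)
    ultimately have "(\<lambda>\<zeta>. F (cvec (x + Re \<zeta> *\<^sub>R s) (y + Im \<zeta> *\<^sub>R s)) * (cnj \<circ> G \<circ> cnj) \<zeta>) holomorphic_on ?S"
      by (intro holomorphic_intros)
    then show "h x holomorphic_on ?S"
      by (simp add: h_def[abs_def] G_def)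
  next
    fix x t \<zeta>
    show "h (x + t *\<^sub>R s) \<zeta> = h x (\<zeta> + of_real t)" by (simp add: h_def algebra_simps)
  next
    show "(\<lambda>p. indicator {0..1} (snd p) *\<^sub>R h (fst p) (Complex 0 (snd p))) \<in> borel_measurable (borel :: ((real^'n) \<times> real) measure)"
      unfolding h_def using e inT
      by (intro borel_measurable_on_slab continuous_on_mult continuous_on_cnj
          continuous_on_compose2[OF continuous_on_H2[OF F]] continuous_intros) auto
  next
    fix \<tau> :: real assume \<tau>: "\<tau> \<in> {0..1}"
    have o: "y + \<tau> *\<^sub>R s \<in> octant" "y' - \<tau> *\<^sub>R s \<in> octant" using inT[of \<tau>] \<tau> e by auto
    have [measurable]: "slice F (y + \<tau> *\<^sub>R s) \<in> borel_measurable borel" "slice F (y' - \<tau> *\<^sub>R s) \<in> borel_measurable borel"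
      using square_integrable_slice[OF F] o by (auto simp: square_integrable_def)
    have "(\<integral>\<^sup>+x. ennreal (cmod (h x (Complex 0 \<tau>))) \<partial>lborel)
        \<le> (\<integral>\<^sup>+x. ennreal ((cmod (slice F (y + \<tau> *\<^sub>R s) x))\<^sup>2) + ennreal ((cmod (slice F (y' - \<tau> *\<^sub>R s) x))\<^sup>2) \<partial>lborel)"
    proof (intro nn_integral_mono)
      fix x
      let ?a = "cmod (slice F (y + \<tau> *\<^sub>R s) x)" and ?b = "cmod (slice F (y' - \<tau> *\<^sub>R s) x)"
      have "2 * (?a * ?b) \<le> ?a\<^sup>2 + ?b\<^sup>2" using sum_squares_bound[of ?a ?b] by simp
      moreover have "0 \<le> ?a * ?b" by simp
      ultimately have "?a * ?b \<le> ?a\<^sup>2 + ?b\<^sup>2" by linarith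
      then show "ennreal (cmod (h x (Complex 0 \<tau>))) \<le> ennreal (?a\<^sup>2) + ennreal (?b\<^sup>2)"
        by (simp add: h_def slice_def norm_mult ennreal_plus[symmetric] ennreal_leI del: ennreal_plus)
    qed
    also have "\<dots> = (\<integral>\<^sup>+x. ennreal ((cmod (slice F (y + \<tau> *\<^sub>R s) x))\<^sup>2) \<partial>lborel) + (\<integral>\<^sup>+x. ennreal ((cmod (slice F (y' - \<tau> *\<^sub>R s) x))\<^sup>2) \<partial>lborel)"
      by (intro nn_integral_add) measurable
    also have "\<dots> \<le> H2_energy F + H2_energy F"
      by (intro add_mono nn_integral_slice_le_energy o)
    finally show "(\<integral>\<^sup>+x. ennreal (cmod (h x (Complex 0 \<tau>))) \<partial>lborel) \<le> H2_energy F + H2_energy F" .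
  next
    show "H2_energy F + H2_energy F < \<infinity>" using F by (simp add: H2_def)
  qed
  then show ?thesis by (simp add: h_def L2_inner_def slice_def)
qed

lemma L2_nsq_nonneg: "square_integrable f \<Longrightarrow> 0 \<le> L2.nsq f"
  by (rule L2.nsq_nonneg) simp

lemma L2_inner_self: "square_integrable f \<Longrightarrow> L2_inner f f = of_real (L2.nsq f)"
  by (rule L2.ip_self) simp

definition mean_square :: "(complex^'n \<Rightarrow> complex) \<Rightarrow> real^'n \<Rightarrow> real" where
  "mean_square F y = L2.nsq (slice F y)"

text \<open>Shifting by half the difference of the heights brings both slices to the
  midpoint.\<close>

lemma inner_slices:
  assumes F: "F \<in> H2" and y: "y \<in> octant" "y' \<in> octant"
  shows "L2_inner (slice F y) (slice F y') = of_real (mean_square F ((1/2) *\<^sub>R (y + y')))"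
proof -
  let ?m = "(1/2) *\<^sub>R (y + y')"
  let ?s = "(1/2) *\<^sub>R (y' - y)"
  have m: "y + ?s = ?m" "y' - ?s = ?m" by (simp_all add: vec_eq_iff field_simps)
  have mo: "?m \<in> octant" by (intro octant_scaleR octant_add y) simp
  show ?thesis
    using inner_slices_shift[OF F y, of ?s] L2.ip_self[of "slice F ?m"] square_integrable_slice[OF F mo] mo
    unfolding m mean_square_def by simp
qed

lemma nsq_slice_diff:
  assumes F: "F \<in> H2" and y: "y \<in> octant" "y' \<in> octant"
  shows "L2.nsq (\<lambda>x. slice F y x + (-1) * slice F y' x)
    = mean_square F y + mean_square F y' - 2 * mean_square F ((1/2) *\<^sub>R (y + y'))"
proof -
  have s: "slice F y \<in> Collect square_integrable" "slice F y' \<in> Collect square_integrable"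
    using square_integrable_slice[OF F] y by auto
  show ?thesis
    unfolding L2.nsq_lin[OF s] inner_slices[OF F y] by (simp add: mean_square_def)
qed

lemma mean_square_le:
  assumes F: "F \<in> H2" and y: "y \<in> octant"
  shows "mean_square F y \<le> enn2real (H2_energy F)"
proof -
  have "ennreal (mean_square F y) \<le> H2_energy F"
    using nn_integral_slice_le_energy[OF y, of F] nn_integral_square_nsq[OF square_integrable_slice[OF F y]]
    by (simp add: mean_square_def)
  also have "H2_energy F = ennreal (enn2real (H2_energy F))" using F by (simp add: H2_def less_top)
  finally show ?thesis by (rule ennreal_le_iff[THEN iffD1, rotated]) simp
qed

lemma mean_square_nonneg: "F \<in> H2 \<Longrightarrow> y \<in> octant \<Longrightarrow> 0 \<le> mean_square F y"
  unfolding mean_square_def by (rule L2.nsq_nonneg) (simp add: square_integrable_slice)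

text \<open>The mean square is midpoint convex and bounded, hence cannot increase.\<close>

lemma mean_square_antimono:
  assumes F: "F \<in> H2" and y: "y \<in> octant" and h: "h \<in> octant"
  shows "mean_square F (y + h) \<le> mean_square F y"
proof (rule ccontr)
  assume greater: "\<not> ?thesis"
  \<comment> \<open>By midpoint convexity the increments of \<open>a\<close> never decrease, so a
    positive first increment forces linear growth beyond the energy.\<close>
  define a where "a k = mean_square F (y + real k *\<^sub>R h)" for k :: nat
  define d where "d = a 1 - a 0"
  have d: "d > 0" using greater by (simp add: a_def d_def)
  have o: "y + real k *\<^sub>R h \<in> octant" for k
    by (cases "k = 0") (auto intro!: octant_add octant_scaleR y h)
  have convex: "2 * a (Suc k) \<le> a k + a (Suc (Suc k))" for k
  proof -
    have m: "(1/2) *\<^sub>R ((y + real k *\<^sub>R h) + (y + real (Suc (Suc k)) *\<^sub>R h)) = y + real (Suc k) *\<^sub>R h"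
      by (simp add: vec_eq_iff field_simps)
    have "0 \<le> L2.nsq (\<lambda>x. slice F (y + real k *\<^sub>R h) x + (-1) * slice F (y + real (Suc (Suc k)) *\<^sub>R h) x)"
      by (intro L2_nsq_nonneg square_integrable_lin square_integrable_slice F o)
    then show ?thesis
      unfolding nsq_slice_diff[OF F o o] m by (simp add: a_def)
  qed
  have inc: "d \<le> a (Suc k) - a k" for k
  proof (induction k)
    case (Suc k)
    then show ?case using convex[of k] by linarith
  qed (simp add: d_def)
  have grow: "a 0 + real k * d \<le> a k" for k
  proof (induction k)
    case (Suc k)
    then show ?case using inc[of k] by (simp add: algebra_simps)
  qed simp
  obtain k :: nat where "enn2real (H2_energy F) / d < real k"
    using reals_Archimedean2 by blast
  then have "enn2real (H2_energy F) < real k * d" using d by (simp add: field_simps)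
  moreover have "0 \<le> a 0" unfolding a_def by (rule mean_square_nonneg[OF F o])
  moreover have "a k \<le> enn2real (H2_energy F)" unfolding a_def by (rule mean_square_le[OF F o])
  ultimately show False using grow[of k] by linarith
qed

text \<open>Some height y0 comes within \<open>e\<close> of the supremum. Every sufficiently small y
  in the octant has y0 - y in the octant, and by antitonicity its mean square is at least as
  large.\<close>

lemma mean_square_near_energy:
  fixes F :: "complex^'n \<Rightarrow> complex"
  assumes F: "F \<in> H2" and e: "e > 0"
  shows "\<exists>\<delta>>0. \<forall>y\<in>octant. norm y < \<delta> \<longrightarrow> enn2real (H2_energy F) - e < mean_square F y"
proof -
  let ?L = "enn2real (H2_energy F)"
  have "\<exists>y0\<in>octant. ?L - e < mean_square F y0"
  proof (rule ccontr)
    assume "\<not> ?thesis"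
    then have le: "mean_square F y \<le> ?L - e" if "y \<in> octant" for y using that by force
    have one: "(\<chi> k. 1) \<in> (octant :: (real^'n) set)" by (simp add: octant_def)
    have "H2_energy F \<le> ennreal (?L - e)"
      unfolding H2_energy_def[of F]
    proof (rule SUP_least)
      fix y :: "real^'n" assume y: "y \<in> octant"
      have "(\<integral>\<^sup>+x. ennreal ((cmod (F (cvec x y)))\<^sup>2) \<partial>lborel) = ennreal (mean_square F y)"
        using nn_integral_square_nsq[OF square_integrable_slice[OF F y]] by (simp add: slice_def mean_square_def)
      also have "\<dots> \<le> ennreal (enn2real (SUP y\<in>octant. \<integral>\<^sup>+ x. ennreal ((cmod (F (cvec x y)))\<^sup>2) \<partial>lborel) - e)"
        using le[OF y] by (intro ennreal_leI) (simp add: H2_energy_def)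
      finally show "(\<integral>\<^sup>+x. ennreal ((cmod (F (cvec x y)))\<^sup>2) \<partial>lborel)
        \<le> ennreal (enn2real (SUP y\<in>octant. \<integral>\<^sup>+ x. ennreal ((cmod (F (cvec x y)))\<^sup>2) \<partial>lborel) - e)" .
    qed
    \<comment> \<open>\<open>ennreal\<close> truncates negative numbers to 0, so nonnegativity is
      needed before returning to the reals.\<close>
    moreover have "0 \<le> ?L - e" using le[OF one] mean_square_nonneg[OF F one] by linarith
    ultimately have "?L \<le> ?L - e" by (simp add: enn2real_leI)
    then show False using e by simp
  qed
  then obtain y0 where y0: "y0 \<in> octant" "?L - e < mean_square F y0" by blast
  have op: "open ((\<lambda>y. y0 - y) -` (octant :: (real^'n) set))"
    by (intro open_vimage open_octant continuous_intros)
  have mem: "0 \<in> (\<lambda>y. y0 - y) -` octant" using y0(1) by simp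
  obtain \<delta> where \<delta>: "\<delta> > 0" "ball 0 \<delta> \<subseteq> (\<lambda>y. y0 - y) -` octant"
    by (rule openE[OF op mem])
  have "?L - e < mean_square F y" if "y \<in> octant" "norm y < \<delta>" for y
  proof -
    have "y0 - y \<in> octant" using \<delta>(2) that(2) by (auto simp: dist_norm)
    from mean_square_antimono[OF F that(1) this] y0(2) show ?thesis by simp
  qed
  with \<delta>(1) show ?thesis by blast
qed

text \<open>The squared distance is the sum of two mean squares minus twice the one at the midpoint.
  Near the origin all three lie between L - e/2 and L, where L is the energy, so it is at most
  e.\<close>

lemma slices_Cauchy:
  fixes F :: "complex^'n \<Rightarrow> complex"
  assumes F: "F \<in> H2" and e: "e > 0"
  shows "\<exists>\<delta>>0. \<forall>y\<in>octant. \<forall>y'\<in>octant. norm y < \<delta> \<longrightarrow> norm y' < \<delta> \<longrightarrow>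
    L2.nsq (\<lambda>x. slice F y x + (-1) * slice F y' x) \<le> e"
proof -
  let ?L = "enn2real (H2_energy F)"
  obtain \<delta> where \<delta>: "\<delta> > 0" "\<And>y. y \<in> octant \<Longrightarrow> norm y < \<delta> \<Longrightarrow> ?L - e / 2 < mean_square F y"
    using mean_square_near_energy[OF F, of "e / 2"] e by auto
  have "L2.nsq (\<lambda>x. slice F y x + (-1) * slice F y' x) \<le> e"
    if y: "y \<in> octant" "y' \<in> octant" "norm y < \<delta>" "norm y' < \<delta>" for y y'
  proof -
    have "norm ((1/2) *\<^sub>R (y + y')) < \<delta>"
      using norm_triangle_ineq[of y y'] y by simp
    moreover have "(1/2) *\<^sub>R (y + y') \<in> octant" by (intro octant_scaleR octant_add y) simp
    ultimately have "?L - e / 2 < mean_square F ((1/2) *\<^sub>R (y + y'))" by (rule \<delta>(2)[rotated])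
    then show ?thesis
      unfolding nsq_slice_diff[OF F y(1,2)]
      using mean_square_le[OF F y(1)] mean_square_le[OF F y(2)] by linarith
  qed
  with \<delta>(1) show ?thesis by blast
qed

section \<open>Boundary limits in mean square\<close>

lemma eventually_at_0_octant:
  "(\<forall>\<^sub>F \<eta> in at (0::real^'n) within octant. P \<eta>) \<longleftrightarrow> (\<exists>\<delta>>0. \<forall>\<eta>\<in>octant. norm \<eta> < \<delta> \<longrightarrow> P \<eta>)"
proof -
  have "(0::real^'n) \<notin> octant" by (simp add: octant_def)
  then show ?thesis unfolding eventually_at by (auto simp: dist_norm)
qed

text \<open>The origin is a limit point of the octant; this makes limits along the filter unique and
  allows identities to be proved on slices and passed to the boundary.\<close>

lemma at_0_octant_neq_bot: "at (0::real^'n) within octant \<noteq> bot"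
proof
  assume "at (0::real^'n) within octant = bot"
  then have "\<forall>\<^sub>F \<eta> in at (0::real^'n) within octant. False" by simp
  then have "\<exists>\<delta>>0. \<forall>\<eta>\<in>octant. norm (\<eta> :: real^'n) < \<delta> \<longrightarrow> False"
    by (simp only: eventually_at_0_octant)
  then obtain \<delta> where \<delta>: "\<delta> > 0" "\<forall>\<eta>\<in>octant. \<not> norm (\<eta> :: real^'n) < \<delta>" by blast
  define u :: "real^'n" where "u = (\<chi> k. 1)"
  have u: "u \<in> octant" by (simp add: u_def octant_def)
  let ?c = "\<delta> / (2 * (norm u + 1))"
  have pos: "2 * (norm u + 1) > 0" by (simp add: add_nonneg_pos)
  then have c: "?c > 0" using \<delta>(1) by (rule divide_pos_pos[rotated])
  have "\<delta> * norm u < \<delta> * (2 * (norm u + 1))"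
  proof (rule mult_strict_left_mono[OF _ \<delta>(1)])
    show "norm u < 2 * (norm u + 1)" by (simp add: distrib_left add_nonneg_pos)
  qed
  then have "norm (?c *\<^sub>R u) < \<delta>"
    using pos c \<delta>(1) by (simp add: pos_divide_less_eq del: distrib_left_numeral)
  then show False using bspec[OF \<delta>(2) octant_scaleR[OF u c]] by blast
qed

text \<open>Completeness is applied to one sequence on the diagonal ray; the Cauchy estimate,
  uniform over small heights, carries the limit over to every approach within the octant.\<close>

lemma boundary_limit_exists:
  fixes F :: "complex^'n \<Rightarrow> complex"
  assumes F: "F \<in> H2"
  shows "\<exists>g. square_integrable g \<and> ((\<lambda>\<eta>. L2.nsq (\<lambda>x. slice F \<eta> x + (-1) * g x)) \<longlongrightarrow> 0) (at 0 within octant)"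
proof -
  define \<eta> :: "nat \<Rightarrow> real^'n" where "\<eta> k = inverse (real (Suc k)) *\<^sub>R (\<chi> k. 1)" for k
  have \<eta>: "\<eta> k \<in> octant" for k by (auto simp: \<eta>_def octant_def)
  have "(\<lambda>k. norm (\<eta> k)) \<longlonglongrightarrow> 0"
    unfolding \<eta>_def norm_scaleR using tendsto_mult_left_zero[OF LIMSEQ_inverse_real_of_nat]
    by simp
  then have small: "\<exists>N. \<forall>k\<ge>N. norm (\<eta> k) < \<delta>" if "\<delta> > 0" for \<delta>
    using that order_tendstoD(2) unfolding eventually_sequentially[symmetric] by blast
  have s: "square_integrable (slice F (\<eta> k))" for k by (rule square_integrable_slice[OF F \<eta>])
  have "\<exists>N. \<forall>m\<ge>N. \<forall>n\<ge>N. L2.nsq (\<lambda>x. slice F (\<eta> m) x + (-1) * slice F (\<eta> n) x) \<le> e" if "e > 0" for e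
    using slices_Cauchy[OF F that] small \<eta> by metis
  from L2_complete[OF s this] obtain g where g: "square_integrable g"
    "(\<lambda>n. L2.nsq (\<lambda>x. slice F (\<eta> n) x + (-1) * g x)) \<longlonglongrightarrow> 0" by blast
  have "((\<lambda>y. L2.nsq (\<lambda>x. slice F y x + (-1) * g x)) \<longlongrightarrow> 0) (at 0 within octant)"
    unfolding tendsto_iff
  proof (intro allI impI)
    fix e :: real assume e: "e > 0"
    \<comment> \<open>\<open>nsq_add_le\<close> doubles both distances, so two tolerances e/6 give
      2e/3 < e.\<close>
    obtain \<delta> where \<delta>: "\<delta> > 0" "\<And>y y'. y \<in> octant \<Longrightarrow> y' \<in> octant \<Longrightarrow> norm y < \<delta> \<Longrightarrow> norm y' < \<delta> \<Longrightarrow>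
      L2.nsq (\<lambda>x. slice F y x + (-1) * slice F y' x) \<le> e / 6"
      using slices_Cauchy[OF F, of "e / 6"] e by auto
    obtain N where N: "\<forall>k\<ge>N. norm (\<eta> k) < \<delta>" using small[OF \<delta>(1)] by blast
    obtain M where M: "\<forall>n\<ge>M. L2.nsq (\<lambda>x. slice F (\<eta> n) x + (-1) * g x) < e / 6"
      using order_tendstoD(2)[OF g(2), of "e / 6"] e unfolding eventually_sequentially by auto
    define k where "k = max M N"
    show "\<forall>\<^sub>F y in at 0 within octant. dist (L2.nsq (\<lambda>x. slice F y x + (-1) * g x)) 0 < e"
      unfolding eventually_at_0_octant
    proof (intro exI conjI ballI impI)
      fix y :: "real^'n" assume y: "y \<in> octant" "norm y < \<delta>"
      have sy: "square_integrable (slice F y)" by (rule square_integrable_slice[OF F y(1)])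
      have "L2.nsq (\<lambda>x. slice F y x + (-1) * g x)
          = L2.nsq (\<lambda>x. (slice F y x + (-1) * slice F (\<eta> k) x) + 1 * (slice F (\<eta> k) x + (-1) * g x))"
        by (rule arg_cong[of _ _ L2.nsq]) (simp add: fun_eq_iff)
      also have "\<dots> \<le> 2 * L2.nsq (\<lambda>x. slice F y x + (-1) * slice F (\<eta> k) x) + 2 * L2.nsq (\<lambda>x. slice F (\<eta> k) x + (-1) * g x)"
        using sy s g(1) by (intro L2.nsq_add_le L2.lin_closed) auto
      also have "\<dots> \<le> 2 * (e / 6) + 2 * (e / 6)"
        using \<delta>(2)[OF y(1) \<eta> y(2)] N M by (intro add_mono mult_left_mono) (auto simp: k_def less_imp_le)
      also have "\<dots> < e" using e by simp
      finally show "dist (L2.nsq (\<lambda>x. slice F y x + (-1) * g x)) 0 < e"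
        using L2_nsq_nonneg[OF square_integrable_lin[OF sy g(1), of "-1"]] by simp
    qed (rule \<delta>(1))
  qed
  with g(1) show ?thesis by blast
qed

lemma boundary_limit:
  fixes F :: "complex^'n \<Rightarrow> complex"
  assumes F: "F \<in> H2"
  shows "square_integrable (boundary_limit F)"
    and "((\<lambda>\<eta>. L2.nsq (\<lambda>x. slice F \<eta> x + (-1) * boundary_limit F x)) \<longlongrightarrow> 0) (at 0 within octant)"
proof -
  have eq: "\<forall>\<^sub>F \<eta> in at 0 within octant. (\<integral>\<^sup>+ \<xi>. ennreal ((cmod (F (cvec \<xi> \<eta>) - g \<xi>))\<^sup>2) \<partial>lborel)
      = ennreal (L2.nsq (\<lambda>x. slice F \<eta> x + (-1) * g x))" if g: "square_integrable g" for g
    unfolding eventually_at_0_octant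
    using nn_integral_square_nsq[OF square_integrable_lin[OF square_integrable_slice[OF F] g, of _ "-1"]]
    by (intro exI[of _ 1]) (auto simp: slice_def)
  have iff: "is_boundary_limit F g \<longleftrightarrow> square_integrable g
      \<and> ((\<lambda>\<eta>. L2.nsq (\<lambda>x. slice F \<eta> x + (-1) * g x)) \<longlongrightarrow> 0) (at 0 within octant)" for g
  proof (cases "square_integrable g")
    case True
    have "((\<lambda>\<eta>. ennreal (L2.nsq (\<lambda>x. slice F \<eta> x + (-1) * g x))) \<longlongrightarrow> ennreal 0) (at 0 within octant)
        \<longleftrightarrow> ((\<lambda>\<eta>. L2.nsq (\<lambda>x. slice F \<eta> x + (-1) * g x)) \<longlongrightarrow> 0) (at 0 within octant)"
    proof (rule tendsto_ennreal_iff)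
      show "\<forall>\<^sub>F \<eta> in at 0 within octant. 0 \<le> L2.nsq (\<lambda>x. slice F \<eta> x + (-1) * g x)"
        unfolding eventually_at_0_octant
        using L2_nsq_nonneg[OF square_integrable_lin[OF square_integrable_slice[OF F] True, of _ "-1"]]
        by (intro exI[of _ 1]) (simp del: mult_minus1)
    qed simp
    then show ?thesis
      using True tendsto_cong[OF eq[OF True], of 0] by (simp add: is_boundary_limit_def square_integrable_iff_nn)
  next
    case False
    then show ?thesis unfolding is_boundary_limit_def square_integrable_iff_nn by auto
  qed
  obtain g where "square_integrable g
      \<and> ((\<lambda>\<eta>. L2.nsq (\<lambda>x. slice F \<eta> x + (-1) * g x)) \<longlongrightarrow> 0) (at 0 within octant)"
    using boundary_limit_exists[OF F] by (elim exE) (rule that)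
  then have "is_boundary_limit F g" by (simp only: iff)
  then have "is_boundary_limit F (boundary_limit F)"
    unfolding boundary_limit_def by (rule someI[of "is_boundary_limit F"])
  note B = this[unfolded iff]
  show "square_integrable (boundary_limit F)" by (rule conjunct1[OF B])
  show "((\<lambda>\<eta>. L2.nsq (\<lambda>x. slice F \<eta> x + (-1) * boundary_limit F x)) \<longlongrightarrow> 0) (at 0 within octant)"
    by (rule conjunct2[OF B])
qed

text \<open>With boundary limits f and g, the error splits as the inner product of F_\<eta> - f with
  G_\<eta> plus that of f with G_\<eta> - g; Cauchy-Schwarz handles both, the norms of the G_\<eta>
  being bounded by the energy. Inner products can thus be computed inside the tube, without handling
  the chosen boundary functions.\<close>

lemma H2_inner_limit:
  fixes F G :: "complex^'n \<Rightarrow> complex"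
  assumes F: "F \<in> H2" and G: "G \<in> H2"
  shows "((\<lambda>\<eta>. L2_inner (slice F \<eta>) (slice G \<eta>)) \<longlongrightarrow> H2_inner F G) (at 0 within octant)"
proof -
  let ?f = "boundary_limit F" and ?g = "boundary_limit G"
  let ?dF = "\<lambda>\<eta> x. slice F \<eta> x + (-1) * ?f x" and ?dG = "\<lambda>\<eta> x. slice G \<eta> x + (-1) * ?g x"
  let ?L = "enn2real (H2_energy G)"
  note bF = boundary_limit[OF F] and bG = boundary_limit[OF G]
  have "((\<lambda>\<eta>. sqrt (L2.nsq (?dF \<eta>) * ?L) + sqrt (L2.nsq ?f * L2.nsq (?dG \<eta>))) \<longlongrightarrow> sqrt (0 * ?L) + sqrt (L2.nsq ?f * 0)) (at 0 within octant)"
    by (intro tendsto_intros bF bG)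
  then have lim: "((\<lambda>\<eta>. sqrt (L2.nsq (?dF \<eta>) * ?L) + sqrt (L2.nsq ?f * L2.nsq (?dG \<eta>))) \<longlongrightarrow> 0) (at 0 within octant)"
    by simp
  have "((\<lambda>\<eta>. L2_inner (slice F \<eta>) (slice G \<eta>) - H2_inner F G) \<longlongrightarrow> 0) (at 0 within octant)"
  proof (rule Lim_null_comparison[OF _ lim])
    show "\<forall>\<^sub>F \<eta> in at 0 within octant. norm (L2_inner (slice F \<eta>) (slice G \<eta>) - H2_inner F G)
        \<le> sqrt (L2.nsq (?dF \<eta>) * ?L) + sqrt (L2.nsq ?f * L2.nsq (?dG \<eta>))"
      unfolding eventually_at_0_octant
    proof (intro exI[of _ 1] conjI ballI impI)
      fix \<eta> :: "real^'n" assume \<eta>: "\<eta> \<in> octant"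
      have s: "square_integrable (slice F \<eta>)" "square_integrable (slice G \<eta>)"
        by (intro square_integrable_slice F G \<eta>)+
      have d: "square_integrable (?dF \<eta>)" "square_integrable (?dG \<eta>)"
        by (intro square_integrable_lin s bF bG)+
      have "H2_inner F G = L2_inner ?f ?g" by (simp add: H2_inner_def L2_inner_def)
      moreover have "L2_inner (?dF \<eta>) (slice G \<eta>) = L2_inner (slice F \<eta>) (slice G \<eta>) - L2_inner ?f (slice G \<eta>)"
        using L2.ip_lin[of "slice F \<eta>" ?f "slice G \<eta>" "-1"] s bF by simp
      moreover have "L2_inner ?f (?dG \<eta>) = L2_inner ?f (slice G \<eta>) - L2_inner ?f ?g"
        using L2.ip_lin_right[of "slice G \<eta>" ?g ?f "-1"] s bF bG by simp
      ultimately have "norm (L2_inner (slice F \<eta>) (slice G \<eta>) - H2_inner F G)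
          \<le> cmod (L2_inner (?dF \<eta>) (slice G \<eta>)) + cmod (L2_inner ?f (?dG \<eta>))"
        using norm_triangle_ineq[of "L2_inner (?dF \<eta>) (slice G \<eta>)" "L2_inner ?f (?dG \<eta>)"] by simp
      also have "\<dots> \<le> sqrt (L2.nsq (?dF \<eta>) * ?L) + sqrt (L2.nsq ?f * L2.nsq (?dG \<eta>))"
      proof (intro add_mono real_le_rsqrt)
        have "(cmod (L2_inner (?dF \<eta>) (slice G \<eta>)))\<^sup>2 \<le> L2.nsq (?dF \<eta>) * L2.nsq (slice G \<eta>)"
          using d s by (intro L2.Cauchy_Schwarz_ip) auto
        also have "\<dots> \<le> L2.nsq (?dF \<eta>) * ?L"
          using mean_square_le[OF G \<eta>] L2.nsq_nonneg[of "?dF \<eta>"] d by (intro mult_left_mono) (auto simp: mean_square_def)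
        finally show "(cmod (L2_inner (?dF \<eta>) (slice G \<eta>)))\<^sup>2 \<le> L2.nsq (?dF \<eta>) * ?L" .
        show "(cmod (L2_inner ?f (?dG \<eta>)))\<^sup>2 \<le> L2.nsq ?f * L2.nsq (?dG \<eta>)"
          using d bF by (intro L2.Cauchy_Schwarz_ip) auto
      qed
      finally show "norm (L2_inner (slice F \<eta>) (slice G \<eta>) - H2_inner F G)
        \<le> sqrt (L2.nsq (?dF \<eta>) * ?L) + sqrt (L2.nsq ?f * L2.nsq (?dG \<eta>))" .
    qed simp
  qed
  then show ?thesis by (simp add: LIM_zero_iff)
qed

lemma mean_square_limit:
  fixes F :: "complex^'n \<Rightarrow> complex"
  assumes F: "F \<in> H2"
  shows "(mean_square F \<longlongrightarrow> enn2real (H2_energy F)) (at 0 within octant)"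
  unfolding tendsto_iff
proof (intro allI impI)
  fix e :: real assume "e > 0"
  from mean_square_near_energy[OF F this] obtain \<delta> where
    \<delta>: "\<delta> > 0" "\<forall>y\<in>octant. norm y < \<delta> \<longrightarrow> enn2real (H2_energy F) - e < mean_square F y"
    by (elim exE conjE) (rule that)
  show "\<forall>\<^sub>F y in at 0 within octant. dist (mean_square F y) (enn2real (H2_energy F)) < e"
    unfolding eventually_at_0_octant
  proof (intro exI[of _ \<delta>] conjI ballI impI \<delta>(1))
    fix y :: "real^'n" assume y: "y \<in> octant" "norm y < \<delta>"
    have "enn2real (H2_energy F) - e < mean_square F y" using \<delta>(2) y by blast
    then show "dist (mean_square F y) (enn2real (H2_energy F)) < e"
      using mean_square_le[OF F y(1)] by (simp add: dist_real_def)
  qed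
qed

text \<open>The supremum of the mean squares is also their limit at the origin, so the norm defined
  by a supremum is the one given by the inner product.\<close>

lemma H2_inner_self:
  assumes F: "F \<in> H2"
  shows "H2_inner F F = of_real (enn2real (H2_energy F))"
proof -
  have ev: "\<forall>\<^sub>F \<eta> in at 0 within octant. of_real (mean_square F \<eta>) = L2_inner (slice F \<eta>) (slice F \<eta>)"
    unfolding eventually_at_0_octant mean_square_def
    using L2_inner_self[OF square_integrable_slice[OF F]] by (intro exI[of _ 1]) simp
  have "((\<lambda>\<eta>. complex_of_real (mean_square F \<eta>)) \<longlongrightarrow> of_real (enn2real (H2_energy F))) (at 0 within octant)"
    by (intro tendsto_of_real mean_square_limit F)
  from Lim_transform_eventually[OF this ev]
  have "((\<lambda>\<eta>. L2_inner (slice F \<eta>) (slice F \<eta>)) \<longlongrightarrow> complex_of_real (enn2real (H2_energy F))) (at 0 within octant)" .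
  with H2_inner_limit[OF F F] show ?thesis
    by (rule tendsto_unique[OF at_0_octant_neq_bot])
qed

section \<open>The Hardy space as a semi-inner product space\<close>

lemma H2_lin:
  fixes F G :: "complex^'n \<Rightarrow> complex"
  assumes F: "F \<in> H2" and G: "G \<in> H2"
  shows "(\<lambda>w. F w + c * G w) \<in> H2"
proof -
  have "holomorphic_Cn_on (\<lambda>w. F w + c * G w) tube"
    unfolding holomorphic_Cn_on_def
  proof
    fix z :: "complex^'n" assume z: "z \<in> tube"
    from H2_holomorphic[OF F, unfolded holomorphic_Cn_on_def, rule_format, OF z]
    obtain a where a: "(F has_derivative (\<lambda>h. \<Sum>k\<in>UNIV. a $ k * h $ k)) (at z)"
      by (elim exE) (rule that)
    from H2_holomorphic[OF G, unfolded holomorphic_Cn_on_def, rule_format, OF z]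
    obtain b where b: "(G has_derivative (\<lambda>h. \<Sum>k\<in>UNIV. b $ k * h $ k)) (at z)"
      by (elim exE) (rule that)
    have "((\<lambda>w. F w + c * G w) has_derivative (\<lambda>h. (\<Sum>k\<in>UNIV. a $ k * h $ k) + c * (\<Sum>k\<in>UNIV. b $ k * h $ k))) (at z)"
      by (intro has_derivative_add a has_derivative_mult_right b)
    moreover have "(\<lambda>h. (\<Sum>k\<in>UNIV. a $ k * h $ k) + c * (\<Sum>k\<in>UNIV. b $ k * h $ k))
        = (\<lambda>h. \<Sum>k\<in>UNIV. (\<chi> k. a $ k + c * b $ k) $ k * h $ k)"
      by (simp add: fun_eq_iff sum.distrib sum_distrib_left distrib_right mult.assoc)
    ultimately show "\<exists>d :: complex^'n. ((\<lambda>w. F w + c * G w) has_derivative (\<lambda>h. \<Sum>k\<in>UNIV. d $ k * h $ k)) (at z)"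
      by (intro exI[of _ "\<chi> k. a $ k + c * b $ k"]) simp
  qed
  moreover have "H2_energy (\<lambda>w. F w + c * G w) \<le> ennreal (2 * enn2real (H2_energy F) + 2 * (cmod c)\<^sup>2 * enn2real (H2_energy G))"
    unfolding H2_energy_def[of "\<lambda>w. F w + c * G w"]
  proof (rule SUP_least)
    fix y :: "real^'n" assume y: "y \<in> octant"
    have s: "square_integrable (slice F y)" "square_integrable (slice G y)"
      by (intro square_integrable_slice F G y)+
    have sc: "square_integrable (\<lambda>x. c * slice G y x)"
      using square_integrable_lin[OF _ s(2), of "\<lambda>x. 0" c] L2.zero_mem[of "slice G y"] s by simp
    have "L2.nsq (\<lambda>x. slice F y x + 1 * (c * slice G y x)) \<le> 2 * L2.nsq (slice F y) + 2 * L2.nsq (\<lambda>x. c * slice G y x)"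
      using s sc by (intro L2.nsq_add_le) auto
    also have "L2.nsq (\<lambda>x. c * slice G y x) = (cmod c)\<^sup>2 * L2.nsq (slice G y)"
      unfolding L2_nsq by (simp add: norm_mult power_mult_distrib)
    finally have "L2.nsq (\<lambda>x. slice F y x + c * slice G y x) \<le> 2 * mean_square F y + 2 * (cmod c)\<^sup>2 * mean_square G y"
      by (simp add: mean_square_def)
    also have "\<dots> \<le> 2 * enn2real (H2_energy F) + 2 * (cmod c)\<^sup>2 * enn2real (H2_energy G)"
      using mean_square_le[OF F y] mean_square_le[OF G y] by (intro add_mono mult_left_mono) auto
    finally show "(\<integral>\<^sup>+ x. ennreal ((cmod (F (cvec x y) + c * G (cvec x y)))\<^sup>2) \<partial>lborel)
        \<le> ennreal (2 * enn2real (H2_energy F) + 2 * (cmod c)\<^sup>2 * enn2real (H2_energy G))"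
      using nn_integral_square_nsq[OF square_integrable_lin[OF s, of c]] by (simp add: slice_def ennreal_leI del: ennreal_plus)
  qed
  ultimately show ?thesis by (simp add: H2_def le_less_trans)
qed

interpretation H2: semi_inner_space H2 H2_inner
proof
  fix F G K :: "complex^'n \<Rightarrow> complex" and c
  assume F: "F \<in> H2" and G: "G \<in> H2"
  show lin: "(\<lambda>w. F w + c * G w) \<in> H2" by (rule H2_lin[OF F G])
  show "H2_inner G F = cnj (H2_inner F G)"
    using L2.ip_cnj[of "boundary_limit F" "boundary_limit G"] boundary_limit(1)[OF F] boundary_limit(1)[OF G]
    by (simp add: H2_inner_def L2_inner_def)
  show "0 \<le> Re (H2_inner F F)" by (simp add: H2_inner_self[OF F])
  assume K: "K \<in> H2"
  \<comment> \<open>The boundary limits are chosen separately and are additive only almost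
    everywhere; linearity is taken from the slices, where it is exact.\<close>
  show "H2_inner (\<lambda>w. F w + c * G w) K = H2_inner F K + c * H2_inner G K"
  proof (rule tendsto_unique[OF at_0_octant_neq_bot H2_inner_limit[OF lin K]])
    have "\<forall>\<^sub>F \<eta> in at 0 within octant. L2_inner (slice F \<eta>) (slice K \<eta>) + c * L2_inner (slice G \<eta>) (slice K \<eta>)
        = L2_inner (slice (\<lambda>w. F w + c * G w) \<eta>) (slice K \<eta>)"
      unfolding eventually_at_0_octant
    proof (intro exI[of _ 1] conjI ballI impI)
      fix \<eta> :: "real^'n" assume \<eta>: "\<eta> \<in> octant"
      have "slice (\<lambda>w. F w + c * G w) \<eta> = (\<lambda>x. slice F \<eta> x + c * slice G \<eta> x)"
        by (simp add: slice_def fun_eq_iff)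
      then show "L2_inner (slice F \<eta>) (slice K \<eta>) + c * L2_inner (slice G \<eta>) (slice K \<eta>)
          = L2_inner (slice (\<lambda>w. F w + c * G w) \<eta>) (slice K \<eta>)"
        using L2.ip_lin[of "slice F \<eta>" "slice G \<eta>" "slice K \<eta>" c] square_integrable_slice[OF _ \<eta>] F G K by simp
    qed simp
    moreover have "((\<lambda>\<eta>. L2_inner (slice F \<eta>) (slice K \<eta>) + c * L2_inner (slice G \<eta>) (slice K \<eta>))
        \<longlongrightarrow> H2_inner F K + c * H2_inner G K) (at 0 within octant)"
      by (intro tendsto_intros H2_inner_limit F G K)
    ultimately show "((\<lambda>\<eta>. L2_inner (slice (\<lambda>w. F w + c * G w) \<eta>) (slice K \<eta>))
        \<longlongrightarrow> H2_inner F K + c * H2_inner G K) (at 0 within octant)"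
      by (rule Lim_transform_eventually[rotated])
  qed
qed

lemma H2_nsq: "F \<in> H2 \<Longrightarrow> H2.nsq F = enn2real (H2_energy F)"
  by (simp add: H2.nsq_def H2_inner_self)

lemma H2_norm_eq: "F \<in> H2 \<Longrightarrow> H2_norm F = sqrt (H2.nsq F)"
  by (simp add: H2_norm_def H2_nsq)

lemma nn_integral_slice_le_nsq:
  assumes F: "F \<in> H2" and y: "y \<in> octant"
  shows "(\<integral>\<^sup>+x. ennreal ((cmod (F (cvec x y)))\<^sup>2) \<partial>lborel) \<le> ennreal (H2.nsq F)"
  using nn_integral_slice_le_energy[OF y, of F] F
  by (simp add: H2_nsq slice_def H2_def less_top)

subsection \<open>Boundedness away from the boundary\<close>

text \<open>Multiplication by c + i s on complex n-space, the point x + i y being represented by the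
  pair (x, y).\<close>

definition rot :: "real \<Rightarrow> real \<Rightarrow> 'a::real_vector \<times> 'a \<Rightarrow> 'a \<times> 'a" where
  "rot c s p = (c *\<^sub>R fst p - s *\<^sub>R snd p, s *\<^sub>R fst p + c *\<^sub>R snd p)"

lemma rot_measurable [measurable]:
  "(rot c s :: 'a::euclidean_space \<times> 'a \<Rightarrow> _) \<in> borel_measurable borel"
  unfolding rot_def by (intro borel_measurable_continuous_onI continuous_intros)

text \<open>A rotation is a product of three shears, and a shear is a family of translations.\<close>

lemma nn_integral_rot_aux:
  fixes f :: "'a::euclidean_space \<times> 'a \<Rightarrow> ennreal"
  assumes f[measurable]: "f \<in> borel_measurable borel" and cs: "c\<^sup>2 + s\<^sup>2 = 1" "c \<ge> 0"
  shows "(\<integral>\<^sup>+p. f (rot c s p) \<partial>lborel) = (\<integral>\<^sup>+p. f p \<partial>lborel)"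
proof -
  have shear1: "(\<integral>\<^sup>+p. g (fst p + a *\<^sub>R snd p, snd p) \<partial>lborel) = (\<integral>\<^sup>+p. g p \<partial>lborel)"
    if g: "g \<in> borel_measurable borel" for g :: "'a \<times> 'a \<Rightarrow> ennreal" and a
  proof -
    note [measurable] = g
    have "(\<lambda>p::'a \<times> 'a. (fst p + a *\<^sub>R snd p, snd p)) \<in> borel_measurable borel"
      by (intro borel_measurable_continuous_onI continuous_intros)
    from measurable_compose[OF this g]
    have "(\<integral>\<^sup>+p. g (fst p + a *\<^sub>R snd p, snd p) \<partial>lborel) = (\<integral>\<^sup>+y. (\<integral>\<^sup>+x. g (x + a *\<^sub>R y, y) \<partial>lborel) \<partial>lborel)"
      by (subst nn_integral_lborel_pair(2)) simp_all
    also have "\<dots> = (\<integral>\<^sup>+y. (\<integral>\<^sup>+x. g (x, y) \<partial>lborel) \<partial>lborel)"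
      by (intro nn_integral_cong nn_integral_lborel_translate[of "\<lambda>x. g (x, _)"]) measurable
    also have "\<dots> = (\<integral>\<^sup>+p. g p \<partial>lborel)" by (subst nn_integral_lborel_pair(2)) simp_all
    finally show ?thesis .
  qed
  have shear2: "(\<integral>\<^sup>+p. g (fst p, snd p + a *\<^sub>R fst p) \<partial>lborel) = (\<integral>\<^sup>+p. g p \<partial>lborel)"
    if g: "g \<in> borel_measurable borel" for g :: "'a \<times> 'a \<Rightarrow> ennreal" and a
  proof -
    note [measurable] = g
    have "(\<lambda>p::'a \<times> 'a. (fst p, snd p + a *\<^sub>R fst p)) \<in> borel_measurable borel"
      by (intro borel_measurable_continuous_onI continuous_intros)
    from measurable_compose[OF this g]
    have "(\<integral>\<^sup>+p. g (fst p, snd p + a *\<^sub>R fst p) \<partial>lborel) = (\<integral>\<^sup>+x. (\<integral>\<^sup>+y. g (x, y + a *\<^sub>R x) \<partial>lborel) \<partial>lborel)"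
      by (subst nn_integral_lborel_pair(1)) simp_all
    also have "\<dots> = (\<integral>\<^sup>+x. (\<integral>\<^sup>+y. g (x, y) \<partial>lborel) \<partial>lborel)"
      by (intro nn_integral_cong nn_integral_lborel_translate[of "\<lambda>y. g (_, y)"]) measurable
    also have "\<dots> = (\<integral>\<^sup>+p. g p \<partial>lborel)" by (subst nn_integral_lborel_pair(1)) simp_all
    finally show ?thesis .
  qed
  \<comment> \<open>Minus the tangent of half the angle: shears by a, s and a, alternating between
    the two components, compose to the rotation. The assumption c \<ge> 0 keeps 1 + c away from
    0.\<close>
  define a where "a = - s / (1 + c)"
  have ab: "1 + a * s = c" "a * (1 + c) = - s"
  proof -
    have "s * s = (1 - c) * (1 + c)" using cs by (simp add: power2_eq_square algebra_simps)
    then have "a * s = - ((1 - c) * (1 + c)) / (1 + c)" by (simp add: a_def)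
    also have "\<dots> = - (1 - c)" using cs by (simp only: minus_divide_left[symmetric]) simp
    finally show "1 + a * s = c" by simp
    show "a * (1 + c) = - s" using cs by (simp add: a_def)
  qed
  have r: "rot c s p = (fst q + a *\<^sub>R snd q, snd q)"
    if "q = (fst p + a *\<^sub>R snd p, snd p + s *\<^sub>R (fst p + a *\<^sub>R snd p))" for p q :: "'a \<times> 'a"
  proof -
    have 1: "fst q + a *\<^sub>R snd q = (1 + a * s) *\<^sub>R fst p + (a *\<^sub>R snd p + (a * (1 + a * s)) *\<^sub>R snd p)"
      and 2: "snd q = s *\<^sub>R fst p + (1 + a * s) *\<^sub>R snd p"
      using that by (simp_all add: algebra_simps)
    have "a *\<^sub>R snd p + (a * c) *\<^sub>R snd p = (a * (1 + c)) *\<^sub>R snd p"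
      by (simp add: algebra_simps)
    then show ?thesis using 1 2 unfolding ab by (simp add: rot_def)
  qed
  have m1: "(\<lambda>p. f (fst p + a *\<^sub>R snd p, snd p)) \<in> borel_measurable borel"
    by (rule measurable_compose[OF _ f]) (intro borel_measurable_continuous_onI continuous_intros)
  have m2: "(\<lambda>p. f (fst p + a *\<^sub>R (snd p + s *\<^sub>R fst p), snd p + s *\<^sub>R fst p)) \<in> borel_measurable borel"
    by (rule measurable_compose[OF _ f]) (intro borel_measurable_continuous_onI continuous_intros)
  have "(\<integral>\<^sup>+p. f (rot c s p) \<partial>lborel)
      = (\<integral>\<^sup>+p. f (fst p + a *\<^sub>R snd p + a *\<^sub>R (snd p + s *\<^sub>R (fst p + a *\<^sub>R snd p)), snd p + s *\<^sub>R (fst p + a *\<^sub>R snd p)) \<partial>lborel)"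
    by (simp add: r[OF refl])
  also have "\<dots> = (\<integral>\<^sup>+p. f (fst p + a *\<^sub>R (snd p + s *\<^sub>R fst p), snd p + s *\<^sub>R fst p) \<partial>lborel)"
    using shear1[OF m2, of a] by simp
  also have "\<dots> = (\<integral>\<^sup>+p. f (fst p + a *\<^sub>R snd p, snd p) \<partial>lborel)"
    using shear2[OF m1, of s] by simp
  also have "\<dots> = (\<integral>\<^sup>+p. f p \<partial>lborel)" by (rule shear1[OF f])
  finally show ?thesis .
qed

lemma rot_rot: "rot (cos a) (sin a) (rot (cos b) (sin b) p) = rot (cos (a + b)) (sin (a + b)) p"
  by (simp add: rot_def cos_add sin_add algebra_simps)

text \<open>A quarter of the angle lies in [0, pi/2] and so has nonnegative cosine, as
  \<open>nn_integral_rot_aux\<close> demands; four such rotations are composed.\<close>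

lemma nn_integral_rot:
  fixes f :: "'a::euclidean_space \<times> 'a \<Rightarrow> ennreal"
  assumes f[measurable]: "f \<in> borel_measurable borel" and t: "0 \<le> t" "t \<le> 2 * pi"
  shows "(\<integral>\<^sup>+p. f (rot (cos t) (sin t) p) \<partial>lborel) = (\<integral>\<^sup>+p. f p \<partial>lborel)"
proof -
  let ?r = "rot (cos (t / 4)) (sin (t / 4)) :: 'a \<times> 'a \<Rightarrow> 'a \<times> 'a"
  have "cos (t / 4) \<ge> 0" using t by (intro cos_ge_zero) auto
  then have inv: "(\<integral>\<^sup>+p. g (?r p) \<partial>lborel) = (\<integral>\<^sup>+p. g p \<partial>lborel)"
    if "g \<in> borel_measurable borel" for g :: "'a \<times> 'a \<Rightarrow> ennreal"
    using that by (intro nn_integral_rot_aux) simp_all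
  have "rot (cos t) (sin t) p = ?r (?r (?r (?r p)))" for p
    by (simp add: rot_rot)
  then have "(\<integral>\<^sup>+p. f (rot (cos t) (sin t) p) \<partial>lborel) = (\<integral>\<^sup>+p. f (?r (?r (?r (?r p)))) \<partial>lborel)"
    by simp
  also have "\<dots> = (\<integral>\<^sup>+p. f p \<partial>lborel)"
    using inv[of "\<lambda>p. f (?r (?r (?r p)))"] inv[of "\<lambda>p. f (?r (?r p))"] inv[of "\<lambda>p. f (?r p)"] inv[of f] by simp
  finally show ?thesis .
qed

text \<open>The mean value property on the unit circle, left unnormalised. It will be applied to the
  square of F along a complex line, so that |F|^2 appears.\<close>

lemma circle_mean_le:
  assumes g: "g holomorphic_on ball 0 r" and r: "1 < r"
  shows "ennreal (2 * pi * cmod (g 0)) \<le> (\<integral>\<^sup>+t. indicator {0..2 * pi} t * ennreal (cmod (g (cis t))) \<partial>lborel)"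
proof -
  have cont: "continuous_on (ball 0 r) g" by (rule holomorphic_on_imp_continuous_on[OF g])
  have sub: "cball 0 1 \<subseteq> ball (0::complex) r" using r by auto
  have "((\<lambda>u. g u / (u - 0)) has_contour_integral 2 * of_real pi * \<i> * g 0) (circlepath 0 1)"
    by (rule Cauchy_integral_circlepath[OF continuous_on_subset[OF cont sub]])
      (use holomorphic_on_subset[OF g subset_ball[of 1 r 0]] r in auto)
  then have "((\<lambda>t. (g (cis t) / cis t) * \<i> * cis t) has_integral 2 * of_real pi * \<i> * g 0) {0..2 * pi}"
    by (simp add: circlepath_def has_contour_integral_part_circlepath_iff mult_ac)
  then have int: "((\<lambda>t. \<i> * g (cis t)) has_integral 2 * of_real pi * \<i> * g 0) {0..2 * pi}"
    by (rule has_integral_eq[rotated]) simp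
  have ct: "continuous_on {0..2 * pi} (\<lambda>t. \<i> * g (cis t))"
    by (intro continuous_intros continuous_on_compose2[OF cont]) (use r in \<open>auto intro!: continuous_intros\<close>)
  have L: "integrable lborel (\<lambda>t. indicator {0..2 * pi} t *\<^sub>R (\<i> * g (cis t)))"
    using borel_integrable_atLeastAtMost'[OF ct] by (simp add: set_integrable_def)
  have "(\<integral>t. indicator {0..2 * pi} t *\<^sub>R (\<i> * g (cis t)) \<partial>lborel) = 2 * of_real pi * \<i> * g 0"
    using set_borel_integral_eq_integral(2)[OF borel_integrable_atLeastAtMost'[OF ct]]
    unfolding set_lebesgue_integral_def integral_unique[OF int] .
  then have "ennreal (2 * pi * cmod (g 0)) = ennreal (cmod (\<integral>t. indicator {0..2 * pi} t *\<^sub>R (\<i> * g (cis t)) \<partial>lborel))"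
    by (simp add: norm_mult)
  also have "\<dots> \<le> (\<integral>\<^sup>+t. ennreal (norm (indicator {0..2 * pi} t *\<^sub>R (\<i> * g (cis t)))) \<partial>lborel)"
    by (rule integral_norm_bound_ennreal[OF L])
  also have "\<dots> = (\<integral>\<^sup>+t. indicator {0..2 * pi} t * ennreal (cmod (g (cis t))) \<partial>lborel)"
    by (intro nn_integral_cong) (auto simp: indicator_def norm_mult)
  finally show ?thesis .
qed

lemma norm_rot: "c\<^sup>2 + s\<^sup>2 = 1 \<Longrightarrow> norm (rot c s p) = norm (p :: 'a::real_inner \<times> 'a)"
proof -
  assume cs: "c\<^sup>2 + s\<^sup>2 = 1"
  have "(norm (rot c s p))\<^sup>2 = (c\<^sup>2 + s\<^sup>2) * (fst p \<bullet> fst p + snd p \<bullet> snd p)"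
    by (simp only: power2_norm_eq_inner)
      (simp add: rot_def inner_prod_def inner_add inner_diff inner_commute power2_eq_square algebra_simps)
  also have "\<dots> = (norm p)\<^sup>2" by (simp add: cs power2_norm_eq_inner inner_prod_def)
  finally show ?thesis by simp
qed

text \<open>For each p in a ball of real dimension 2n, the mean value property on the circle e^(it)
  p bounds |F(w)|^2 by a mean over that circle. Averaging over p, rotation invariance turns the
  means into the integral of |F|^2 over a ball around w. Fubini splits this into horizontal slices,
  each bounded by the energy, independently of w.\<close>

lemma H2_bounded:
  fixes F :: "complex^'n \<Rightarrow> complex"
  assumes F: "F \<in> H2" and \<delta>: "\<delta> > 0"
  shows "\<exists>B. \<forall>w. (\<forall>k. \<delta> \<le> Im (w $ k)) \<longrightarrow> cmod (F w) \<le> B"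
proof -
  \<comment> \<open>Radius \<delta>/2 leaves room for \<zeta> p with |\<zeta>| < 2, hence for
    holomorphy on a neighbourhood of the closed unit disc.\<close>
  let ?B = "ball (0 :: (real^'n) \<times> (real^'n)) (\<delta> / 2)"
  let ?b = "ball (0 :: real^'n) (\<delta> / 2)"
  let ?L = "enn2real (H2_energy F)"
  have fin: "H2_energy F = ennreal ?L" using F by (simp add: H2_def less_top)
  have vB: "emeasure lborel ?B = ennreal (measure lborel ?B)" and vb: "emeasure lborel ?b = ennreal (measure lborel ?b)"
    by (rule emeasure_eq_ennreal_measure,
        use emeasure_lborel_ball_finite[of 0 "\<delta> / 2"] in \<open>simp add: less_top\<close>)+
  have pos: "measure lborel ?B > 0" using \<delta> content_ball_pos[of "\<delta> / 2" 0] by simp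
  have main: "measure lborel ?B * (cmod (F w))\<^sup>2 \<le> measure lborel ?b * ?L" if w: "\<forall>k. \<delta> \<le> Im (w $ k)" for w :: "complex^'n"
  proof -
    define u v where "u = (\<chi> k. Re (w $ k))" and "v = (\<chi> k. Im (w $ k))"
    have wv: "w = cvec u v" unfolding u_def v_def by (rule cvec_Re_Im)
    have oct: "v + y \<in> octant" if "norm y < \<delta>" for y
    proof -
      have "0 < v $ k + y $ k" for k
        using component_le_norm_cart[of y k] that w[rule_format, of k] by (simp add: v_def)
      then show ?thesis by (simp add: octant_def)
    qed
    define f where "f p = indicator ?B p * ennreal ((cmod (F (cvec (u + fst p) (v + snd p))))\<^sup>2)" for p
    have snd_small: "norm (snd p) < \<delta> / 2" if "p \<in> ?B" for p
      using that norm_snd_le[of "snd p" "fst p"] by simp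
    have f[measurable]: "f \<in> borel_measurable borel"
    proof -
      have "continuous_on ?B (\<lambda>p. F (cvec (u + fst p) (v + snd p)))"
        using snd_small \<delta> by (intro continuous_on_compose2[OF continuous_on_H2[OF F]] continuous_intros)
          (force intro!: oct)
      then have "(\<lambda>p. indicator ?B p *\<^sub>R F (cvec (u + fst p) (v + snd p))) \<in> borel_measurable borel"
        by (intro borel_measurable_continuous_on_indicator) auto
      then have "(\<lambda>p. ennreal ((cmod (indicator ?B p *\<^sub>R F (cvec (u + fst p) (v + snd p))))\<^sup>2)) \<in> borel_measurable borel"
        by measurable
      also have "(\<lambda>p. ennreal ((cmod (indicator ?B p *\<^sub>R F (cvec (u + fst p) (v + snd p))))\<^sup>2)) = f"
        by (auto simp: f_def indicator_def fun_eq_iff)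
      finally show ?thesis .
    qed
    have mean: "ennreal (2 * pi * (cmod (F w))\<^sup>2) * indicator ?B p
        \<le> (\<integral>\<^sup>+t. indicator {0..2 * pi} t * f (rot (cos t) (sin t) p) \<partial>lborel)" for p
    proof (cases "p \<in> ?B")
      case True
      obtain x y where p: "p = (x, y)" by (cases p)
      define q where "q = cvec x y"
      have line: "(\<chi> k. w $ k + \<zeta> * q $ k) = cvec (u + (Re \<zeta> *\<^sub>R x - Im \<zeta> *\<^sub>R y)) (v + (Im \<zeta> *\<^sub>R x + Re \<zeta> *\<^sub>R y))" for \<zeta>
        by (simp add: wv q_def vec_eq_iff complex_eq_iff)
      have "(\<lambda>\<zeta>. F (\<chi> k. w $ k + \<zeta> * q $ k)) holomorphic_on {\<zeta>. (\<chi> k. w $ k + \<zeta> * q $ k) \<in> tube}"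
        by (rule holomorphic_on_line[OF H2_holomorphic[OF F]])
      then have "(\<lambda>\<zeta>. F (\<chi> k. w $ k + \<zeta> * q $ k)) holomorphic_on ball 0 2"
      proof (rule holomorphic_on_subset, intro subsetI CollectI)
        fix \<zeta> :: complex assume z: "\<zeta> \<in> ball 0 2"
        \<comment> \<open>Multiplication by \<zeta> is a rotation of the pair followed by scaling
          with |\<zeta>|, so the imaginary part is at most |\<zeta>| times the norm of
          \<open>p\<close>.\<close>
        have "norm (Im \<zeta> *\<^sub>R x + Re \<zeta> *\<^sub>R y) < \<delta>"
        proof (cases "\<zeta> = 0")
          case False
          let ?c = "Re \<zeta> / cmod \<zeta>" and ?s = "Im \<zeta> / cmod \<zeta>"
          have cs: "?c\<^sup>2 + ?s\<^sup>2 = 1"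
            using False by (simp add: power_divide add_divide_distrib[symmetric] cmod_power2[symmetric])
          have "Im \<zeta> *\<^sub>R x + Re \<zeta> *\<^sub>R y = cmod \<zeta> *\<^sub>R snd (rot ?c ?s p)"
            using False by (simp add: rot_def p algebra_simps)
          then have "norm (Im \<zeta> *\<^sub>R x + Re \<zeta> *\<^sub>R y) = cmod \<zeta> * norm (snd (rot ?c ?s p))" by simp
          also have "\<dots> \<le> cmod \<zeta> * norm p"
            using norm_snd_le[of "snd (rot ?c ?s p)" "fst (rot ?c ?s p)"] norm_rot[OF cs, of p]
            by (intro mult_left_mono) auto
          also have "\<dots> \<le> 2 * norm p" using z by (intro mult_right_mono) auto
          also have "\<dots> < \<delta>" using True by simp
          finally show ?thesis .
        qed (use \<delta> in simp)
        then show "(\<chi> k. w $ k + \<zeta> * q $ k) \<in> tube" unfolding line by (simp add: oct)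
      qed
      then have "(\<lambda>\<zeta>. (F (\<chi> k. w $ k + \<zeta> * q $ k))\<^sup>2) holomorphic_on ball 0 2" by (intro holomorphic_intros)
      from circle_mean_le[OF this]
      have "ennreal (2 * pi * (cmod (F w))\<^sup>2)
          \<le> (\<integral>\<^sup>+t. indicator {0..2 * pi} t * ennreal (cmod ((F (\<chi> k. w $ k + cis t * q $ k))\<^sup>2)) \<partial>lborel)"
        by (simp add: norm_power)
      also have "\<dots> = (\<integral>\<^sup>+t. indicator {0..2 * pi} t * f (rot (cos t) (sin t) p) \<partial>lborel)"
        using True norm_rot[of "cos _" "sin _" p] unfolding line
        by (intro nn_integral_cong) (simp add: f_def norm_power rot_def p)
      finally show ?thesis using True by simp
    qed simp
    have "ennreal (2 * pi * (cmod (F w))\<^sup>2) * emeasure lborel ?B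
        = (\<integral>\<^sup>+p. ennreal (2 * pi * (cmod (F w))\<^sup>2) * indicator ?B p \<partial>lborel)"
      by (rule nn_integral_cmult_indicator[symmetric]) simp
    also have "\<dots> \<le> (\<integral>\<^sup>+p. (\<integral>\<^sup>+t. indicator {0..2 * pi} t * f (rot (cos t) (sin t) p) \<partial>lborel) \<partial>lborel)"
      by (intro nn_integral_mono mean)
    also have "\<dots> = (\<integral>\<^sup>+t. (\<integral>\<^sup>+p. indicator {0..2 * pi} t * f (rot (cos t) (sin t) p) \<partial>lborel) \<partial>lborel)"
    proof -
      have "(\<lambda>z :: ((real^'n) \<times> (real^'n)) \<times> real. rot (cos (snd z)) (sin (snd z)) (fst z)) \<in> borel_measurable borel"
        unfolding rot_def by (intro borel_measurable_continuous_onI continuous_intros)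
      from measurable_compose[OF this f]
      have 1[measurable]: "(\<lambda>z. f (rot (cos (snd z)) (sin (snd z)) (fst z))) \<in> borel_measurable borel" .
      have "(\<lambda>z :: ((real^'n) \<times> (real^'n)) \<times> real. indicator (UNIV \<times> {0..2 * pi}) z :: ennreal) \<in> borel_measurable borel"
        by (intro borel_measurable_indicator borel_closed closed_Times) auto
      then have "(\<lambda>z :: ((real^'n) \<times> (real^'n)) \<times> real. indicator (UNIV \<times> {0..2 * pi}) z * f (rot (cos (snd z)) (sin (snd z)) (fst z))) \<in> borel_measurable borel"
        by measurable
      moreover have "(\<lambda>z :: ((real^'n) \<times> (real^'n)) \<times> real. indicator (UNIV \<times> {0..2 * pi}) z * f (rot (cos (snd z)) (sin (snd z)) (fst z)))
          = (\<lambda>z. indicator {0..2 * pi} (snd z) * f (rot (cos (snd z)) (sin (snd z)) (fst z)))"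
        by (auto simp: indicator_def fun_eq_iff)
      ultimately have m: "(\<lambda>z. indicator {0..2 * pi} (snd z) * f (rot (cos (snd z)) (sin (snd z)) (fst z))) \<in> borel_measurable borel"
        by simp
      show ?thesis using nn_integral_lborel_pair[OF m] by simp
    qed
    also have "\<dots> = (\<integral>\<^sup>+t. (\<integral>\<^sup>+p. f p \<partial>lborel) * indicator {0..2 * pi} t \<partial>lborel)"
    proof (intro nn_integral_cong)
      fix t :: real
      have m: "(\<lambda>p. f (rot (cos t) (sin t) p)) \<in> borel_measurable lborel"
        using measurable_compose[OF rot_measurable f] by simp
      show "(\<integral>\<^sup>+p. indicator {0..2 * pi} t * f (rot (cos t) (sin t) p) \<partial>lborel) = (\<integral>\<^sup>+p. f p \<partial>lborel) * indicator {0..2 * pi} t"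
        using nn_integral_rot[OF f, of t] by (simp add: nn_integral_cmult[OF m] indicator_def)
    qed
    also have "\<dots> = (\<integral>\<^sup>+p. f p \<partial>lborel) * ennreal (2 * pi)" by (simp add: nn_integral_cmult)
    also have "(\<integral>\<^sup>+p. f p \<partial>lborel) \<le> ennreal ?L * emeasure lborel ?b"
    proof -
      have "(\<integral>\<^sup>+p. f p \<partial>lborel) = (\<integral>\<^sup>+y. (\<integral>\<^sup>+x. f (x, y) \<partial>lborel) \<partial>lborel)"
        by (rule nn_integral_lborel_pair(2)[OF f])
      also have "\<dots> \<le> (\<integral>\<^sup>+y. ennreal ?L * indicator ?b y \<partial>lborel)"
      proof (intro nn_integral_mono)
        fix y :: "real^'n"
        show "(\<integral>\<^sup>+x. f (x, y) \<partial>lborel) \<le> ennreal ?L * indicator ?b y"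
        proof (cases "norm y < \<delta> / 2")
          case True
          have o: "v + y \<in> octant" using True \<delta> by (intro oct) simp
          have "(\<lambda>x. ennreal ((cmod (slice F (v + y) x))\<^sup>2)) \<in> borel_measurable borel"
            using slice_measurable[OF continuous_on_H2[OF F] o] by measurable
          from nn_integral_lborel_translate[OF this, of u]
          have "(\<integral>\<^sup>+x. ennreal ((cmod (F (cvec (u + x) (v + y))))\<^sup>2) \<partial>lborel) = (\<integral>\<^sup>+x. ennreal ((cmod (slice F (v + y) x))\<^sup>2) \<partial>lborel)"
            by (simp add: slice_def add.commute)
          also have "\<dots> \<le> ennreal ?L" using nn_integral_slice_le_energy[OF o, of F] fin by simp
          finally have "(\<integral>\<^sup>+x. ennreal ((cmod (F (cvec (u + x) (v + y))))\<^sup>2) \<partial>lborel) \<le> ennreal ?L" .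
          moreover have "(\<integral>\<^sup>+x. f (x, y) \<partial>lborel) \<le> (\<integral>\<^sup>+x. ennreal ((cmod (F (cvec (u + x) (v + y))))\<^sup>2) \<partial>lborel)"
            by (intro nn_integral_mono) (simp add: f_def indicator_def)
          ultimately show ?thesis using True by simp
        next
          case False
          then have "f (x, y) = 0" for x using snd_small[of "(x, y)"] by (auto simp: f_def indicator_def)
          then show ?thesis by simp
        qed
      qed
      also have "\<dots> = ennreal ?L * emeasure lborel ?b" by (rule nn_integral_cmult_indicator) simp
      finally show ?thesis .
    qed
    finally have "ennreal (2 * pi * (cmod (F w))\<^sup>2) * ennreal (measure lborel ?B) \<le> ennreal ?L * ennreal (measure lborel ?b) * ennreal (2 * pi)"
      unfolding vB vb by (simp add: mult_right_mono)
    then have "ennreal (2 * pi * (measure lborel ?B * (cmod (F w))\<^sup>2)) \<le> ennreal (2 * pi * (measure lborel ?b * ?L))"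
      by (simp only: ennreal_mult[symmetric] mult_nonneg_nonneg zero_le_power2 enn2real_nonneg measure_nonneg pi_ge_zero zero_le_numeral mult_ac)
    then have "2 * pi * (measure lborel ?B * (cmod (F w))\<^sup>2) \<le> 2 * pi * (measure lborel ?b * ?L)"
      by (rule ennreal_le_iff[THEN iffD1, rotated]) (simp add: measure_nonneg)
    then show ?thesis by simp
  qed
  show ?thesis
  proof (intro exI allI impI)
    fix w :: "complex^'n" assume "\<forall>k. \<delta> \<le> Im (w $ k)"
    from main[OF this] pos have "(cmod (F w))\<^sup>2 \<le> measure lborel ?b * ?L / measure lborel ?B"
      by (simp add: pos_le_divide_eq mult.commute)
    then show "cmod (F w) \<le> sqrt (measure lborel ?b * ?L / measure lborel ?B)" by (rule real_le_rsqrt)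
  qed
qed

subsection \<open>The dictionary functions\<close>

text \<open>The one-variable factor of \<open>phi\<close>; its pole \<open>b\<close> will be the
  conjugate of a coordinate of z.\<close>

definition ker1 :: "nat \<Rightarrow> complex \<Rightarrow> complex \<Rightarrow> complex" where
  "ker1 m b t = (- 1 / (2 * complex_of_real pi * \<i>)) * (fact m / (t - b) ^ Suc m)"

lemma phi_eq_prod_ker1:
  fixes w z :: "complex^'n"
  assumes "w \<in> tube" "z \<in> tube"
  shows "phi \<alpha> z w = (\<Prod>k\<in>UNIV. ker1 (\<alpha> $ k) (cnj (z $ k)) (w $ k))"
  unfolding phi_eq[OF assms] ker1_def by (subst prod.distrib) simp

lemma ker1_holomorphic: "ker1 m b holomorphic_on - {b}"
  unfolding ker1_def by (intro holomorphic_intros) auto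

text \<open>The k-th derivative in z of the m-th derivative in \<open>cnj w\<close> of the
  one-variable kernel K(z, cnj w), which is what reproduction of derivatives predicts for the inner
  product; note that -1 / (2 pi i) = i / (2 pi).\<close>

definition gram1 :: "nat \<Rightarrow> complex \<Rightarrow> nat \<Rightarrow> complex \<Rightarrow> complex" where
  "gram1 m w k z = \<i> / (2 * of_real pi) * (-1) ^ k * (fact (m + k) / (z - cnj w) ^ Suc (m + k))"

text \<open>On the line of height \<open>e\<close> the kernels look like those on the real axis with
  both parameters raised by i e. The conjugated factor then has its pole \<open>a\<close> above the
  axis and the other its pole \<open>b\<close> below, as in \<open>integral_rational_kernel\<close>.
  Height 0 is included because it dominates all others in the energy estimate.\<close>

lemma ker1_inner:
  assumes w: "0 < Im w" and z: "0 < Im z" and e: "0 \<le> e"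
  shows "integrable lborel (\<lambda>t. ker1 m (cnj w) (Complex t e) * cnj (ker1 k (cnj z) (Complex t e)))"
    and "(\<integral>t. ker1 m (cnj w) (Complex t e) * cnj (ker1 k (cnj z) (Complex t e)) \<partial>lborel)
      = gram1 m (w + \<i> * e) k (z + \<i> * e)"
proof -
  define a b where "a = z + \<i> * e" and "b = cnj w - \<i> * e"
  have a: "0 < Im a" and b: "Im b < 0" using w z e by (simp_all add: a_def b_def)
  define C where "C = fact m * fact k / (4 * complex_of_real pi * of_real pi)"
  have eq: "ker1 m (cnj w) (Complex t e) * cnj (ker1 k (cnj z) (Complex t e))
      = C * (1 / ((of_real t - a) ^ Suc k * (of_real t - b) ^ Suc m))" for t
  proof -
    have ta: "Complex t e - cnj w = of_real t - b" "cnj (Complex t e - cnj z) = of_real t - a"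
      by (simp_all add: a_def b_def complex_eq_iff)
    have "cnj (ker1 k (cnj z) (Complex t e))
        = cnj (- 1 / (2 * complex_of_real pi * \<i>)) * (fact k / (cnj (Complex t e - cnj z)) ^ Suc k)"
      by (simp add: ker1_def)
    then have "ker1 m (cnj w) (Complex t e) * cnj (ker1 k (cnj z) (Complex t e))
        = ((- 1 / (2 * complex_of_real pi * \<i>)) * cnj (- 1 / (2 * complex_of_real pi * \<i>)))
          * (fact m * fact k) * (1 / ((of_real t - a) ^ Suc k * (of_real t - b) ^ Suc m))"
      unfolding ta ker1_def by simp
    also have "(- 1 / (2 * complex_of_real pi * \<i>)) * cnj (- 1 / (2 * complex_of_real pi * \<i>)) = 1 / (4 * complex_of_real pi * of_real pi)"
    proof -
      have "- 1 / (2 * complex_of_real pi * \<i>) = \<i> / (2 * of_real pi)" by (simp add: field_simps)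
      then show ?thesis by (simp only:) simp
    qed
    finally show ?thesis by (simp add: C_def)
  qed
  note R = integral_rational_kernel[OF a b, of k m]
  show "integrable lborel (\<lambda>t. ker1 m (cnj w) (Complex t e) * cnj (ker1 k (cnj z) (Complex t e)))"
    unfolding eq by (intro integrable_mult_right R)
  have "fact k * fact m * ((k + m) choose k) = (fact (k + m) :: nat)"
    using binomial_fact_lemma[of k "k + m"] by simp
  from arg_cong[OF this, of "of_nat :: nat \<Rightarrow> complex"]
  have bin: "fact m * fact k * of_nat ((k + m) choose k) = (fact (m + k) :: complex)"
    by (simp only: of_nat_mult of_nat_fact mult.commute[of "fact m"] add.commute[of m])
  have alg: "(x / Q) * (T * S * N / D) = T / Q * S * ((x * N) / D)" for x Q T S N D :: complex
    by simp
  have "C * (2 * pi * \<i> * (-1) ^ k * of_nat ((k + m) choose k) / (a - b) ^ Suc (k + m))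
      = (2 * pi * \<i> / (4 * complex_of_real pi * of_real pi)) * (-1) ^ k * (fact (m + k) / (a - b) ^ Suc (m + k))"
    unfolding C_def alg bin by (simp only: add.commute[of k m])
  also have "2 * pi * \<i> / (4 * complex_of_real pi * of_real pi) = \<i> / (2 * of_real pi)" by simp
  finally show "(\<integral>t. ker1 m (cnj w) (Complex t e) * cnj (ker1 k (cnj z) (Complex t e)) \<partial>lborel)
      = gram1 m (w + \<i> * e) k (z + \<i> * e)"
    unfolding eq by (simp only: integral_mult_right_zero R) (simp add: gram1_def a_def b_def)
qed

text \<open>\<open>integral_iterated_kernel\<close> for the constant function 1.\<close>

lemma integral_prod_vec:
  fixes q :: "'n::finite \<Rightarrow> real \<Rightarrow> complex"
  assumes "\<And>k. integrable lborel (q k)"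
  shows "(\<integral>x. (\<Prod>k\<in>UNIV. q k (x $ k)) \<partial>(lborel :: (real^'n) measure)) = (\<Prod>k\<in>UNIV. \<integral>t. q k t \<partial>lborel)"
  using integral_iterated_kernel[of "\<lambda>_. 1" undefined 1 q "\<lambda>k. \<integral>t. q k t \<partial>lborel"] assms by simp

lemma phi_H2:
  fixes z :: "complex^'n"
  assumes z: "z \<in> tube"
  shows "phi \<alpha> z \<in> H2"
proof -
  let ?g = "\<lambda>k. ker1 (\<alpha> $ k) (cnj (z $ k))"
  have ne: "w $ k \<noteq> cnj (z $ k)" if "w \<in> tube" for w :: "complex^'n" and k
    using that z unfolding tube_iff by (metis complex_cnj_cnj complex_cnj_complex_of_real cnj.simps(2) less_asym neg_0_less_iff_less)
  have "holomorphic_Cn_on (phi \<alpha> z) tube"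
    unfolding holomorphic_Cn_on_def
  proof
    fix w :: "complex^'n" assume w: "w \<in> tube"
    have "?g k field_differentiable at (w $ k)" for k
      by (rule holomorphic_on_imp_differentiable_at[OF ker1_holomorphic]) (use ne[OF w] in auto)
    then obtain g' where g': "\<And>k. (?g k has_field_derivative g' k) (at (w $ k))"
      unfolding field_differentiable_def by metis
    have d: "((\<lambda>w. ?g k (w $ k)) has_derivative (\<lambda>h. g' k * h $ k)) (at w)" for k
      using has_derivative_compose[OF bounded_linear_imp_has_derivative[OF bounded_linear_vec_nth] g'[unfolded has_field_derivative_def]] .
    have "((\<lambda>w. \<Prod>k\<in>UNIV. ?g k (w $ k)) has_derivative (\<lambda>h. \<Sum>i\<in>UNIV. g' i * h $ i * (\<Prod>j\<in>UNIV - {i}. ?g j (w $ j)))) (at w)"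
      by (rule has_derivative_prod) (rule d)
    then have "(phi \<alpha> z has_derivative (\<lambda>h. \<Sum>i\<in>UNIV. g' i * h $ i * (\<Prod>j\<in>UNIV - {i}. ?g j (w $ j)))) (at w)"
      by (rule has_derivative_transform_within_open[OF _ open_tube w]) (simp add: phi_eq_prod_ker1 z)
    moreover have "(\<lambda>h :: complex^'n. \<Sum>i\<in>UNIV. g' i * h $ i * (\<Prod>j\<in>UNIV - {i}. ?g j (w $ j)))
        = (\<lambda>h. \<Sum>i\<in>UNIV. (\<chi> i. g' i * (\<Prod>j\<in>UNIV - {i}. ?g j (w $ j))) $ i * h $ i)"
      by (simp add: mult_ac)
    ultimately show "\<exists>c :: complex^'n. (phi \<alpha> z has_derivative (\<lambda>h. \<Sum>k\<in>UNIV. c $ k * h $ k)) (at w)"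
      by (intro exI[of _ "\<chi> i. g' i * (\<Prod>j\<in>UNIV - {i}. ?g j (w $ j))"]) simp
  qed
  moreover have "H2_energy (phi \<alpha> z) < \<infinity>"
  proof -
    have zp: "0 < Im (z $ k)" for k using z by (simp add: tube_iff)
    let ?h = "\<lambda>k t. (cmod (?g k (of_real t)))\<^sup>2"
    have h: "(\<integral>\<^sup>+t. ennreal (?h k t) \<partial>lborel) < \<infinity>" for k
    proof -
      have "?g k (Complex t 0) * cnj (?g k (Complex t 0)) = of_real (?h k t)" for t
      proof -
        have "Complex t 0 = of_real t" by (simp add: complex_eq_iff)
        then show ?thesis by (simp only: complex_norm_square)
      qed
      then have "integrable lborel (\<lambda>t. complex_of_real (?h k t))"
        using ker1_inner(1)[OF zp zp, of 0 "\<alpha> $ k" k "\<alpha> $ k" k] by (simp only:)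
      from integrable_norm[OF this] have "integrable lborel (?h k)"
        by (simp del: of_real_power)
      then show ?thesis by (simp add: integrable_iff_bounded)
    qed
    \<comment> \<open>The poles lie below the real axis, so raising the line only increases the
      distance to them: the values at height 0 bound those at every height.\<close>
    have le: "(cmod (?g k (Complex t s)))\<^sup>2 \<le> ?h k t" if s: "s > 0" for k t s
    proof -
      have "cmod (of_real t - cnj (z $ k)) \<le> cmod (Complex t s - cnj (z $ k))"
      proof -
        have "(Im (z $ k))\<^sup>2 \<le> (s + Im (z $ k))\<^sup>2" using zp[of k] s by (intro power_mono) auto
        then show ?thesis unfolding cmod_def by (intro real_sqrt_le_mono) simp
      qed
      moreover have "0 < cmod (of_real t - cnj (z $ k))" using zp[of k] by (auto simp: complex_eq_iff)
      ultimately have "cmod (?g k (Complex t s)) \<le> cmod (?g k (of_real t))"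
        unfolding ker1_def norm_mult norm_divide norm_power
        by (intro mult_left_mono divide_left_mono power_mono mult_pos_pos zero_less_power) auto
      then show ?thesis by (intro power_mono) auto
    qed
    have "H2_energy (phi \<alpha> z) \<le> (\<Prod>k\<in>UNIV. \<integral>\<^sup>+t. ennreal (?h k t) \<partial>lborel)"
      unfolding H2_energy_def
    proof (rule SUP_least)
      fix y :: "real^'n" assume y: "y \<in> octant"
      have hm: "(\<lambda>t. ennreal (?h k t)) \<in> borel_measurable borel" for k
      proof -
        have "continuous_on UNIV (\<lambda>t. ?g k (of_real t))"
          by (rule continuous_on_compose2[OF holomorphic_on_imp_continuous_on[OF ker1_holomorphic]])
            (use zp[of k] in \<open>auto simp: complex_eq_iff intro!: continuous_intros\<close>)
        from borel_measurable_continuous_onI[OF this] show ?thesis by measurable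
      qed
      have "(\<integral>\<^sup>+ x. ennreal ((cmod (phi \<alpha> z (cvec x y)))\<^sup>2) \<partial>lborel)
          \<le> (\<integral>\<^sup>+ x. (\<Prod>k\<in>UNIV. ennreal (?h k (x $ k))) \<partial>lborel)"
      proof (intro nn_integral_mono)
        fix x :: "real^'n"
        have "(cmod (phi \<alpha> z (cvec x y)))\<^sup>2 = (\<Prod>k\<in>UNIV. (cmod (?g k (Complex (x $ k) (y $ k))))\<^sup>2)"
          using y by (subst phi_eq_prod_ker1) (simp_all add: z prod_norm[symmetric] prod_power_distrib)
        also have "\<dots> \<le> (\<Prod>k\<in>UNIV. ?h k (x $ k))"
          using y by (intro prod_mono conjI le) (auto simp: octant_def)
        finally show "ennreal ((cmod (phi \<alpha> z (cvec x y)))\<^sup>2) \<le> (\<Prod>k\<in>UNIV. ennreal (?h k (x $ k)))"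
          by (simp add: prod_ennreal ennreal_leI)
      qed
      also have "\<dots> = (\<Prod>k\<in>UNIV. \<integral>\<^sup>+t. ennreal (?h k t) \<partial>lborel)"
        by (rule nn_integral_prod_vec) (rule hm)
      finally show "(\<integral>\<^sup>+ x. ennreal ((cmod (phi \<alpha> z (cvec x y)))\<^sup>2) \<partial>lborel)
        \<le> (\<Prod>k\<in>UNIV. \<integral>\<^sup>+t. ennreal (?h k t) \<partial>lborel)" .
    qed
    also have "\<dots> < \<infinity>"
    proof -
      have "(\<Prod>k\<in>A. \<integral>\<^sup>+t. ennreal (?h k t) \<partial>lborel) < \<infinity>" if "finite A" for A
        using that h by (induction A) (auto simp: ennreal_mult_less_top)
      then show ?thesis by simp
    qed
    finally show ?thesis .
  qed
  ultimately show ?thesis by (simp add: H2_def)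
qed

lemma tendsto_nth_octant: "((\<lambda>\<eta>::real^'n. \<eta> $ k) \<longlongrightarrow> 0) (at 0 within octant)"
proof -
  have "((\<lambda>\<eta>::real^'n. \<eta> $ k) \<longlongrightarrow> 0 $ k) (at 0 within octant)" by (intro tendsto_intros)
  then show ?thesis by simp
qed

text \<open>On the slice of height \<eta> the inner product factorises into one-variable integrals
  with parameters raised by i \<eta>; the explicit formula is continuous as \<eta> tends to
  0.\<close>

lemma phi_gram:
  fixes w z :: "complex^'n"
  assumes w: "w \<in> tube" and z: "z \<in> tube"
  shows "H2_inner (phi \<beta> w) (phi \<alpha> z) = (\<Prod>k\<in>UNIV. gram1 (\<beta> $ k) (w $ k) (\<alpha> $ k) (z $ k))"
proof (rule tendsto_unique[OF at_0_octant_neq_bot H2_inner_limit[OF phi_H2[OF w] phi_H2[OF z]]])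
  have wp: "0 < Im (w $ k)" and zp: "0 < Im (z $ k)" for k using w z by (simp_all add: tube_iff)
  let ?G = "\<lambda>\<eta>::real^'n. \<Prod>k\<in>UNIV. gram1 (\<beta> $ k) (w $ k + \<i> * (\<eta> $ k)) (\<alpha> $ k) (z $ k + \<i> * (\<eta> $ k))"
  have ev: "\<forall>\<^sub>F \<eta> in at 0 within octant. ?G \<eta> = L2_inner (slice (phi \<beta> w) \<eta>) (slice (phi \<alpha> z) \<eta>)"
    unfolding eventually_at_0_octant
  proof (intro exI[of _ 1] conjI ballI impI)
    fix \<eta> :: "real^'n" assume \<eta>: "\<eta> \<in> octant"
    have p: "0 \<le> \<eta> $ k" for k using \<eta> by (simp add: octant_def less_imp_le)
    have "L2_inner (slice (phi \<beta> w) \<eta>) (slice (phi \<alpha> z) \<eta>)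
        = (\<integral>x. (\<Prod>k\<in>UNIV. ker1 (\<beta> $ k) (cnj (w $ k)) (Complex (x $ k) (\<eta> $ k))
            * cnj (ker1 (\<alpha> $ k) (cnj (z $ k)) (Complex (x $ k) (\<eta> $ k)))) \<partial>lborel)"
      unfolding L2_inner_def slice_def using \<eta>
      by (intro Bochner_Integration.integral_cong refl) (simp add: phi_eq_prod_ker1 w z prod.distrib)
    also have "\<dots> = ?G \<eta>"
      by (subst integral_prod_vec[of "\<lambda>k t. ker1 (\<beta> $ k) (cnj (w $ k)) (Complex t (\<eta> $ k))
            * cnj (ker1 (\<alpha> $ k) (cnj (z $ k)) (Complex t (\<eta> $ k)))"])
        (simp_all only: ker1_inner[OF wp zp p])
    finally show "?G \<eta> = L2_inner (slice (phi \<beta> w) \<eta>) (slice (phi \<alpha> z) \<eta>)" by simp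
  qed simp
  have nz: "z $ k - cnj (w $ k) \<noteq> 0" for k
  proof
    assume "z $ k - cnj (w $ k) = 0"
    then have "Im (z $ k - cnj (w $ k)) = 0" by simp
    then show False using wp[of k] zp[of k] by simp
  qed
  have "(?G \<longlongrightarrow> (\<Prod>k\<in>UNIV. gram1 (\<beta> $ k) (w $ k + \<i> * of_real 0) (\<alpha> $ k) (z $ k + \<i> * of_real 0))) (at 0 within octant)"
    unfolding gram1_def by (intro tendsto_intros tendsto_nth_octant) (use nz in simp)
  then have "(?G \<longlongrightarrow> (\<Prod>k\<in>UNIV. gram1 (\<beta> $ k) (w $ k) (\<alpha> $ k) (z $ k))) (at 0 within octant)" by simp
  from Lim_transform_eventually[OF this ev]
  show "((\<lambda>\<eta>. L2_inner (slice (phi \<beta> w) \<eta>) (slice (phi \<alpha> z) \<eta>)) \<longlongrightarrow> (\<Prod>k\<in>UNIV. gram1 (\<beta> $ k) (w $ k) (\<alpha> $ k) (z $ k))) (at 0 within octant)" .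
qed

subsection \<open>The reproducing formula\<close>

text \<open>Multiplying the Cauchy kernel by \<open>reg s\<close>, which decays at infinity and tends to 1 as \<open>s\<close>
  tends to 0, makes it integrable against bounded functions.\<close>

definition reg :: "real \<Rightarrow> complex \<Rightarrow> complex" where
  "reg s t = 1 / (1 - \<i> * of_real s * t)"

lemma reg_denominator: "s > 0 \<Longrightarrow> 0 \<le> Im t \<Longrightarrow> 1 \<le> cmod (1 - \<i> * of_real s * t)"
proof -
  assume "s > 0" "0 \<le> Im t"
  then have "0 \<le> s * Im t" by simp
  moreover have "1 + s * Im t \<le> cmod (1 - \<i> * of_real s * t)"
    using complex_Re_le_cmod[of "1 - \<i> * of_real s * t"] by simp
  ultimately show ?thesis by linarith
qed

lemma norm_reg_le_1: "s > 0 \<Longrightarrow> 0 \<le> Im t \<Longrightarrow> cmod (reg s t) \<le> 1"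
  using reg_denominator[of s t] by (simp add: reg_def norm_divide divide_le_eq_1)

lemma norm_reg_decay:
  assumes "s > 0"
  shows "\<exists>K\<ge>0. \<forall>t. 0 \<le> Im t \<longrightarrow> cmod (reg s t) \<le> K / (1 + cmod t)"
proof -
  define b where "b = - \<i> / of_real s"
  define K where "K = 1 + (1 + cmod b) / \<bar>Im b\<bar>"
  have b: "Im b < 0" using assms by (simp add: b_def)
  have "cmod (reg s t) \<le> (1 / s * K) / (1 + cmod t)" if t: "0 \<le> Im t" for t
  proof -
    have "1 - \<i> * of_real s * t = - \<i> * of_real s * (t - b)"
      using assms by (simp add: b_def field_simps)
    then have "cmod (1 - \<i> * of_real s * t) = s * cmod (t - b)"
      using assms by (simp add: norm_mult)
    then have "cmod (reg s t) = 1 / s * (1 / cmod (t - b))"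
      by (simp add: reg_def norm_divide)
    also have "\<dots> \<le> 1 / s * (K / (1 + cmod t))"
      unfolding K_def using assms by (intro mult_left_mono inverse_below_bound b t) simp
    finally show ?thesis by simp
  qed
  moreover have "0 \<le> 1 / s * K" using assms by (simp add: K_def)
  ultimately show ?thesis by blast
qed

lemma reg_tendsto_1: "(\<lambda>n. reg (inverse (real (Suc n))) t) \<longlonglongrightarrow> 1"
proof -
  have "(\<lambda>n. 1 / (1 - \<i> * complex_of_real (inverse (real (Suc n))) * t)) \<longlonglongrightarrow> 1 / (1 - \<i> * complex_of_real 0 * t)"
    by (intro tendsto_intros LIMSEQ_inverse_real_of_nat) simp
  then show ?thesis by (simp add: reg_def)
qed

lemma integral_regularised_Cauchy_kernel:
  fixes g :: "complex \<Rightarrow> complex"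
  assumes \<epsilon>: "\<epsilon> > 0" and holo: "g holomorphic_on {\<zeta>. - \<epsilon> < Im \<zeta>}"
    and bd: "\<And>\<zeta>. 0 \<le> Im \<zeta> \<Longrightarrow> cmod (g \<zeta>) \<le> B"
    and p: "0 < Im p" and s: "s > 0"
  shows "integrable lborel (\<lambda>t. g (of_real t) * (reg s (of_real t) / (2 * pi * \<i> * (of_real t - p))))"
    and "(\<integral>t. g (of_real t) * (reg s (of_real t) / (2 * pi * \<i> * (of_real t - p))) \<partial>lborel) = reg s p * g p"
proof -
  have B: "0 \<le> B" using order_trans[OF norm_ge_zero bd[of 0]] by simp
  obtain K where K: "K \<ge> 0" "\<And>t. 0 \<le> Im t \<Longrightarrow> cmod (reg s t) \<le> K / (1 + cmod t)"
    using norm_reg_decay[OF s] by blast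
  \<comment> \<open>\<open>reg s\<close> has its pole at -i / s, which must stay outside the
    half-plane.\<close>
  define \<delta> where "\<delta> = min \<epsilon> (1 / s)"
  have \<delta>: "\<delta> > 0" using \<epsilon> s by (simp add: \<delta>_def)
  have ne: "1 - \<i> * of_real s * \<zeta> \<noteq> 0" if "- \<delta> < Im \<zeta>" for \<zeta>
  proof
    assume "1 - \<i> * of_real s * \<zeta> = 0"
    then have "Re (1 - \<i> * of_real s * \<zeta>) = 0" by simp
    then have "1 + s * Im \<zeta> = 0" by simp
    moreover have "- (1 / s) < Im \<zeta>" using that by (simp add: \<delta>_def)
    then have "s * (- (1 / s)) < s * Im \<zeta>" using s by (rule mult_strict_left_mono)
    ultimately show False using s by simp
  qed
  have h: "(\<lambda>\<zeta>. g \<zeta> * reg s \<zeta> / (2 * pi * \<i>)) holomorphic_on {\<zeta>. - \<delta> < Im \<zeta>}"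
    unfolding reg_def
    by (intro holomorphic_intros holomorphic_on_subset[OF holo]) (use ne in \<open>auto simp: \<delta>_def\<close>)
  have b: "cmod (g \<zeta> * reg s \<zeta> / (2 * pi * \<i>)) \<le> (B * K / (2 * pi)) / (1 + cmod \<zeta>)" if "0 \<le> Im \<zeta>" for \<zeta>
  proof -
    have "cmod (g \<zeta>) * cmod (reg s \<zeta>) \<le> B * (K / (1 + cmod \<zeta>))"
      using B by (intro mult_mono bd K(2) that) auto
    then have "cmod (g \<zeta>) * cmod (reg s \<zeta>) / (2 * pi) \<le> B * (K / (1 + cmod \<zeta>)) / (2 * pi)"
      by (intro divide_right_mono) auto
    then show ?thesis by (simp add: norm_mult norm_divide mult_ac)
  qed
  note C = integral_Cauchy_kernel[OF \<delta> h b p]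
  have eq: "g (of_real t) * (reg s (of_real t) / (2 * pi * \<i> * (of_real t - p)))
      = g (of_real t) * reg s (of_real t) / (2 * pi * \<i>) / (of_real t - p)" for t
    by simp
  show "integrable lborel (\<lambda>t. g (of_real t) * (reg s (of_real t) / (2 * pi * \<i> * (of_real t - p))))"
    unfolding eq by (rule C(1))
  show "(\<integral>t. g (of_real t) * (reg s (of_real t) / (2 * pi * \<i> * (of_real t - p))) \<partial>lborel) = reg s p * g p"
    by (simp only: eq C(2)) simp
qed

text \<open>On the slice of height \<eta> the conjugated kernel is the Cauchy kernel at p = w + i
  \<eta>, and the slice consists of the real values of f(\<zeta>) = F(\<zeta> + i \<eta>). Cauchy's
  formula in each variable evaluates f at p, which is why \<eta> is added twice.\<close>

lemma L2_inner_slice_kernel: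
  fixes F :: "complex^'n \<Rightarrow> complex"
  assumes F: "F \<in> H2" and w: "w \<in> tube" and \<eta>: "\<eta> \<in> octant"
  shows "L2_inner (slice F \<eta>) (slice (phi 0 w) \<eta>) = F (\<chi> k. w $ k + \<i> * (\<eta> $ k) + \<i> * (\<eta> $ k))"
proof -
  define p :: "complex^'n" where "p = (\<chi> k. w $ k + \<i> * (\<eta> $ k))"
  have wp: "0 < Im (w $ k)" for k using w by (simp add: tube_iff)
  have \<eta>p: "0 < \<eta> $ k" for k using \<eta> by (simp add: octant_def)
  have pp: "0 < Im (p $ k)" for k using wp[of k] \<eta>p[of k] by (simp add: p_def)
  \<comment> \<open>Half of the smallest height: \<open>f\<close> continues holomorphically below
    the real axis by this amount in each variable, while F is bounded at all heights from \<epsilon>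
    upwards.\<close>
  define \<epsilon> where "\<epsilon> = Min (range (($) \<eta>)) / 2"
  have "Min (range (($) \<eta>)) > 0" using \<eta>p by simp
  then have \<epsilon>: "\<epsilon> > 0" by (simp add: \<epsilon>_def)
  have \<epsilon>le: "2 * \<epsilon> \<le> \<eta> $ k" for k by (simp add: \<epsilon>_def)
  obtain B where B: "\<And>w. (\<forall>k. \<epsilon> \<le> Im ((w :: complex^'n) $ k)) \<Longrightarrow> cmod (F w) \<le> B"
    using H2_bounded[OF F \<epsilon>] by blast
  define f where "f \<zeta> = F (\<chi> k. \<zeta> $ k + \<i> * (\<eta> $ k))" for \<zeta> :: "complex^'n"
  have fB: "cmod (f \<zeta>) \<le> B" if "\<forall>k. 0 \<le> Im (\<zeta> $ k)" for \<zeta> :: "complex^'n"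
    unfolding f_def
  proof (rule B, intro allI)
    fix k show "\<epsilon> \<le> Im ((\<chi> k. \<zeta> $ k + \<i> * (\<eta> $ k)) $ k)"
      using that[rule_format, of k] \<epsilon>le[of k] \<epsilon> by simp
  qed
  have mixed_nonneg: "\<forall>k. 0 \<le> Im (mixed S p x $ k)" for S x
    using pp by (simp add: mixed_def less_imp_le)
  have fh: "(\<lambda>\<zeta>. f (upd m j \<zeta>)) holomorphic_on {\<zeta>. - \<epsilon> < Im \<zeta>}" if m: "\<forall>k. 0 \<le> Im (m $ k)" for m :: "complex^'n" and j
  proof -
    let ?u = "(\<chi> k. upd m j 0 $ k + \<i> * (\<eta> $ k)) :: complex^'n"
    have e: "f (upd m j \<zeta>) = F (\<chi> k. ?u $ k + \<zeta> * axis j 1 $ k)" for \<zeta>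
      unfolding f_def by (rule arg_cong[of _ _ F]) (simp add: vec_eq_iff axis_def)
    have "(\<lambda>\<zeta>. F (\<chi> k. ?u $ k + \<zeta> * axis j 1 $ k)) holomorphic_on {\<zeta>. (\<chi> k. ?u $ k + \<zeta> * axis j 1 $ k) \<in> tube}"
      by (rule holomorphic_on_line[OF H2_holomorphic[OF F]])
    then show ?thesis
      unfolding e
    proof (rule holomorphic_on_subset, intro subsetI CollectI)
      fix \<zeta> :: complex assume z: "\<zeta> \<in> {\<zeta>. - \<epsilon> < Im \<zeta>}"
      have 1: "0 < Im \<zeta> + \<eta> $ j" using z \<epsilon>le[of j] \<epsilon> by simp
      have 2: "0 < Im (m $ k) + \<eta> $ k" for k using m[rule_format, of k] \<eta>p[of k] by simp
      have "0 < Im (?u $ k + \<zeta> * axis j 1 $ k)" for k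
        using 1 2[of k] by (cases "k = j") (simp_all add: axis_def add.commute)
      then show "(\<chi> k. ?u $ k + \<zeta> * axis j 1 $ k) \<in> tube"
        unfolding tube_iff by simp
    qed
  qed
  have fm: "(\<lambda>x. f (mixed S p x)) \<in> borel_measurable borel" for S
  proof -
    have "continuous_on UNIV (\<lambda>x :: real^'n. if k \<in> S then p $ k else of_real (x $ k))" for k
      by (cases "k \<in> S") (auto intro!: continuous_intros)
    then have "continuous_on UNIV (\<lambda>x. mixed S p x)"
      unfolding mixed_def by (intro continuous_on_vec_lambda)
    then have "continuous_on UNIV (\<lambda>x. (\<chi> k. mixed S p x $ k + \<i> * (\<eta> $ k)))"
      by (intro continuous_intros)
    moreover have "(\<chi> k. mixed S p x $ k + \<i> * (\<eta> $ k)) \<in> tube" for x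
      using mixed_nonneg[of S x] \<eta>p by (simp add: tube_iff add_nonneg_pos)
    ultimately have "continuous_on UNIV (\<lambda>x. F (\<chi> k. mixed S p x $ k + \<i> * (\<eta> $ k)))"
      by (intro continuous_on_compose2[OF continuous_on_H2[OF F]]) auto
    then show ?thesis unfolding f_def by (rule borel_measurable_continuous_onI)
  qed
  have mixed0: "f (mixed {} p x) = slice F \<eta> x" for x
    unfolding f_def slice_def by (rule arg_cong[of _ _ F]) (simp add: vec_eq_iff mixed_def complex_eq_iff)
  let ?q = "\<lambda>s k t. reg s (of_real t) / (2 * pi * \<i> * (of_real t - p $ k))"
  have regularised: "(\<integral>x. slice F \<eta> x * (\<Prod>k\<in>UNIV. ?q s k (x $ k)) \<partial>lborel) = (\<Prod>k\<in>UNIV. reg s (p $ k)) * f p"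
    if s: "s > 0" for s
    unfolding mixed0[symmetric]
  proof (rule integral_iterated_kernel[OF fm])
    show "cmod (f (mixed S p x)) \<le> B" for S x by (rule fB[OF mixed_nonneg])
    show "integrable lborel (?q s k)" for k
      using integral_regularised_Cauchy_kernel(1)[of 1 "\<lambda>_. 1" 1 "p $ k" s] pp s by simp
    fix S :: "'n set" and j x assume j: "j \<notin> S"
    have 1: "mixed S p (upd x j t) = upd (mixed S p x) j (of_real t)" for t
      using j by (auto simp: vec_eq_iff mixed_def)
    have 2: "mixed (insert j S) p x = upd (mixed S p x) j (p $ j)"
      by (auto simp: vec_eq_iff mixed_def)
    have bd: "cmod (f (upd (mixed S p x) j \<zeta>)) \<le> B" if "0 \<le> Im \<zeta>" for \<zeta>
      using mixed_nonneg[of S x] that by (intro fB) auto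
    show "(\<integral>t. f (mixed S p (upd x j t)) * ?q s j t \<partial>lborel) = reg s (p $ j) * f (mixed (insert j S) p x)"
      unfolding 1 2 by (rule integral_regularised_Cauchy_kernel(2)[OF \<epsilon> fh[OF mixed_nonneg] bd pp s])
  qed
  \<comment> \<open>The unregularised integrand is integrable as a product of two square integrable
    slices, and it dominates the regularised ones because |reg| \<le> 1 on the real axis; so
    \<open>s\<close> may tend to 0.\<close>
  define G where "G x = slice F \<eta> x * cnj (slice (phi 0 w) \<eta> x)" for x
  have G: "integrable lborel G"
    unfolding G_def by (intro integrable_square_mult square_integrable_slice F phi_H2 w \<eta>)
  have Gq: "slice F \<eta> x * (\<Prod>k\<in>UNIV. ?q s k (x $ k)) = G x * (\<Prod>k\<in>UNIV. reg s (of_real (x $ k)))" for s x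
  proof -
    have "cnj (ker1 0 (cnj (w $ k)) (Complex (x $ k) (\<eta> $ k))) = 1 / (2 * pi * \<i> * (of_real (x $ k) - p $ k))" for k
    proof -
      have "cnj (Complex (x $ k) (\<eta> $ k) - cnj (w $ k)) = of_real (x $ k) - p $ k"
        by (simp add: p_def complex_eq_iff)
      moreover have "cnj (ker1 0 (cnj (w $ k)) (Complex (x $ k) (\<eta> $ k)))
          = cnj (- 1 / (2 * complex_of_real pi * \<i>)) * (1 / cnj (Complex (x $ k) (\<eta> $ k) - cnj (w $ k)))"
        by (simp add: ker1_def)
      moreover have "cnj (- 1 / (2 * complex_of_real pi * \<i>)) = 1 / (2 * pi * \<i>)" by simp
      ultimately show ?thesis by (simp only:) simp
    qed
    then have "cnj (slice (phi 0 w) \<eta> x) = (\<Prod>k\<in>UNIV. 1 / (2 * pi * \<i> * (of_real (x $ k) - p $ k)))"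
      using \<eta> by (simp add: slice_def phi_eq_prod_ker1 w)
    moreover have "(\<Prod>k\<in>UNIV. ?q s k (x $ k))
        = (\<Prod>k\<in>UNIV. (1 / (2 * pi * \<i> * (of_real (x $ k) - p $ k))) * reg s (of_real (x $ k)))"
      by (intro prod.cong) auto
    ultimately show ?thesis by (simp only: G_def prod.distrib mult.assoc)
  qed
  let ?s = "\<lambda>n. inverse (real (Suc n))"
  have "(\<lambda>n. \<integral>x. G x * (\<Prod>k\<in>UNIV. reg (?s n) (of_real (x $ k))) \<partial>lborel) \<longlonglongrightarrow> (\<integral>x. G x \<partial>lborel)"
  proof (rule integral_dominated_convergence[where w = "\<lambda>x. norm (G x)"])
    show "G \<in> borel_measurable lborel" using G by auto
    show "integrable lborel (\<lambda>x. norm (G x))" using G by (rule integrable_norm)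
    show "(\<lambda>x. G x * (\<Prod>k\<in>UNIV. reg (?s n) (of_real (x $ k)))) \<in> borel_measurable lborel" for n
    proof -
      have ne: "1 - \<i> * of_real (?s n) * complex_of_real u \<noteq> 0" for u
      proof
        assume "1 - \<i> * of_real (?s n) * complex_of_real u = 0"
        then show False using reg_denominator[of "?s n" "of_real u"] by (simp del: of_nat_Suc)
      qed
      have "continuous_on UNIV (\<lambda>x :: real^'n. \<Prod>k\<in>UNIV. reg (?s n) (of_real (x $ k)))"
        unfolding reg_def by (intro continuous_intros) (use ne in blast)
      from borel_measurable_continuous_onI[OF this] G show ?thesis by auto
    qed
    show "AE x in lborel. norm (G x * (\<Prod>k\<in>UNIV. reg (?s n) (of_real (x $ k)))) \<le> norm (G x)" for n
    proof (intro AE_I2)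
      fix x :: "real^'n"
      have "(\<Prod>k\<in>UNIV. cmod (reg (?s n) (of_real (x $ k)))) \<le> (\<Prod>k\<in>(UNIV :: 'n set). 1)"
        by (intro prod_mono conjI norm_ge_zero norm_reg_le_1) simp_all
      then show "norm (G x * (\<Prod>k\<in>UNIV. reg (?s n) (of_real (x $ k)))) \<le> norm (G x)"
        by (simp add: norm_mult prod_norm mult_left_le del: of_nat_Suc)
    qed
    show "AE x in lborel. (\<lambda>n. G x * (\<Prod>k\<in>UNIV. reg (?s n) (of_real (x $ k)))) \<longlonglongrightarrow> G x"
    proof (intro AE_I2)
      fix x :: "real^'n"
      have "(\<lambda>n. G x * (\<Prod>k\<in>UNIV. reg (?s n) (of_real (x $ k)))) \<longlonglongrightarrow> G x * (\<Prod>k\<in>(UNIV :: 'n set). 1)"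
        by (intro tendsto_intros reg_tendsto_1)
      then show "(\<lambda>n. G x * (\<Prod>k\<in>UNIV. reg (?s n) (of_real (x $ k)))) \<longlonglongrightarrow> G x" by simp
    qed
  qed
  then have "(\<lambda>n. (\<Prod>k\<in>UNIV. reg (?s n) (p $ k)) * f p) \<longlonglongrightarrow> (\<integral>x. G x \<partial>lborel)"
    unfolding Gq[symmetric] using regularised[of "?s _"] by simp
  moreover have "(\<lambda>n. (\<Prod>k\<in>UNIV. reg (?s n) (p $ k)) * f p) \<longlonglongrightarrow> (\<Prod>k\<in>(UNIV :: 'n set). 1) * f p"
    by (intro tendsto_intros reg_tendsto_1)
  ultimately have "(\<integral>x. G x \<partial>lborel) = f p" using LIMSEQ_unique by fastforce
  then show ?thesis by (simp add: L2_inner_def G_def f_def p_def)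
qed

theorem reproducing:
  fixes F :: "complex^'n \<Rightarrow> complex"
  assumes F: "F \<in> H2" and w: "w \<in> tube"
  shows "H2_inner F (phi 0 w) = F w"
proof (rule tendsto_unique[OF at_0_octant_neq_bot H2_inner_limit[OF F phi_H2[OF w]]])
  let ?p = "\<lambda>\<eta>::real^'n. (\<chi> k. w $ k + \<i> * (\<eta> $ k) + \<i> * (\<eta> $ k))"
  have "((\<lambda>\<eta>. w $ k + \<i> * of_real (\<eta> $ k) + \<i> * of_real (\<eta> $ k)) \<longlongrightarrow> w $ k + \<i> * of_real 0 + \<i> * of_real 0) (at 0 within octant)" for k
    by (intro tendsto_intros tendsto_nth_octant)
  then have "(?p \<longlongrightarrow> (\<chi> k. w $ k)) (at 0 within octant)"
    by (intro tendsto_vec_lambda) simp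
  moreover have "isCont F w"
    using continuous_on_H2[OF F] w continuous_on_eq_continuous_at[OF open_tube] by blast
  ultimately have lim: "((\<lambda>\<eta>. F (?p \<eta>)) \<longlongrightarrow> F w) (at 0 within octant)"
    by (intro isCont_tendsto_compose[of w F]) simp_all
  have "\<forall>\<^sub>F \<eta> in at 0 within octant. F (?p \<eta>) = L2_inner (slice F \<eta>) (slice (phi 0 w) \<eta>)"
    unfolding eventually_at_0_octant by (intro exI[of _ 1]) (simp add: L2_inner_slice_kernel[OF F w])
  from Lim_transform_eventually[OF lim this]
  show "((\<lambda>\<eta>. L2_inner (slice F \<eta>) (slice (phi 0 w) \<eta>)) \<longlongrightarrow> F w) (at 0 within octant)" .
qed

subsection \<open>Correlations of dictionary functions\<close>

definition norm1 :: "nat \<Rightarrow> real \<Rightarrow> real" where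
  "norm1 m y = fact (2 * m) / (2 * pi * (2 * y) ^ Suc (2 * m))"

lemma norm1_pos: "y > 0 \<Longrightarrow> norm1 m y > 0"
  by (simp add: norm1_def)

lemma gram1_self:
  assumes "0 < Im z"
  shows "gram1 m z m z = of_real (norm1 m (Im z))"
proof -
  define u where "u = (2 * complex_of_real (Im z)) ^ Suc (2 * m)"
  have u: "u \<noteq> 0" using assms by (simp add: u_def)
  have "z - cnj z = \<i> * (2 * of_real (Im z))" by (simp add: complex_eq_iff)
  then have d: "(z - cnj z) ^ Suc (m + m) = \<i> * ((-1) ^ m * u)"
    by (simp only: power_mult_distrib mult_2[symmetric] u_def) (simp add: power_mult)
  have "gram1 m z m z = \<i> / (2 * of_real pi) * (-1) ^ m * (fact (2 * m) / (\<i> * ((-1) ^ m * u)))"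
    unfolding gram1_def d by (simp only: mult_2)
  also have "\<dots> = ((-1) ^ m / (-1) ^ m) * (fact (2 * m) / (2 * of_real pi * u))"
    using u by (simp add: field_simps)
  also have "\<dots> = of_real (norm1 m (Im z))" by (simp add: norm1_def u_def)
  finally show ?thesis .
qed

lemma nsq_phi:
  fixes z :: "complex^'n"
  assumes z: "z \<in> tube"
  shows "H2.nsq (phi \<alpha> z) = (\<Prod>k\<in>UNIV. norm1 (\<alpha> $ k) (Im (z $ k)))"
proof -
  have "H2_inner (phi \<alpha> z) (phi \<alpha> z) = (\<Prod>k\<in>UNIV. of_real (norm1 (\<alpha> $ k) (Im (z $ k))))"
    unfolding phi_gram[OF z z] using z by (intro prod.cong refl gram1_self) (simp add: tube_iff)
  then show ?thesis by (simp add: H2.nsq_def of_real_prod[symmetric] del: of_real_prod)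
qed

lemma nsq_phi_pos: "z \<in> tube \<Longrightarrow> H2.nsq (phi \<alpha> z) > 0"
  unfolding nsq_phi by (intro prod_pos) (simp add: norm1_pos tube_iff)

text \<open>The summand 0 brings the multiple into the form F + c * G of the locale laws.\<close>

lemma psi_eq:
  assumes "z \<in> tube"
  shows "psi \<alpha> z = (\<lambda>w. 0 + of_real (1 / sqrt (H2.nsq (phi \<alpha> z))) * phi \<alpha> z w)"
  using phi_H2[OF assms] by (simp add: psi_def fun_eq_iff H2_norm_eq)

lemma psi_H2:
  assumes "z \<in> tube"
  shows "psi \<alpha> z \<in> H2"
  unfolding psi_eq[OF assms] by (intro H2.lin_closed H2.zero_mem[OF phi_H2[OF assms]] phi_H2 assms)

lemma H2_inner_psi_right:
  assumes "G \<in> H2" "z \<in> tube"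
  shows "H2_inner G (psi \<alpha> z) = H2_inner G (phi \<alpha> z) / of_real (sqrt (H2.nsq (phi \<alpha> z)))"
proof -
  have "H2_inner G (\<lambda>w. 0) = 0"
    using H2.ip_cnj[OF H2.zero_mem assms(1)] H2.ip_zero assms(1) by fastforce
  then show ?thesis
    unfolding psi_eq[OF assms(2)]
    using H2.ip_lin_right[OF H2.zero_mem[OF assms(1)] phi_H2[OF assms(2), of \<alpha>] assms(1)]
    by (simp add: divide_inverse)
qed

lemma H2_inner_psi_left:
  assumes "G \<in> H2" "z \<in> tube"
  shows "H2_inner (psi \<alpha> z) G = H2_inner (phi \<alpha> z) G / of_real (sqrt (H2.nsq (phi \<alpha> z)))"
  unfolding H2.ip_cnj[OF assms(1) psi_H2[OF assms(2)]] H2_inner_psi_right[OF assms]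
    H2.ip_cnj[OF assms(1) phi_H2[OF assms(2)]] by simp

lemma nsq_psi:
  assumes z: "z \<in> tube"
  shows "H2.nsq (psi \<alpha> z) = 1"
proof -
  define n where "n = H2.nsq (phi \<alpha> z)"
  have n: "n > 0" using nsq_phi_pos[OF z] by (simp add: n_def)
  have "H2_inner (psi \<alpha> z) (psi \<alpha> z) = of_real n / of_real (sqrt n) / of_real (sqrt n)"
    unfolding H2_inner_psi_left[OF psi_H2[OF z] z] H2_inner_psi_right[OF phi_H2[OF z] z]
      H2.ip_self[OF phi_H2[OF z]] n_def ..
  also have "\<dots> = of_real (n / sqrt n / sqrt n)" by (simp only: of_real_divide)
  also have "n / sqrt n / sqrt n = 1" using n by (simp add: real_div_sqrt)
  finally show ?thesis by (simp add: H2.nsq_def)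
qed

text \<open>The squared modulus of the inner product of two normalised one-variable functions.
  Squaring removes the square roots of the norms.\<close>

definition corr :: "nat \<Rightarrow> complex \<Rightarrow> nat \<Rightarrow> complex \<Rightarrow> real" where
  "corr b w a z = (cmod (gram1 b w a z))\<^sup>2 / (norm1 b (Im w) * norm1 a (Im z))"

lemma norm_inner_psi_psi:
  fixes w z :: "complex^'n"
  assumes w: "w \<in> tube" and z: "z \<in> tube"
  shows "(cmod (H2_inner (psi \<beta> w) (psi \<alpha> z)))\<^sup>2 = (\<Prod>k\<in>UNIV. corr (\<beta> $ k) (w $ k) (\<alpha> $ k) (z $ k))"
proof -
  have "H2_inner (psi \<beta> w) (psi \<alpha> z)
      = H2_inner (phi \<beta> w) (phi \<alpha> z) / of_real (sqrt (H2.nsq (phi \<beta> w)) * sqrt (H2.nsq (phi \<alpha> z)))"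
    unfolding H2_inner_psi_left[OF psi_H2[OF z] w] H2_inner_psi_right[OF phi_H2[OF w] z] by simp
  then have "(cmod (H2_inner (psi \<beta> w) (psi \<alpha> z)))\<^sup>2
      = (cmod (H2_inner (phi \<beta> w) (phi \<alpha> z)))\<^sup>2 / (H2.nsq (phi \<beta> w) * H2.nsq (phi \<alpha> z))"
    using nsq_phi_pos[OF w, of \<beta>] nsq_phi_pos[OF z, of \<alpha>]
    by (simp add: norm_divide norm_mult power_divide power_mult_distrib)
  also have "\<dots> = (\<Prod>k\<in>UNIV. corr (\<beta> $ k) (w $ k) (\<alpha> $ k) (z $ k))"
    unfolding phi_gram[OF w z] nsq_phi[OF w] nsq_phi[OF z] corr_def
    by (simp add: prod_norm[symmetric] prod_power_distrib prod_dividef prod.distrib)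
  finally show ?thesis .
qed

text \<open>The Wallis-type bound 4^n / (2 sqrt n) for the central binomial coefficient from below,
  squared so that it becomes an inequality free of roots. The induction step comes down to 4 n (n +
  1) \<le> (2 n + 1)^2.\<close>

lemma sixteen_power_le: "n \<ge> 1 \<Longrightarrow> 16 ^ n * (fact n) ^ 4 \<le> 4 * real n * (fact (2 * n))\<^sup>2"
proof (induction n rule: nat_induct_at_least)
  case base
  show ?case by (simp add: fact_numeral)
next
  case (Suc n)
  let ?f = "fact n :: real" and ?g = "fact (2 * n) :: real"
  have "16 ^ Suc n * (fact (Suc n)) ^ 4 = 16 * (real n + 1) ^ 4 * (16 ^ n * ?f ^ 4)"
    by (simp add: power_mult_distrib add.commute)
  also have "\<dots> \<le> 16 * (real n + 1) ^ 4 * (4 * real n * ?g\<^sup>2)"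
    by (intro mult_left_mono Suc.IH) auto
  also have "\<dots> = 16 * (real n + 1) ^ 3 * ?g\<^sup>2 * (4 * real n * (real n + 1))"
    by (simp add: power_numeral_reduce)
  also have "\<dots> \<le> 16 * (real n + 1) ^ 3 * ?g\<^sup>2 * (2 * real n + 1)\<^sup>2"
    by (intro mult_left_mono) (auto simp: power2_eq_square algebra_simps)
  also have "\<dots> = 4 * (real n + 1) * ((2 * real n + 2) * (2 * real n + 1) * ?g)\<^sup>2"
    by (simp add: power_numeral_reduce algebra_simps)
  also have "(2 * real n + 2) * (2 * real n + 1) * ?g = fact (2 * Suc n)"
    by (simp add: algebra_simps)
  finally show ?case by (simp add: add.commute)
qed

section \<open>Decay of correlations as the parameters leave compact sets\<close>

lemma corr_eq:
  assumes w: "0 < Im w" and z: "0 < Im z"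
  shows "corr b w a z = (fact (a + b))\<^sup>2 / (fact (2 * a) * fact (2 * b))
    * ((2 * Im z) ^ Suc (2 * a) * (2 * Im w) ^ Suc (2 * b) / cmod (z - cnj w) ^ (Suc (2 * a) + Suc (2 * b)))"
proof -
  have "(cmod (gram1 b w a z))\<^sup>2 = (1 / (2 * pi) * (fact (b + a) / cmod (z - cnj w) ^ Suc (b + a)))\<^sup>2"
    unfolding gram1_def by (simp add: norm_mult norm_divide norm_power)
  also have "\<dots> = 1 / (2 * pi)\<^sup>2 * ((fact (a + b))\<^sup>2 / cmod (z - cnj w) ^ (Suc (2 * a) + Suc (2 * b)))"
  proof -
    have "(cmod (z - cnj w) ^ Suc (b + a))\<^sup>2 = cmod (z - cnj w) ^ (Suc (2 * a) + Suc (2 * b))"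
      unfolding power_mult[symmetric] by (rule arg_cong[of _ _ "(^) _"]) simp
    then show ?thesis by (simp only: power_mult_distrib power_divide power_one add.commute[of b a])
  qed
  finally have g: "(cmod (gram1 b w a z))\<^sup>2 = 1 / (2 * pi)\<^sup>2 * ((fact (a + b))\<^sup>2 / cmod (z - cnj w) ^ (Suc (2 * a) + Suc (2 * b)))" .
  have alg: "1 / p\<^sup>2 * (x / d) / (fb / (p * v) * (fa / (p * y))) = x / (fa * fb) * (y * v / d)"
    if "p \<noteq> 0" for p x d fa fb v y :: real
    using that by (simp add: power2_eq_square mult_ac)
  show ?thesis unfolding corr_def g norm1_def by (rule alg) simp
qed

lemma corr_nonneg: "0 < Im w \<Longrightarrow> 0 < Im z \<Longrightarrow> 0 \<le> corr b w a z"
  by (simp add: corr_def norm1_pos less_imp_le)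

lemma sum_Im_le_dist: "Im z + Im w \<le> cmod (z - cnj w)"
  using abs_Im_le_cmod[of "z - cnj w"] by simp

text \<open>Uniform in \<open>z\<close>: one term of the binomial expansion of \<open>(y + v)\<close> to the power \<open>2a + 2b + 2\<close> bounds
  the geometric factor, and Wallis' estimate bounds the remaining factorials.\<close>

lemma corr_le_index:
  assumes w: "0 < Im w" and z: "0 < Im z"
  shows "corr b w a z \<le> 4 * (2 * real b + 1) / sqrt (real a + 1)"
proof -
  define y v d where "y = Im z" and "v = Im w" and "d = cmod (z - cnj w)"
  have yv: "y > 0" "v > 0" "y + v \<le> d" using w z sum_Im_le_dist[of z w] by (simp_all add: y_def v_def d_def)
  define A B n where "A = Suc (2 * a)" and "B = Suc (2 * b)" and "n = Suc (a + b)"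
  have AB: "A + B = 2 * n" by (simp add: A_def B_def n_def)
  have d: "d > 0" using yv by linarith
  have "real ((A + B) choose A) * y ^ A * v ^ B \<le> (\<Sum>k\<le>A + B. real ((A + B) choose k) * y ^ k * v ^ (A + B - k))"
    using member_le_sum[of A "{..A + B}" "\<lambda>k. real ((A + B) choose k) * y ^ k * v ^ (A + B - k)"] yv by simp
  also have "\<dots> = (y + v) ^ (A + B)" by (rule binomial_ring[symmetric])
  also have "\<dots> \<le> d ^ (A + B)" using yv by (intro power_mono) auto
  finally have "real ((A + B) choose A) * (y ^ A * v ^ B) \<le> d ^ (A + B)" by (simp add: mult.assoc)
  moreover have "real ((A + B) choose A) = fact (A + B) / (fact A * fact B)"
    by (simp add: binomial_fact)
  ultimately have "fact (A + B) * (y ^ A * v ^ B) \<le> fact A * fact B * d ^ (A + B)"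
    by (simp add: field_simps)
  then have geo: "y ^ A * v ^ B / d ^ (A + B) \<le> fact A * fact B / fact (2 * n)"
    using d by (simp add: divide_le_eq le_divide_eq AB mult_ac)
  have n: "n \<ge> 1" "real n > 0" by (simp_all add: n_def)
  have wallis: "4 ^ n * (fact n)\<^sup>2 \<le> 2 * sqrt (real n) * fact (2 * n)"
  proof (rule power2_le_imp_le)
    have "(4::real) ^ n * 4 ^ n = 16 ^ n" by (simp flip: power_mult_distrib)
    then have "(4 ^ n * (fact n)\<^sup>2)\<^sup>2 = 16 ^ n * ((fact n :: real)) ^ 4"
      by (simp add: power2_eq_square power4_eq_xxxx)
    also have "\<dots> \<le> 4 * real n * (fact (2 * n))\<^sup>2" by (rule sixteen_power_le[OF n(1)])
    also have "\<dots> = (2 * sqrt (real n) * fact (2 * n))\<^sup>2" by (simp add: power_mult_distrib)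
    finally show "(4 ^ n * (fact n)\<^sup>2)\<^sup>2 \<le> (2 * sqrt (real n) * fact (2 * n))\<^sup>2" .
  qed simp
  have "corr b w a z = (fact (a + b))\<^sup>2 / (fact (2 * a) * fact (2 * b)) * (2 ^ (A + B) * (y ^ A * v ^ B / d ^ (A + B)))"
    unfolding corr_eq[OF w z] A_def[symmetric] B_def[symmetric] y_def[symmetric] v_def[symmetric] d_def[symmetric]
    by (simp add: power_mult_distrib power_add mult_ac)
  also have "\<dots> \<le> (fact (a + b))\<^sup>2 / (fact (2 * a) * fact (2 * b)) * (2 ^ (A + B) * (fact A * fact B / fact (2 * n)))"
    by (intro mult_left_mono geo) auto
  \<comment> \<open>The quotients (2a+1)! / (2a)! and (2b+1)! / (2b)! leave the factors 2a + 1 and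
    2b + 1. The first is at most 2n, and together with the Wallis factor it leaves the order 1 /
    sqrt n.\<close>
  also have "\<dots> = (fact (a + b))\<^sup>2 * (2 * real a + 1) * (2 * real b + 1) * (4 ^ n / fact (2 * n))"
    unfolding AB by (simp add: A_def B_def power_mult add.commute)
  also have "4 ^ n / fact (2 * n) \<le> 2 * sqrt (real n) / (fact n)\<^sup>2"
    using wallis by (simp add: divide_le_eq le_divide_eq mult_ac)
  also have "(fact (a + b))\<^sup>2 * (2 * real a + 1) * (2 * real b + 1) * (2 * sqrt (real n) / (fact n)\<^sup>2)
      = (2 * real a + 1) * (2 * real b + 1) * (2 * sqrt (real n) / (real n)\<^sup>2)"
    by (simp add: n_def power_mult_distrib)
  also have "\<dots> \<le> (2 * real n) * (2 * real b + 1) * (2 * sqrt (real n) / (real n)\<^sup>2)"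
    by (intro mult_right_mono) (auto simp: n_def)
  also have "\<dots> = 4 * (2 * real b + 1) * (real n * sqrt (real n) / (real n)\<^sup>2)" by simp
  also have "real n * sqrt (real n) / (real n)\<^sup>2 = 1 / sqrt (real n)"
  proof -
    have "real n = sqrt (real n) * sqrt (real n)" using n by simp
    then show ?thesis using n by (simp add: power2_eq_square field_simps)
  qed
  also have "4 * (2 * real b + 1) * (1 / sqrt (real n)) \<le> 4 * (2 * real b + 1) * (1 / sqrt (real a + 1))"
    by (intro mult_left_mono divide_left_mono) (auto simp: n_def)
  finally show ?thesis by (simp add: mult_left_mono mult_right_mono)
qed

lemma corr_le_bound:
  assumes w: "0 < Im w" and z: "0 < Im z"
  shows "corr b w a z \<le> 4 * (2 * real b + 1)"
proof -
  have "4 * (2 * real b + 1) / sqrt (real a + 1) \<le> 4 * (2 * real b + 1) / 1"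
    by (intro divide_left_mono) auto
  with corr_le_index[OF w z, of b a] show ?thesis by simp
qed

text \<open>Complements \<open>corr_le_index\<close> for fixed indices: one power of y/d and one of
  v/d are kept, the others are at most 1. The remaining y v / d^2 becomes small as z approaches the
  boundary or infinity.\<close>

lemma corr_le_point:
  assumes w: "0 < Im w" and z: "0 < Im z"
  shows "corr b w a z \<le> (fact (a + b))\<^sup>2 / (fact (2 * a) * fact (2 * b)) * 2 ^ (2 * (a + b + 1))
    * (Im z * Im w / (cmod (z - cnj w))\<^sup>2)"
proof -
  define y v d where "y = Im z" and "v = Im w" and "d = cmod (z - cnj w)"
  have yv: "y > 0" "v > 0" "y + v \<le> d" using w z sum_Im_le_dist[of z w] by (simp_all add: y_def v_def d_def)
  then have d: "d > 0" "y \<le> d" "v \<le> d" by linarith+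
  have "(2 * y) ^ Suc (2 * a) * (2 * v) ^ Suc (2 * b) / d ^ (Suc (2 * a) + Suc (2 * b))
      = 2 ^ (2 * (a + b + 1)) * (y * v / d\<^sup>2) * ((y / d) ^ (2 * a) * (v / d) ^ (2 * b))"
    by (simp add: power_mult_distrib power_divide power_add power2_eq_square mult_ac)
  also have "\<dots> \<le> 2 ^ (2 * (a + b + 1)) * (y * v / d\<^sup>2) * (1 * 1)"
    using yv d by (intro mult_left_mono mult_mono power_le_one) auto
  finally have "(2 * y) ^ Suc (2 * a) * (2 * v) ^ Suc (2 * b) / d ^ (Suc (2 * a) + Suc (2 * b)) \<le> 2 ^ (2 * (a + b + 1)) * (y * v / d\<^sup>2)"
    by simp
  then have "(fact (a + b))\<^sup>2 / (fact (2 * a) * fact (2 * b)) * ((2 * y) ^ Suc (2 * a) * (2 * v) ^ Suc (2 * b) / d ^ (Suc (2 * a) + Suc (2 * b)))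
    \<le> (fact (a + b))\<^sup>2 / (fact (2 * a) * fact (2 * b)) * (2 ^ (2 * (a + b + 1)) * (y * v / d\<^sup>2))"
    by (intro mult_left_mono) auto
  then show ?thesis unfolding corr_eq[OF w z] y_def v_def d_def by (simp only: mult.assoc)
qed

text \<open>For growing R these boxes exhaust the pairs of an index and a point of the upper
  half-plane by compact sets; the bound \<open>inverse R\<close> keeps away from the real
  axis.\<close>

definition param_box :: "real \<Rightarrow> nat \<Rightarrow> complex \<Rightarrow> bool" where
  "param_box R a z \<longleftrightarrow> real a \<le> R \<and> \<bar>Re z\<bar> \<le> R \<and> inverse R \<le> Im z \<and> Im z \<le> R"

lemma param_box_mono:
  assumes "param_box R a z" "0 < R" "R \<le> R'"
  shows "param_box R' a z"
proof -
  have "inverse R' \<le> inverse R" using assms by (intro le_imp_inverse_le)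
  with assms show ?thesis unfolding param_box_def by (meson order_trans)
qed

text \<open>The order matters: \<open>corr_le_index\<close> bounds the index whatever z is, which
  leaves finitely many constants in \<open>corr_le_point\<close>; with a common constant C, the
  inequality e d^2 < C y v then confines z.\<close>

lemma corr_small_outside_box:
  assumes w: "0 < Im w" and e: "e > 0"
  shows "\<exists>R>0. \<forall>a z. 0 < Im z \<longrightarrow> e < corr b w a z \<longrightarrow> param_box R a z"
proof -
  define u v where "u = Re w" and "v = Im w"
  have v: "v > 0" using w by (simp add: v_def)
  define M where "M = (4 * (2 * real b + 1) / e)\<^sup>2"
  have index: "real a \<le> M" if "0 < Im z" "e < corr b w a z" for a z
  proof -
    have "e < 4 * (2 * real b + 1) / sqrt (real a + 1)"
      using corr_le_index[OF w that(1), of b a] that(2) by linarith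
    then have "sqrt (real a + 1) \<le> 4 * (2 * real b + 1) / e"
      using e by (simp add: field_simps)
    then have "(sqrt (real a + 1))\<^sup>2 \<le> M" unfolding M_def by (intro power_mono) auto
    then show ?thesis by simp
  qed
  define c :: "nat \<Rightarrow> real" where "c a = (fact (a + b))\<^sup>2 / (fact (2 * a) * fact (2 * b)) * (2::real) ^ (2 * (a + b + 1))" for a :: nat
  have cpos: "c a \<ge> 0" for a by (simp add: c_def)
  define C where "C = 1 + (\<Sum>a\<le>nat \<lfloor>M\<rfloor>. c a)"
  have C: "C > 0" unfolding C_def using sum_nonneg[of "{..nat \<lfloor>M\<rfloor>}" c] cpos by (simp add: add_pos_nonneg)
  have cC: "c a \<le> C" if "real a \<le> M" for a
  proof -
    have "a \<in> {..nat \<lfloor>M\<rfloor>}" using that by (simp add: le_nat_floor)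
    then have "c a \<le> (\<Sum>a\<le>nat \<lfloor>M\<rfloor>. c a)" using cpos by (intro member_le_sum) auto
    then show ?thesis by (simp add: C_def)
  qed
  \<comment> \<open>The sum of all bounds below: M for the index, |u| + C v / e for the real part, C
    v / e for the imaginary part and C / (e v) for its inverse.\<close>
  define R where "R = M + (\<bar>u\<bar> + C * v / e) + C / (e * v)"
  have terms: "0 \<le> M" "0 < C * v / e" "0 < C / (e * v)" using C v e by (simp_all add: M_def)
  have R: "R > 0" using terms abs_ge_zero[of u] unfolding R_def by linarith
  have "param_box R a z" if z: "0 < Im z" "e < corr b w a z" for a z
  proof -
    define x y where "x = Re z" and "y = Im z"
    have y: "y > 0" using z by (simp add: y_def)
    have d2: "(cmod (z - cnj w))\<^sup>2 = (x - u)\<^sup>2 + (y + v)\<^sup>2"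
      by (simp add: cmod_power2 x_def y_def u_def v_def)
    have D: "(x - u)\<^sup>2 + (y + v)\<^sup>2 > 0" using y v by (intro add_nonneg_pos) auto
    have "e < c a * (y * v / ((x - u)\<^sup>2 + (y + v)\<^sup>2))"
      using corr_le_point[OF w z(1), of b a] z(2) unfolding c_def[symmetric] d2 y_def[symmetric] v_def[symmetric] by linarith
    also have "\<dots> \<le> C * (y * v / ((x - u)\<^sup>2 + (y + v)\<^sup>2))"
      using D y v by (intro mult_right_mono cC[OF index[OF z]]) auto
    finally have main: "e * ((x - u)\<^sup>2 + (y + v)\<^sup>2) < C * y * v"
      using D by (simp add: field_simps)
    have "y\<^sup>2 \<le> (y + v)\<^sup>2" "v\<^sup>2 \<le> (y + v)\<^sup>2" using y v by (intro power_mono; simp)+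
    then have sq: "y\<^sup>2 \<le> (x - u)\<^sup>2 + (y + v)\<^sup>2" "v\<^sup>2 \<le> (x - u)\<^sup>2 + (y + v)\<^sup>2"
      using zero_le_power2[of "x - u"] by linarith+
    have "e * y\<^sup>2 \<le> e * ((x - u)\<^sup>2 + (y + v)\<^sup>2)" using e by (intro mult_left_mono sq) auto
    with main have "y * (e * y) < y * (C * v)" by (simp add: power2_eq_square mult_ac)
    then have "e * y < C * v" using y by simp
    then have y1: "y < C * v / e" using e by (simp add: field_simps)
    have "e * v\<^sup>2 \<le> e * ((x - u)\<^sup>2 + (y + v)\<^sup>2)" using e by (intro mult_left_mono sq) auto
    with main have "v * (e * v) < v * (C * y)" by (simp add: power2_eq_square mult_ac)
    then have "e * v < C * y" using v by simp
    then have y2: "inverse y < C / (e * v)" using e y v C by (simp add: field_simps)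
    have "e * (x - u)\<^sup>2 \<le> e * ((x - u)\<^sup>2 + (y + v)\<^sup>2)" using e by (intro mult_left_mono) auto
    with main have "e * (x - u)\<^sup>2 < C * v * y" by (simp add: mult_ac)
    also have "\<dots> \<le> C * v * (C * v / e)" using y1 C v by (intro mult_left_mono) auto
    finally have "(x - u)\<^sup>2 \<le> (C * v / e)\<^sup>2" using e by (simp add: field_simps power2_eq_square)
    then have "\<bar>x - u\<bar> \<le> C * v / e" using terms by (simp add: abs_le_square_iff[symmetric])
    then have x1: "\<bar>x\<bar> \<le> \<bar>u\<bar> + C * v / e" by linarith
    have "inverse R \<le> y"
    proof -
      have "inverse y \<le> R" using y2 terms abs_ge_zero[of u] unfolding R_def by linarith
      from le_imp_inverse_le[OF this] show ?thesis using y by simp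
    qed
    moreover have "y \<le> R" using y1 terms abs_ge_zero[of u] unfolding R_def by linarith
    moreover have "\<bar>x\<bar> \<le> R" using x1 terms unfolding R_def by linarith
    moreover have "real a \<le> R" using index[OF z] terms abs_ge_zero[of u] unfolding R_def by linarith
    ultimately show ?thesis by (simp add: param_box_def x_def y_def)
  qed
  with R show ?thesis by blast
qed

text \<open>The correlation is a product over coordinates, and leaving the box in one coordinate
  makes one factor small. The other factors are bounded by \<open>corr_le_bound\<close>, hence the
  threshold e / M for the small one.\<close>

lemma inner_psi_small_outside_box:
  fixes w :: "complex^'n"
  assumes w: "w \<in> tube" and e: "e > 0"
  shows "\<exists>R>0. \<forall>\<alpha> z. z \<in> tube \<longrightarrow> \<not> (\<forall>k. param_box R (\<alpha> $ k) (z $ k)) \<longrightarrow>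
    (cmod (H2_inner (psi \<beta> w) (psi \<alpha> z)))\<^sup>2 \<le> e"
proof -
  have wp: "0 < Im (w $ k)" for k using w by (simp add: tube_iff)
  define M where "M = (\<Prod>k\<in>UNIV. 4 * (2 * real (\<beta> $ k) + 1))"
  have M: "M > 0" unfolding M_def by (intro prod_pos) simp
  have "\<forall>k. \<exists>R>0. \<forall>a z. 0 < Im z \<longrightarrow> e / M < corr (\<beta> $ k) (w $ k) a z \<longrightarrow> param_box R a z"
    using corr_small_outside_box[OF wp, of "e / M"] M e by simp
  then obtain R where R: "\<And>k. R k > 0"
    "\<And>k a z. 0 < Im z \<Longrightarrow> e / M < corr (\<beta> $ k) (w $ k) a z \<Longrightarrow> param_box (R k) a z" by metis
  define S where "S = Max (range R)"
  have S: "R k \<le> S" for k by (simp add: S_def)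
  have Spos: "S > 0" using R(1) S less_le_trans by blast
  have "(cmod (H2_inner (psi \<beta> w) (psi \<alpha> z)))\<^sup>2 \<le> e"
    if z: "z \<in> tube" and out: "\<not> (\<forall>k. param_box S (\<alpha> $ k) (z $ k))" for \<alpha> and z :: "complex^'n"
  proof -
    have zp: "0 < Im (z $ k)" for k using z by (simp add: tube_iff)
    let ?c = "\<lambda>k. corr (\<beta> $ k) (w $ k) (\<alpha> $ k) (z $ k)"
    obtain j where j: "\<not> param_box S (\<alpha> $ j) (z $ j)" using out by blast
    then have cj: "?c j \<le> e / M"
      using R(2)[OF zp, of j "\<alpha> $ j"] param_box_mono[OF _ R(1) S] by (meson not_le)
    have "(cmod (H2_inner (psi \<beta> w) (psi \<alpha> z)))\<^sup>2 = ?c j * (\<Prod>k\<in>UNIV - {j}. ?c k)"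
      unfolding norm_inner_psi_psi[OF w z] by (rule prod.remove) auto
    also have "\<dots> \<le> e / M * (\<Prod>k\<in>UNIV - {j}. 4 * (2 * real (\<beta> $ k) + 1))"
      using cj e M by (intro mult_mono prod_mono conjI corr_nonneg corr_le_bound wp zp prod_nonneg) auto
    also have "\<dots> \<le> e / M * M"
    proof (intro mult_left_mono)
      have "1 * (\<Prod>k\<in>UNIV - {j}. 4 * (2 * real (\<beta> $ k) + 1)) \<le> (4 * (2 * real (\<beta> $ j) + 1)) * (\<Prod>k\<in>UNIV - {j}. 4 * (2 * real (\<beta> $ k) + 1))"
        by (intro mult_right_mono prod_nonneg) auto
      also have "\<dots> = M" unfolding M_def by (rule prod.remove[symmetric]) auto
      finally show "(\<Prod>k\<in>UNIV - {j}. 4 * (2 * real (\<beta> $ k) + 1)) \<le> M" by simp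
    qed (use e M in simp)
    finally show ?thesis using M by simp
  qed
  with Spos show ?thesis by blast
qed

subsection \<open>Existence of optimal parameters\<close>

lemma inner_psi_vanishes:
  fixes G :: "complex^'n \<Rightarrow> complex"
  assumes G: "G \<in> H2" and e: "e > 0"
  shows "\<exists>R>0. \<forall>\<alpha> z. z \<in> tube \<longrightarrow> e \<le> cmod (H2_inner G (psi \<alpha> z)) \<longrightarrow> (\<forall>k. param_box R (\<alpha> $ k) (z $ k))"
proof (rule ccontr)
  assume "\<not> ?thesis"
  then have no: "\<not> (\<forall>\<alpha> z. z \<in> tube \<longrightarrow> e \<le> cmod (H2_inner G (psi \<alpha> z)) \<longrightarrow> (\<forall>k. param_box R (\<alpha> $ k) (z $ k)))"
    if "R > 0" for R using that by blast
  have "\<forall>n. \<exists>\<alpha> z. z \<in> tube \<and> e \<le> cmod (H2_inner G (psi \<alpha> z)) \<and> \<not> (\<forall>k. param_box (real (Suc n)) (\<alpha> $ k) (z $ k))"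
    using no[of "real (Suc _)"] by (simp del: of_nat_Suc)
  then obtain \<alpha> z where z: "\<And>n. z n \<in> tube" and big: "\<And>n. e \<le> cmod (H2_inner G (psi (\<alpha> n) (z n)))"
    and out: "\<And>n. \<not> (\<forall>k. param_box (real (Suc n)) (\<alpha> n $ k) (z n $ k))" by metis
  have "(\<lambda>n. H2_inner G (psi (\<alpha> n) (z n))) \<longlonglongrightarrow> 0"
  proof (rule H2.almost_orthogonal_imp_weakly_null)
    show "psi (\<alpha> n) (z n) \<in> H2" "H2.nsq (psi (\<alpha> n) (z n)) = 1" for n
      by (rule psi_H2[OF z] nsq_psi[OF z])+
    show "(\<lambda>n. H2_inner (psi (\<alpha> i) (z i)) (psi (\<alpha> n) (z n))) \<longlonglongrightarrow> 0" for i
    proof (rule LIMSEQ_I)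
      fix r :: real assume r: "r > 0"
      obtain R where R: "R > 0" "\<And>\<beta> \<zeta>. \<zeta> \<in> tube \<Longrightarrow> \<not> (\<forall>k. param_box R (\<beta> $ k) (\<zeta> $ k)) \<Longrightarrow>
          (cmod (H2_inner (psi (\<alpha> i) (z i)) (psi \<beta> \<zeta>)))\<^sup>2 \<le> (r / 2)\<^sup>2"
        using inner_psi_small_outside_box[OF z[of i], of "(r / 2)\<^sup>2" "\<alpha> i"] r by auto
      obtain N :: nat where N: "R \<le> real N" using real_arch_simple by blast
      have "norm (H2_inner (psi (\<alpha> i) (z i)) (psi (\<alpha> n) (z n)) - 0) < r" if "n \<ge> N" for n
      proof -
        have "\<not> (\<forall>k. param_box R (\<alpha> n $ k) (z n $ k))"
          using out[of n] param_box_mono[OF _ R(1), of _ _ "real (Suc n)"] N that by fastforce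
        from R(2)[OF z this] have "cmod (H2_inner (psi (\<alpha> i) (z i)) (psi (\<alpha> n) (z n))) \<le> r / 2"
          by (rule power2_le_imp_le) (use r in simp)
        then show ?thesis using r by simp
      qed
      then show "\<exists>no. \<forall>n\<ge>no. norm (H2_inner (psi (\<alpha> i) (z i)) (psi (\<alpha> n) (z n)) - 0) < r" by blast
    qed
  qed (rule G)
  from LIMSEQ_D[OF this e] obtain n where "cmod (H2_inner G (psi (\<alpha> n) (z n))) < e" by auto
  then show False using big[of n] by simp
qed

text \<open>By Cauchy-Schwarz it suffices that z -> phi \<alpha> z is continuous in norm; the
  squared distance of two such functions is an explicit continuous expression in norms and
  \<open>gram1\<close>.\<close>

lemma continuous_on_inner_psi:
  fixes G :: "complex^'n \<Rightarrow> complex"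
  assumes G: "G \<in> H2"
  shows "continuous_on tube (\<lambda>z. cmod (H2_inner G (psi \<alpha> z)))"
proof -
  have ne: "z $ k - cnj (w $ k) \<noteq> 0" if "z \<in> tube" "w \<in> tube" for z w :: "complex^'n" and k
  proof
    assume "z $ k - cnj (w $ k) = 0"
    then have "Im (z $ k - cnj (w $ k)) = 0" by simp
    moreover have "0 < Im (z $ k)" "0 < Im (w $ k)" using that by (simp_all add: tube_iff)
    ultimately show False by simp
  qed
  have nz: "Im (z $ k) \<noteq> 0" if "z \<in> tube" for z :: "complex^'n" and k
    using that[unfolded tube_iff, rule_format, of k] by simp
  have nsq_cont: "continuous_on tube (\<lambda>z. H2.nsq (phi \<alpha> z))"
  proof -
    have "continuous_on tube (\<lambda>z :: complex^'n. \<Prod>k\<in>UNIV. norm1 (\<alpha> $ k) (Im (z $ k)))"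
      unfolding norm1_def by (intro continuous_intros) (simp_all add: nz)
    then show ?thesis by (rule continuous_on_eq) (simp add: nsq_phi)
  qed
  have "continuous_on tube (\<lambda>z. H2_inner G (phi \<alpha> z))"
    unfolding continuous_on_def
  proof
    fix z :: "complex^'n" assume z: "z \<in> tube"
    define D where "D w = H2.nsq (phi \<alpha> w) + H2.nsq (phi \<alpha> z)
      - 2 * Re (\<Prod>k\<in>UNIV. gram1 (\<alpha> $ k) (w $ k) (\<alpha> $ k) (z $ k))" for w
    have D: "H2.nsq (\<lambda>x. phi \<alpha> w x + (-1) * phi \<alpha> z x) = D w" if "w \<in> tube" for w
      unfolding H2.nsq_lin[OF phi_H2[OF that] phi_H2[OF z]] phi_gram[OF that z] by (simp add: D_def)
    have "continuous_on tube D"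
      unfolding D_def gram1_def using ne z by (intro continuous_intros nsq_cont) auto
    then have "(D \<longlongrightarrow> D z) (at z within tube)" using z by (simp add: continuous_on_def)
    moreover have "D z = 0"
      using H2.ip_self[OF phi_H2[OF z, of \<alpha>]] by (simp add: D_def phi_gram[OF z z, symmetric])
    ultimately have "((\<lambda>w. sqrt (H2.nsq G * D w)) \<longlongrightarrow> sqrt (H2.nsq G * 0)) (at z within tube)"
      by (intro tendsto_intros) simp
    then have lim: "((\<lambda>w. sqrt (H2.nsq G * D w)) \<longlongrightarrow> 0) (at z within tube)" by simp
    have "((\<lambda>w. H2_inner G (phi \<alpha> w) - H2_inner G (phi \<alpha> z)) \<longlongrightarrow> 0) (at z within tube)"
    proof (rule Lim_null_comparison[OF _ lim])
      have "norm (H2_inner G (phi \<alpha> w) - H2_inner G (phi \<alpha> z)) \<le> sqrt (H2.nsq G * D w)" if w: "w \<in> tube" for w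
      proof -
        have "H2_inner G (\<lambda>x. phi \<alpha> w x + (-1) * phi \<alpha> z x) = H2_inner G (phi \<alpha> w) - H2_inner G (phi \<alpha> z)"
          using H2.ip_lin_right[OF phi_H2[OF w] phi_H2[OF z] G, of \<alpha> "-1" \<alpha>] by simp
        with H2.Cauchy_Schwarz_ip[OF G H2.lin_closed[OF phi_H2[OF w] phi_H2[OF z]], of \<alpha> "-1" \<alpha>]
        have "(norm (H2_inner G (phi \<alpha> w) - H2_inner G (phi \<alpha> z)))\<^sup>2 \<le> H2.nsq G * D w"
          unfolding D[OF w] by (simp only:)
        then show ?thesis by (rule real_le_rsqrt)
      qed
      then show "\<forall>\<^sub>F w in at z within tube. norm (H2_inner G (phi \<alpha> w) - H2_inner G (phi \<alpha> z)) \<le> sqrt (H2.nsq G * D w)"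
        by (auto simp: eventually_at_filter)
    qed
    then show "((\<lambda>z. H2_inner G (phi \<alpha> z)) \<longlongrightarrow> H2_inner G (phi \<alpha> z)) (at z within tube)"
      by (simp add: LIM_zero_iff)
  qed
  then have "continuous_on tube (\<lambda>z. cmod (H2_inner G (phi \<alpha> z) / of_real (sqrt (H2.nsq (phi \<alpha> z)))))"
    using nsq_phi_pos[of _ \<alpha>] by (intro continuous_intros nsq_cont) (auto simp: less_imp_neq[symmetric])
  then show ?thesis by (rule continuous_on_eq) (simp add: H2_inner_psi_right[OF G])
qed

lemma compact_param_box:
  assumes R: "R > 0"
  shows "compact {z :: complex^'n. \<forall>k. \<bar>Re (z $ k)\<bar> \<le> R \<and> inverse R \<le> Im (z $ k) \<and> Im (z $ k) \<le> R}" (is "compact ?Z")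
  unfolding compact_eq_bounded_closed
proof
  show "closed ?Z"
    by (intro closed_Collect_all closed_Collect_conj closed_Collect_le continuous_intros)
  show "bounded ?Z"
    unfolding bounded_iff
  proof (intro exI ballI)
    fix z :: "complex^'n" assume z: "z \<in> ?Z"
    have "norm z \<le> (\<Sum>k\<in>UNIV. norm (z $ k))"
      unfolding norm_vec_def by (rule L2_set_le_sum) simp
    also have "\<dots> \<le> (\<Sum>k\<in>(UNIV :: 'n set). R + R)"
    proof (intro sum_mono)
      fix k
      have "\<bar>Re (z $ k)\<bar> \<le> R" "inverse R \<le> Im (z $ k)" "Im (z $ k) \<le> R" using z by blast+
      moreover have "0 < inverse R" using R by simp
      ultimately have "\<bar>Re (z $ k)\<bar> + \<bar>Im (z $ k)\<bar> \<le> R + R" by linarith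
      then show "norm (z $ k) \<le> R + R" using cmod_le[of "z $ k"] by linarith
    qed
    finally show "norm z \<le> (\<Sum>k\<in>(UNIV :: 'n set). R + R)" .
  qed
qed

lemma finite_bounded_multi_indices: "finite {\<alpha> :: nat^'n. \<forall>k. real (\<alpha> $ k) \<le> R}"
proof (rule finite_subset)
  show "{\<alpha> :: nat^'n. \<forall>k. real (\<alpha> $ k) \<le> R} \<subseteq> vec_lambda ` (PiE UNIV (\<lambda>_. {..nat \<lfloor>R\<rfloor>}))"
  proof
    fix \<alpha> :: "nat^'n" assume "\<alpha> \<in> {\<alpha>. \<forall>k. real (\<alpha> $ k) \<le> R}"
    then have "vec_nth \<alpha> \<in> PiE UNIV (\<lambda>_. {..nat \<lfloor>R\<rfloor>})" by (auto simp: PiE_def le_nat_floor)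
    then have "vec_lambda (vec_nth \<alpha>) \<in> vec_lambda ` (PiE UNIV (\<lambda>_. {..nat \<lfloor>R\<rfloor>}))" by (rule imageI)
    then show "\<alpha> \<in> vec_lambda ` (PiE UNIV (\<lambda>_. {..nat \<lfloor>R\<rfloor>}))" by simp
  qed
qed (intro finite_imageI finite_PiE, auto)

text \<open>The supremum is taken in \<open>ennreal\<close>, where it always exists; a member of the
  dictionary attains it exactly when it dominates all others, which is a statement about
  reals.\<close>

lemma optimal_choice_iff:
  "optimal_choice G \<alpha> z \<longleftrightarrow> z \<in> tube \<and>
    (\<forall>\<beta> \<zeta>. \<zeta> \<in> tube \<longrightarrow> cmod (H2_inner G (psi \<beta> \<zeta>)) \<le> cmod (H2_inner G (psi \<alpha> z)))"
proof (cases "z \<in> tube")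
  case True
  then have "psi \<alpha> z \<in> dictionary" unfolding dictionary_def by blast
  then have "ennreal (cmod (H2_inner G (psi \<alpha> z))) \<le> (SUP \<psi>\<in>dictionary. ennreal (cmod (H2_inner G \<psi>)))"
    by (rule SUP_upper)
  then have "optimal_choice G \<alpha> z \<longleftrightarrow> (SUP \<psi>\<in>dictionary. ennreal (cmod (H2_inner G \<psi>))) \<le> ennreal (cmod (H2_inner G (psi \<alpha> z)))"
    unfolding optimal_choice_def using True by (auto intro: antisym)
  also have "\<dots> \<longleftrightarrow> (\<forall>\<psi>\<in>dictionary. cmod (H2_inner G \<psi>) \<le> cmod (H2_inner G (psi \<alpha> z)))"
    by (simp add: SUP_le_iff)
  finally show ?thesis using True unfolding dictionary_def by auto
qed (simp add: optimal_choice_def)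

theorem optimal_choice_exists:
  fixes G :: "complex^'n \<Rightarrow> complex"
  assumes G: "G \<in> H2"
  shows "\<exists>\<alpha> z. optimal_choice G \<alpha> z"
proof -
  let ?J = "\<lambda>\<alpha> z. cmod (H2_inner G (psi \<alpha> z))"
  define z1 :: "complex^'n" where "z1 = (\<chi> k. \<i>)"
  have z1: "z1 \<in> tube" by (simp add: z1_def tube_iff)
  show ?thesis
  proof (cases "\<exists>\<alpha> z. z \<in> tube \<and> ?J \<alpha> z \<noteq> 0")
    \<comment> \<open>If all correlations vanish, any parameter is optimal. This case is separate
      because \<open>inner_psi_vanishes\<close> requires a positive level.\<close>
    case False
    then have "optimal_choice G 0 z1" unfolding optimal_choice_iff using z1 by auto
    then show ?thesis by blast
  next
    case True
    then obtain \<alpha>0 z0 where z0: "z0 \<in> tube" "?J \<alpha>0 z0 > 0" by auto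
    obtain R where R: "R > 0"
      and box: "\<And>\<alpha> z k. z \<in> tube \<Longrightarrow> ?J \<alpha>0 z0 \<le> ?J \<alpha> z \<Longrightarrow> param_box R (\<alpha> $ k) (z $ k)"
      using inner_psi_vanishes[OF G z0(2)] by blast
    let ?Z = "{z :: complex^'n. \<forall>k. \<bar>Re (z $ k)\<bar> \<le> R \<and> inverse R \<le> Im (z $ k) \<and> Im (z $ k) \<le> R}"
    let ?A = "{\<alpha> :: nat^'n. \<forall>k. real (\<alpha> $ k) \<le> R}"
    have inbox: "\<alpha> \<in> ?A \<and> z \<in> ?Z" if "z \<in> tube" "?J \<alpha>0 z0 \<le> ?J \<alpha> z" for \<alpha> z
      using box[OF that] by (simp add: param_box_def)
    have Zt: "?Z \<subseteq> tube"
    proof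
      fix z :: "complex^'n" assume "z \<in> ?Z"
      then have "inverse R \<le> Im (z $ k)" for k by blast
      moreover have "0 < inverse R" using R by simp
      ultimately show "z \<in> tube" unfolding tube_iff using less_le_trans by blast
    qed
    have ne: "?Z \<noteq> {}" "?A \<noteq> {}" using inbox[OF z0(1) order_refl] by blast+
    \<comment> \<open>For each index a maximum over the compact set of points, then a maximum over
      the finitely many indices in the box; parameters outside stay below the value at
      \<open>\<alpha>0\<close>, \<open>z0\<close>.\<close>
    have "\<forall>\<alpha>. \<exists>z. z \<in> ?Z \<and> (\<forall>w\<in>?Z. ?J \<alpha> w \<le> ?J \<alpha> z)"
    proof
      fix \<alpha>
      have "\<exists>z\<in>?Z. \<forall>w\<in>?Z. ?J \<alpha> w \<le> ?J \<alpha> z"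
        by (rule continuous_attains_sup[OF compact_param_box[OF R] ne(1) continuous_on_subset[OF continuous_on_inner_psi[OF G] Zt]])
      then show "\<exists>z. z \<in> ?Z \<and> (\<forall>w\<in>?Z. ?J \<alpha> w \<le> ?J \<alpha> z)" by (simp only: Bex_def)
    qed
    from choice[OF this] obtain m where m: "\<forall>\<alpha>. m \<alpha> \<in> ?Z \<and> (\<forall>w\<in>?Z. ?J \<alpha> w \<le> ?J \<alpha> (m \<alpha>))"
      by (elim exE) (rule that)
    define M where "M \<alpha> = ?J \<alpha> (m \<alpha>)" for \<alpha>
    have fin: "finite (M ` ?A)" by (intro finite_imageI finite_bounded_multi_indices)
    have "Max (M ` ?A) \<in> M ` ?A" by (rule Max_in[OF fin]) (use ne(2) in blast)
    then obtain \<alpha>s where \<alpha>s: "Max (M ` ?A) = M \<alpha>s" by (elim imageE) (rule that)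
    have max: "M \<alpha> \<le> M \<alpha>s" if "\<alpha> \<in> ?A" for \<alpha>
      using Max_ge[OF fin imageI[OF that, of M]] unfolding \<alpha>s .
    have le: "?J \<alpha> z \<le> ?J \<alpha>s (m \<alpha>s)" if "z \<in> tube" "?J \<alpha>0 z0 \<le> ?J \<alpha> z" for \<alpha> z
    proof -
      have "?J \<alpha> z \<le> M \<alpha>" unfolding M_def using inbox[OF that] m by blast
      also have "\<dots> \<le> M \<alpha>s" using inbox[OF that] by (intro max) blast
      finally show ?thesis unfolding M_def .
    qed
    have "?J \<alpha> z \<le> ?J \<alpha>s (m \<alpha>s)" if "z \<in> tube" for \<alpha> z
      using le[OF that, of \<alpha>] le[OF z0(1) order_refl] by linarith
    then have "optimal_choice G \<alpha>s (m \<alpha>s)"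
      unfolding optimal_choice_iff using m Zt by blast
    then show ?thesis by blast
  qed
qed

subsection \<open>Convergence\<close>

text \<open>Only the parameters up to \<open>l\<close> are constrained, since existence at a given
  step may presume nothing about later choices.\<close>

lemma remainder_H2:
  assumes F: "F \<in> H2" and z: "\<And>k. 1 \<le> k \<Longrightarrow> k \<le> l \<Longrightarrow> z k \<in> tube"
  shows "remainder F \<alpha> z l \<in> H2"
  using z
proof (induction l)
  case 0
  then show ?case using F by simp
next
  case (Suc l)
  have R: "remainder F \<alpha> z l \<in> H2" and zl: "z (Suc l) \<in> tube" using Suc by simp_all
  from H2.lin_closed[OF R psi_H2[OF zl, of "\<alpha> (Suc l)"], of "- H2_inner (remainder F \<alpha> z l) (psi (\<alpha> (Suc l)) (z (Suc l)))"]
  show ?case by simp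
qed

text \<open>The remainders form a Cauchy sequence, and by the reproducing formula they tend to 0
  pointwise; Fatou's lemma on each slice identifies the limit as 0 in norm.\<close>

lemma remainder_norm_tendsto_0:
  fixes F :: "complex^'n \<Rightarrow> complex"
  assumes F: "F \<in> H2" and opt: "\<And>l. l \<ge> 1 \<Longrightarrow> optimal_choice (remainder F \<alpha> z (l - 1)) (\<alpha> l) (z l)"
  shows "(\<lambda>m. H2_norm (remainder F \<alpha> z m)) \<longlonglongrightarrow> 0"
proof -
  let ?R = "remainder F \<alpha> z"
  have zt: "z l \<in> tube" if "l \<ge> 1" for l using opt[OF that] by (simp add: optimal_choice_def)
  have RH: "?R l \<in> H2" for l using zt by (intro remainder_H2[OF F]) simp
  \<comment> \<open>The locale counts chosen elements from 0, the parameter sequences from 1; hence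
    \<open>Suc l\<close>.\<close>
  interpret G: greedy H2 H2_inner dictionary ?R "\<lambda>l. psi (\<alpha> (Suc l)) (z (Suc l))"
  proof
    show "dictionary \<subseteq> (H2 :: (complex^'n \<Rightarrow> complex) set)" by (auto simp: dictionary_def psi_H2)
    show "H2.nsq \<psi> = 1" if "\<psi> \<in> dictionary" for \<psi> :: "complex^'n \<Rightarrow> complex"
      using that by (auto simp: dictionary_def nsq_psi)
    show "?R 0 \<in> H2" by (rule RH)
    show "?R (Suc l) = (\<lambda>w. ?R l w - H2_inner (?R l) (psi (\<alpha> (Suc l)) (z (Suc l))) * psi (\<alpha> (Suc l)) (z (Suc l)) w)" for l
      by simp
    show "psi (\<alpha> (Suc l)) (z (Suc l)) \<in> dictionary" for l
      using zt[of "Suc l"] by (auto simp: dictionary_def)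
    show "cmod (H2_inner (?R l) \<psi>) \<le> cmod (H2_inner (?R l) (psi (\<alpha> (Suc l)) (z (Suc l))))" if "\<psi> \<in> dictionary" for l \<psi>
      using opt[of "Suc l"] that unfolding optimal_choice_iff dictionary_def by auto
  qed
  have pointwise: "(\<lambda>l. ?R l w) \<longlonglongrightarrow> 0" if w: "w \<in> tube" for w
  proof -
    let ?c = "complex_of_real (sqrt (H2.nsq (phi 0 w)))"
    have c: "?c \<noteq> 0" using nsq_phi_pos[OF w, of 0] by simp
    have "psi 0 w \<in> dictionary" using w by (auto simp: dictionary_def)
    from tendsto_mult_right_zero[OF G.residual_inner_tendsto_0[OF this], of ?c]
    have "(\<lambda>l. ?c * H2_inner (?R l) (psi 0 w)) \<longlonglongrightarrow> 0" .
    then show ?thesis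
      using c by (simp add: H2_inner_psi_right[OF RH w] reproducing[OF RH w])
  qed
  show ?thesis
  proof (rule LIMSEQ_I)
    fix r :: real assume r: "r > 0"
    \<comment> \<open>Its square root r/2 leaves room for the strict inequality below r.\<close>
    define e where "e = (r / 2)\<^sup>2"
    have e: "e > 0" using r by (simp add: e_def)
    obtain N where N: "\<forall>n\<ge>N. \<forall>p\<ge>N. H2.nsq (\<lambda>w. ?R n w + (-1) * ?R p w) \<le> e"
      using G.residual_Cauchy[OF e] by (elim exE) (rule that)
    have "norm (H2_norm (?R n) - 0) < r" if n: "n \<ge> N" for n
    proof -
      have "H2_energy (?R n) \<le> ennreal e"
        unfolding H2_energy_def
      proof (rule SUP_least)
        fix y :: "real^'n" assume y: "y \<in> octant"
        have [measurable]: "(\<lambda>x. ?R l (cvec x y)) \<in> borel_measurable borel" for l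
          using slice_measurable[OF continuous_on_H2[OF RH] y] by (simp add: slice_def[abs_def])
        have "(\<integral>\<^sup>+ x. ennreal ((cmod (?R n (cvec x y)))\<^sup>2) \<partial>lborel)
            \<le> (\<integral>\<^sup>+ x. liminf (\<lambda>p. ennreal ((cmod (?R n (cvec x y) + (-1) * ?R p (cvec x y)))\<^sup>2)) \<partial>lborel)"
        proof (intro nn_integral_mono)
          fix x :: "real^'n"
          have "cvec x y \<in> tube" using y by simp
          note P = pointwise[OF this]
          have "(\<lambda>p. ennreal ((cmod (?R n (cvec x y) + (-1) * ?R p (cvec x y)))\<^sup>2)) \<longlonglongrightarrow> ennreal ((cmod (?R n (cvec x y) + (-1) * 0))\<^sup>2)"
            by (intro tendsto_intros P)
          from lim_imp_Liminf[OF sequentially_bot this]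
          show "ennreal ((cmod (?R n (cvec x y)))\<^sup>2) \<le> liminf (\<lambda>p. ennreal ((cmod (?R n (cvec x y) + (-1) * ?R p (cvec x y)))\<^sup>2))"
            by simp
        qed
        also have "\<dots> \<le> liminf (\<lambda>p. \<integral>\<^sup>+ x. ennreal ((cmod (?R n (cvec x y) + (-1) * ?R p (cvec x y)))\<^sup>2) \<partial>lborel)"
          by (intro nn_integral_liminf) measurable
        also have "\<dots> \<le> ennreal e"
        proof (rule Liminf_le)
          show "\<forall>\<^sub>F p in sequentially. (\<integral>\<^sup>+ x. ennreal ((cmod (?R n (cvec x y) + (-1) * ?R p (cvec x y)))\<^sup>2) \<partial>lborel) \<le> ennreal e"
            using eventually_ge_at_top[of N]
          proof eventually_elim
            case (elim p)
            have "(\<integral>\<^sup>+ x. ennreal ((cmod (?R n (cvec x y) + (-1) * ?R p (cvec x y)))\<^sup>2) \<partial>lborel)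
                \<le> ennreal (H2.nsq (\<lambda>w. ?R n w + (-1) * ?R p w))"
              by (rule nn_integral_slice_le_nsq[OF H2_lin[OF RH RH] y])
            also have "\<dots> \<le> ennreal e" using N n elim by (intro ennreal_leI) blast
            finally show ?case .
          qed
        qed simp
        finally show "(\<integral>\<^sup>+ x. ennreal ((cmod (?R n (cvec x y)))\<^sup>2) \<partial>lborel) \<le> ennreal e" .
      qed
      then have "enn2real (H2_energy (?R n)) \<le> e" using e by (intro enn2real_leI) auto
      then have "H2_norm (?R n) \<le> sqrt e" unfolding H2_norm_def by (rule real_sqrt_le_mono)
      also have "\<dots> = r / 2" using r by (simp add: e_def)
      finally show ?thesis using r by (simp add: H2_norm_def)
    qed
    then show "\<exists>no. \<forall>n\<ge>no. norm (H2_norm (?R n) - 0) < r" by blast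
  qed
qed

text \<open>Existence at step \<open>l\<close> presumes only that the earlier choices were optimal,
  so optimal parameters can be chosen successively; convergence then holds for every sequence
  obtained in this way.\<close>

theorem mainTheorem8:
  fixes F :: "complex^'n \<Rightarrow> complex"
  assumes "F \<in> H2"
  shows "(\<forall>(\<alpha> :: nat \<Rightarrow> nat^'n) (z :: nat \<Rightarrow> complex^'n) (l :: nat).
            1 \<le> l \<longrightarrow>
            (\<forall>k. 1 \<le> k \<and> k < l \<longrightarrow> optimal_choice (remainder F \<alpha> z (k - 1)) (\<alpha> k) (z k)) \<longrightarrow>
            (\<exists>\<beta> \<zeta>. optimal_choice (remainder F \<alpha> z (l - 1)) \<beta> \<zeta>))
       \<and> (\<forall>(\<alpha> :: nat \<Rightarrow> nat^'n) (z :: nat \<Rightarrow> complex^'n).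
            (\<forall>l\<ge>1. optimal_choice (remainder F \<alpha> z (l - 1)) (\<alpha> l) (z l)) \<longrightarrow>
            (\<lambda>m. H2_norm (remainder F \<alpha> z m)) \<longlonglongrightarrow> 0)"
proof (intro conjI allI impI)
  fix \<alpha> :: "nat \<Rightarrow> nat^'n" and z :: "nat \<Rightarrow> complex^'n" and l :: nat
  assume opt: "\<forall>k. 1 \<le> k \<and> k < l \<longrightarrow> optimal_choice (remainder F \<alpha> z (k - 1)) (\<alpha> k) (z k)"
    and l: "1 \<le> l"
  have "z k \<in> tube" if "1 \<le> k" "k \<le> l - 1" for k
    using opt[rule_format, of k] that l by (simp add: optimal_choice_def)
  then show "\<exists>\<beta> \<zeta>. optimal_choice (remainder F \<alpha> z (l - 1)) \<beta> \<zeta>"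
    by (intro optimal_choice_exists remainder_H2 assms)
next
  fix \<alpha> :: "nat \<Rightarrow> nat^'n" and z :: "nat \<Rightarrow> complex^'n"
  assume "\<forall>l\<ge>1. optimal_choice (remainder F \<alpha> z (l - 1)) (\<alpha> l) (z l)"
  then show "(\<lambda>m. H2_norm (remainder F \<alpha> z m)) \<longlonglongrightarrow> 0"
    by (intro remainder_norm_tendsto_0 assms) blast
qed

end
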